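(* Let $\Omega\subset\mathbb{C}^+=\{z=t+\mathbf{i}s\in\mathbb{C}: s>0\}$ be open, let $f(z)=u(t,s)+\mathbf{i}v(t,s)$, $z=t+\mathbf{i}s$ ($u,v$ real-valued), be a complex-valued holomorphic function in $\Omega$, and let $P_n(x_0,\underline{x})$ be an $\mathbb{R}_{0,d}$-valued homogeneous polynomial of degree $n\in\mathbb{N}_0$ in $\mathbb{R}^d_1$ that is Dunkl-monogenic, i.e. $DP_n=0$. If $\mu$ is an odd integer, then the function $$\Delta^{n+\frac{\mu-1}{2}}\left(\left(u(x_0,|\underline{x}|)+\frac{\underline{x}}{|\underline{x}|}v(x_0,|\underline{x}|)\right)P_n(x_0,\underline{x})\right)$$ is Dunkl-monogenic in $\vec{\Omega}=\{x=x_0+\underline{x}\in\mathbb{R}^d_1: (x_0,|\underline{x}|)\in\Omega\}$, i.e. it is annihilated by the Dunkl-Cauchy-Riemann operator $D$ there.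
   Context: $\mathbb{R}_{0,d}$ is the real Clifford algebra of dimension $2^d$ generated by an orthonormal basis $\mathbf{e}_1,\dots,\mathbf{e}_d$ of $\mathbb{R}^d$ with $\mathbf{e}_i\mathbf{e}_j+\mathbf{e}_j\mathbf{e}_i=-2\delta_{ij}$. A vector of $\mathbb{R}^d$ is identified with $\underline{x}=\sum_{i=1}^d x_i\mathbf{e}_i$, and $\mathbb{R}^d_1$ denotes the space of elements $x=x_0+\underline{x}$ with $x_0\in\mathbb{R}$, $\underline{x}\in\mathbb{R}^d$. Complex-plane points $z=t+\mathbf{i}s$ are identified with $(t,s)\in\mathbb{R}^2$. $R$ is a (reduced) root system: a finite set of nonzero vectors with $R\cap\mathbb{R}\alpha=\{\alpha,-\alpha\}$ and $\sigma_\alpha R=R$ for all $\alpha\in R$, where $\sigma_\alpha x=x-2\frac{\langle\alpha,x\rangle}{|\alpha|^2}\alpha$. $W$ is the finite reflection group generated by the $\sigma_\alpha$. It is assumed that $W$ leaves the $x_0$-axis invariant, in the sense that all roots lie in $\mathbb{R}^d$ (so the reflections act only on $\underline{x}$). $R_+\subset R$ is a fixed positive subsystem, $\kappa:R\to[0,\infty)$ is a $W$-invariant function (multiplicity function), $\gamma_\kappa=\sum_{\alpha\in R_+}\kappa(\alpha)$ is assumed to satisfy $\gamma_\kappa>0$, and $\mu=2\gamma_\kappa+d$ is the Dunkl-dimension. The Dunkl operators are $$T_{x_i}f(x)=\frac{\partial f}{\partial x_i}(x)+\sum_{\alpha\in R_+}\kappa(\alpha)\frac{f(x)-f(\sigma_\alpha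 x)}{\langle\alpha,x\rangle}\alpha_i,\quad i=0,1,\dots,d,$$ acting on functions on $W$-invariant open sets (componentwise on $\mathbb{R}_{0,d}$-valued functions; the quotient is understood as its limit where $\langle\alpha,x\rangle=0$); in particular $T_{x_0}=\partial_{x_0}$. The Dunkl-Dirac operator is $\underline{D}f=\sum_{i=1}^d\mathbf{e}_iT_{x_i}f$ (left multiplication), the Dunkl-Cauchy-Riemann operator is $D=\partial_{x_0}+\underline{D}$, and the Dunkl Laplacian in $\mathbb{R}^d_1$ is $\Delta=\partial_{x_0}^2+\sum_{i=1}^dT_{x_i}^2$. Functions on (open subsets of) $\mathbb{R}^d_1$ in the kernel of $D$ are called Dunkl-monogenic. *)

theory Defs
  imports "HOL-Analysis.Analysis"
begin

section \<open>The Clifford algebra of signature (0,d)\<close>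

text \<open>
  The dimension \<open>d\<close> is \<open>CARD('n)\<close>. Elements of the Clifford algebra are families of
  real coefficients indexed by the subsets \<open>A\<close> of the index type, with respect to the basis
  of ordered products \<open>e_A = e_(i1) \<dots> e_(ik)\<close> for \<open>A = {i1 < \<dots> < ik}\<close>; the linear order on
  \<open>'n\<close> serves only to fix this basis.
\<close>

type_synonym 'n clifford = "(real, 'n set) vec"

definition cl_basis :: "'n set \<Rightarrow> 'n::finite clifford"
  where "cl_basis A = axis A 1"

text \<open>
  Sorting the product \<open>e_A e_B\<close> costs one sign for each pair \<open>j < i\<close> with \<open>i \<in> A\<close> and
  \<open>j \<in> B\<close> (anticommutation), and one for each \<open>i \<in> A \<inter> B\<close> (from \<open>e_i e_i = -1\<close>).
\<close>

definition cl_sign :: "'n::{finite,linorder} set \<Rightarrow> 'n set \<Rightarrow> real"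
  where "cl_sign A B = (-1) ^ card {(i, j). i \<in> A \<and> j \<in> B \<and> j \<le> i}"

definition cl_mult :: "'n::{finite,linorder} clifford \<Rightarrow> 'n clifford \<Rightarrow> 'n clifford"
    (infixl "\<odot>" 70)
  where "x \<odot> y =
    (\<Sum>A\<in>UNIV. \<Sum>B\<in>UNIV. (x $ A * y $ B * cl_sign A B) *\<^sub>R cl_basis ((A - B) \<union> (B - A)))"

definition cl_one :: "'n::finite clifford"
  where "cl_one = cl_basis {}"

definition cl_gen :: "'n \<Rightarrow> 'n::finite clifford"
  where "cl_gen i = cl_basis {i}"

definition cl_vec :: "real ^ 'n \<Rightarrow> 'n::finite clifford"
  where "cl_vec x = (\<Sum>i\<in>UNIV. (x $ i) *\<^sub>R cl_gen i)"

text \<open>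
  The following facts confirm that \<open>\<odot>\<close> is the product of the Clifford algebra: it makes
  \<open>'n clifford\<close> an associative unital algebra of dimension \<open>2 ^ d\<close>, the generators satisfy the
  defining relations, and the basis consists of their ordered products.
\<close>

lemma cl_sign_prod: "cl_sign A B = (\<Prod>i\<in>A. \<Prod>j\<in>B. if j \<le> i then -1 else 1)"
proof -
  have "(\<Prod>i\<in>A. \<Prod>j\<in>B. if j \<le> i then -1 else (1::real))
      = (\<Prod>p\<in>A \<times> B. if snd p \<le> fst p then -1 else 1)"
    by (simp add: prod.cartesian_product case_prod_unfold)
  also have "\<dots> = (\<Prod>p\<in>{p \<in> A \<times> B. snd p \<le> fst p}. -1)"
    by (rule prod.inter_filter[symmetric]) simp
  also have "{p \<in> A \<times> B. snd p \<le> fst p} = {(i, j). i \<in> A \<and> j \<in> B \<and> j \<le> i}"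
    by auto
  finally show ?thesis by (simp add: cl_sign_def)
qed

lemma prod_symdiff_sign:
  fixes h :: "'n::finite \<Rightarrow> real"
  assumes "\<And>i. h i * h i = 1"
  shows "prod h ((A - B) \<union> (B - A)) = prod h A * prod h B"
proof -
  have A: "prod h A = prod h (A - B) * prod h (A \<inter> B)"
    using prod.Int_Diff[of A h B] by (simp add: mult.commute)
  have B: "prod h B = prod h (B - A) * prod h (A \<inter> B)"
    using prod.Int_Diff[of B h A] by (simp add: mult.commute Int_commute)
  have 1: "prod h (A \<inter> B) * prod h (A \<inter> B) = 1"
    by (simp add: prod.distrib[symmetric] assms)
  have "prod h ((A - B) \<union> (B - A)) = prod h (A - B) * prod h (B - A)"
    by (rule prod.union_disjoint) auto
  also have "\<dots> = prod h A * prod h B"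
    using 1 by (simp add: A B mult_ac)
  finally show ?thesis .
qed

lemma cl_sign_symdiff_left: "cl_sign ((A - B) \<union> (B - A)) C = cl_sign A C * cl_sign B C"
  unfolding cl_sign_prod
  by (rule prod_symdiff_sign) (auto simp: prod.distrib[symmetric] intro!: prod.neutral)

lemma cl_sign_symdiff_right: "cl_sign A ((B - C) \<union> (C - B)) = cl_sign A B * cl_sign A C"
  unfolding cl_sign_prod prod.distrib[symmetric]
  by (intro prod.cong refl prod_symdiff_sign) auto

lemma bilinear_cl_mult: "bilinear (\<odot>)"
  unfolding bilinear_def
  by (intro allI conjI linearI)
    (simp_all add: cl_mult_def distrib_left distrib_right scaleR_add_left sum.distrib
      scaleR_sum_right mult_ac)

lemma cl_mult_basis: "cl_basis A \<odot> cl_basis B = cl_sign A B *\<^sub>R cl_basis ((A - B) \<union> (B - A))"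
proof -
  have "cl_basis A \<odot> cl_basis B = (\<Sum>A'\<in>UNIV. \<Sum>B'\<in>UNIV. if A' = A then if B' = B then
      cl_sign A B *\<^sub>R cl_basis ((A - B) \<union> (B - A)) else 0 else 0)"
    unfolding cl_mult_def by (intro sum.cong refl) (auto simp: cl_basis_def axis_def)
  also have "\<dots> = (\<Sum>A'\<in>UNIV. if A' = A then \<Sum>B'\<in>UNIV. if B' = B then
      cl_sign A B *\<^sub>R cl_basis ((A - B) \<union> (B - A)) else 0 else 0)"
    by (intro sum.cong refl) auto
  finally show ?thesis by simp
qed

lemma linear_cl_mult: "linear (\<lambda>x. x \<odot> y)" "linear (\<lambda>y. x \<odot> y)"
  using bilinear_cl_mult by (auto simp: bilinear_def)

lemma cl_linear_eq:
  fixes f g :: "'n::finite clifford \<Rightarrow> 'n clifford"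
  assumes "linear f" "linear g" "\<And>A. f (cl_basis A) = g (cl_basis A)"
  shows "f x = g x"
proof -
  have "f = g"
    by (rule linear_eq_stdbasis) (use assms in \<open>auto simp: Basis_vec_def cl_basis_def\<close>)
  then show ?thesis by simp
qed

lemma cl_mult_assoc: "(x \<odot> y) \<odot> z = x \<odot> (y \<odot> z)"
proof -
  have lin: "linear (\<lambda>x. f x \<odot> y)" "linear (\<lambda>x. y \<odot> f x)" if "linear f"
    for f :: "'a clifford \<Rightarrow> 'a clifford" and y
    using linear_compose[OF that linear_cl_mult(1)[of y]]
      linear_compose[OF that linear_cl_mult(2)[of y]] by (simp_all add: o_def)
  have sd: "(((A - B) \<union> (B - A)) - C) \<union> (C - ((A - B) \<union> (B - A)))
      = (A - ((B - C) \<union> (C - B))) \<union> (((B - C) \<union> (C - B)) - A)" for A B C :: "'a set"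
    by auto
  have basis: "(cl_basis A \<odot> cl_basis B) \<odot> cl_basis C
      = cl_basis A \<odot> (cl_basis B \<odot> cl_basis C)" for A B C :: "'a set"
    by (simp only: cl_mult_basis linear_cmul[OF linear_cl_mult(1)]
        linear_cmul[OF linear_cl_mult(2)] sd cl_sign_symdiff_left cl_sign_symdiff_right
        scaleR_scaleR mult_ac)
  have "(cl_basis A \<odot> cl_basis B) \<odot> z = cl_basis A \<odot> (cl_basis B \<odot> z)" for A B
    by (rule cl_linear_eq) (intro lin linear_cl_mult linear_ident basis)+
  then have "(cl_basis A \<odot> y) \<odot> z = cl_basis A \<odot> (y \<odot> z)" for A
    by - (rule cl_linear_eq, (intro lin linear_cl_mult linear_ident | assumption | simp)+)
  then show ?thesis
    by - (rule cl_linear_eq, (intro lin linear_cl_mult linear_ident | assumption | simp)+)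
qed

lemma cl_mult_one: "cl_one \<odot> x = x" "x \<odot> cl_one = x"
proof -
  show "cl_one \<odot> x = x"
    by (rule cl_linear_eq) (auto simp: linear_cl_mult linear_ident cl_one_def cl_mult_basis cl_sign_def)
  show "x \<odot> cl_one = x"
    by (rule cl_linear_eq) (auto simp: linear_cl_mult linear_ident cl_one_def cl_mult_basis cl_sign_def)
qed

lemma cl_gen_relation:
  "cl_gen i \<odot> cl_gen j + cl_gen j \<odot> cl_gen i = (if i = j then -2 *\<^sub>R cl_one else 0)"
  by (auto simp: cl_gen_def cl_one_def cl_mult_basis cl_sign_prod scaleR_2 insert_commute)

lemma cl_basis_insert:
  assumes "\<And>i. i \<in> A \<Longrightarrow> i < j"
  shows "cl_basis (insert j A) = cl_basis A \<odot> cl_gen j"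
proof -
  have "j \<notin> A" using assms by auto
  then have "(A - {j}) \<union> ({j} - A) = insert j A" by auto
  moreover have "cl_sign A {j} = 1"
    unfolding cl_sign_prod by (intro prod.neutral) (use assms in force)
  ultimately show ?thesis by (simp add: cl_gen_def cl_mult_basis)
qed

lemma DIM_clifford: "DIM('n::finite clifford) = 2 ^ CARD('n)"
  by (simp add: card_Pow[of "UNIV :: 'n set", simplified])


section \<open>Root systems\<close>

definition reflection :: "real ^ 'n \<Rightarrow> real ^ 'n \<Rightarrow> real ^ 'n"
  where "reflection \<alpha> x = x - (2 * (\<alpha> \<bullet> x) / (norm \<alpha>)\<^sup>2) *\<^sub>R \<alpha>"

definition root_system :: "(real ^ 'n) set \<Rightarrow> bool"
  where "root_system R \<longleftrightarrow> finite R \<and> 0 \<notin> R \<and>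
    (\<forall>\<alpha>\<in>R. R \<inter> range (\<lambda>c. c *\<^sub>R \<alpha>) = {\<alpha>, - \<alpha>}) \<and>
    (\<forall>\<alpha>\<in>R. reflection \<alpha> ` R = R)"

text \<open>Reflections are involutions, so closing under composition already yields a group.\<close>

inductive_set reflection_group :: "(real ^ 'n) set \<Rightarrow> (real ^ 'n \<Rightarrow> real ^ 'n) set"
  for R :: "(real ^ 'n) set"
  where
    id: "id \<in> reflection_group R"
  | step: "w \<in> reflection_group R \<Longrightarrow> \<alpha> \<in> R \<Longrightarrow> reflection \<alpha> \<circ> w \<in> reflection_group R"

definition positive_subsystem :: "(real ^ 'n) set \<Rightarrow> (real ^ 'n) set \<Rightarrow> bool"
  where "positive_subsystem R Rp \<longleftrightarrow>
    (\<exists>\<beta>. (\<forall>\<alpha>\<in>R. \<alpha> \<bullet> \<beta> \<noteq> 0) \<and> Rp = {\<alpha>\<in>R. \<alpha> \<bullet> \<beta> > 0})"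

definition multiplicity_function :: "(real ^ 'n) set \<Rightarrow> (real ^ 'n \<Rightarrow> real) \<Rightarrow> bool"
  where "multiplicity_function R \<kappa> \<longleftrightarrow>
    (\<forall>\<alpha>\<in>R. \<kappa> \<alpha> \<ge> 0) \<and> (\<forall>w\<in>reflection_group R. \<forall>\<alpha>\<in>R. \<kappa> (w \<alpha>) = \<kappa> \<alpha>)"

definition gamma_kappa :: "(real ^ 'n) set \<Rightarrow> (real ^ 'n \<Rightarrow> real) \<Rightarrow> real"
  where "gamma_kappa Rp \<kappa> = (\<Sum>\<alpha>\<in>Rp. \<kappa> \<alpha>)"

definition dunkl_dim :: "(real ^ 'n) set \<Rightarrow> (real ^ 'n \<Rightarrow> real) \<Rightarrow> real"
  where "dunkl_dim Rp \<kappa> = 2 * gamma_kappa Rp \<kappa> + real CARD('n)"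


section \<open>Dunkl operators\<close>

text \<open>
  A point \<open>x\<^sub>0 + \<Sum>i. x\<^sub>i e\<^sub>i\<close> of the paravector space is the pair of \<open>x\<^sub>0\<close> and
  \<open>(x\<^sub>i)\<^sub>i\<close>. The reflections act on the second component only.
\<close>

type_synonym 'n paravec = "real \<times> (real, 'n) vec"

definition dir_deriv ::
    "'n paravec \<Rightarrow> ('n::finite paravec \<Rightarrow> 'b::real_normed_vector) \<Rightarrow> 'n paravec \<Rightarrow> 'b"
  where "dir_deriv v f x = vector_derivative (\<lambda>t. f (x + t *\<^sub>R v)) (at 0)"

definition dunkl_quotient ::
    "real ^ 'n \<Rightarrow> ('n::finite paravec \<Rightarrow> 'b::real_normed_vector) \<Rightarrow> 'n paravec \<Rightarrow> 'b"
  where "dunkl_quotient \<alpha> f x =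
    (let q = (\<lambda>y. (f y - f (fst y, reflection \<alpha> (snd y))) /\<^sub>R (\<alpha> \<bullet> snd y))
     in if \<alpha> \<bullet> snd x \<noteq> 0 then q x else Lim (at x within {y. \<alpha> \<bullet> snd y \<noteq> 0}) q)"

definition dunkl_T0 :: "('n::finite paravec \<Rightarrow> 'b::real_normed_vector) \<Rightarrow> 'n paravec \<Rightarrow> 'b"
  where "dunkl_T0 f x = dir_deriv (1, 0) f x"

definition dunkl_T :: "(real ^ 'n) set \<Rightarrow> (real ^ 'n \<Rightarrow> real) \<Rightarrow> 'n \<Rightarrow>
    ('n::finite paravec \<Rightarrow> 'b::real_normed_vector) \<Rightarrow> 'n paravec \<Rightarrow> 'b"
  where "dunkl_T Rp \<kappa> i f x =
    dir_deriv (0, axis i 1) f x + (\<Sum>\<alpha>\<in>Rp. (\<kappa> \<alpha> * \<alpha> $ i) *\<^sub>R dunkl_quotient \<alpha> f x)"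

definition dunkl_dirac :: "(real, 'n) vec set \<Rightarrow> ((real, 'n) vec \<Rightarrow> real) \<Rightarrow>
    ('n paravec \<Rightarrow> 'n clifford) \<Rightarrow> 'n::{finite,linorder} paravec \<Rightarrow> 'n clifford"
  where "dunkl_dirac Rp \<kappa> f x = (\<Sum>i\<in>UNIV. cl_gen i \<odot> dunkl_T Rp \<kappa> i f x)"

definition dunkl_CR :: "(real, 'n) vec set \<Rightarrow> ((real, 'n) vec \<Rightarrow> real) \<Rightarrow>
    ('n paravec \<Rightarrow> 'n clifford) \<Rightarrow> 'n::{finite,linorder} paravec \<Rightarrow> 'n clifford"
  where "dunkl_CR Rp \<kappa> f x = dunkl_T0 f x + dunkl_dirac Rp \<kappa> f x"

definition dunkl_laplacian :: "(real ^ 'n) set \<Rightarrow> (real ^ 'n \<Rightarrow> real) \<Rightarrow>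
    ('n::finite paravec \<Rightarrow> 'b::real_normed_vector) \<Rightarrow> 'n paravec \<Rightarrow> 'b"
  where "dunkl_laplacian Rp \<kappa> f x =
    dunkl_T0 (dunkl_T0 f) x + (\<Sum>i\<in>UNIV. dunkl_T Rp \<kappa> i (dunkl_T Rp \<kappa> i f) x)"

text \<open>
  Continuous differentiability guarantees that the derivatives and the limits in
  \<^const>\<open>dunkl_quotient\<close> exist, so that no unspecified value enters the equation.
\<close>

definition C1_on :: "'a set \<Rightarrow> ('a::real_normed_vector \<Rightarrow> 'b::real_normed_vector) \<Rightarrow> bool"
  where "C1_on U f \<longleftrightarrow> (\<exists>f' :: 'a \<Rightarrow> 'a \<Rightarrow>\<^sub>L 'b.
    (\<forall>x\<in>U. (f has_derivative blinfun_apply (f' x)) (at x)) \<and> continuous_on U f')"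

definition dunkl_monogenic_on :: "'n::{finite,linorder} paravec set \<Rightarrow> (real, 'n) vec set \<Rightarrow>
    ((real, 'n) vec \<Rightarrow> real) \<Rightarrow> ('n paravec \<Rightarrow> 'n clifford) \<Rightarrow> bool"
  where "dunkl_monogenic_on U Rp \<kappa> f \<longleftrightarrow> C1_on U f \<and> (\<forall>x\<in>U. dunkl_CR Rp \<kappa> f x = 0)"


section \<open>Homogeneous polynomials and axial functions\<close>

definition homogeneous_polynomial ::
    "nat \<Rightarrow> ('a::real_normed_vector \<Rightarrow> 'b::real_normed_vector) \<Rightarrow> bool"
  where "homogeneous_polynomial n P \<longleftrightarrow>
    polynomial_function P \<and> (\<forall>c x. P (c *\<^sub>R x) = c ^ n *\<^sub>R P x)"

definition axial_set :: "complex set \<Rightarrow> 'n::finite paravec set"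
  where "axial_set \<Omega> = {(x0, x). Complex x0 (norm x) \<in> \<Omega>}"

definition axial_fun :: "(complex \<Rightarrow> complex) \<Rightarrow> 'n::finite paravec \<Rightarrow> 'n clifford"
  where "axial_fun f = (\<lambda>(x0, x).
    Re (f (Complex x0 (norm x))) *\<^sub>R cl_one +
    Im (f (Complex x0 (norm x))) *\<^sub>R cl_vec (x /\<^sub>R norm x))"

end

theory Submission
  imports Defs "HOL-Complex_Analysis.Cauchy_Integral_Formula"
begin

text \<open>
  Write the function under the Laplacian as \<open>F P\<close> with \<open>F = u + \<omega> v\<close>, \<open>\<omega> = x / r\<close>, and put
  \<open>N = n + (\<mu> - 1) / 2\<close>. The relation \<open>D'(x P) = - x D' P - (2 E + \<mu>) P\<close> for the
  spatial part \<open>D'\<close> of \<open>D\<close>, Euler's formula for \<open>P\<close> and the Cauchy-Riemann equations for \<open>u, v\<close> give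
  \<open>D(F P) = 2 (v / r) Q\<close> with \<open>Q = (x\<^sub>0 + x) \<partial>\<^sub>0 P - N P\<close>, which is homogeneous of degree \<open>n\<close> and Dunkl
  harmonic. As \<open>D\<close> commutes with \<open>\<Delta>\<close>, it remains to see \<open>\<Delta>\<^sup>N ((v / r) Q) = 0\<close>. With
  \<open>X = (1 / r) \<partial>\<^sub>r\<close> and \<open>Y = \<partial>\<^sub>0 - x\<^sub>0 X\<close>, which commute, one step of the Laplacian is
  \<open>\<Delta>(Y\<^sup>a X\<^sup>b h \<partial>\<^sub>0\<^sup>a Q) = 2 (N - 1 - 2 a - b) Y\<^sup>a X\<^sup>b\<^sup>+\<^sup>1 h \<partial>\<^sub>0\<^sup>a Q + 2 Y\<^sup>a\<^sup>+\<^sup>1 X\<^sup>b h \<partial>\<^sub>0\<^sup>a\<^sup>+\<^sup>1 Q\<close> for \<open>h = v / r\<close>;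
  after \<open>N\<close> steps the terms with \<open>a < N\<close> have coefficient \<open>0\<close>, and those with \<open>a > n\<close> contain
  \<open>\<partial>\<^sub>0\<^sup>a Q = 0\<close>. Since \<open>\<mu> > 1\<close> is odd, \<open>N > n\<close>.
\<close>

text \<open>The overview leaves open why the iterated operators obey calculus rules at all.
  Derivatives and limits are total functions here, so no rule holds without knowing that they exist,
  and \<open>\<Delta>\<close> is applied arbitrarily often. Everything is therefore carried out in a
  class \<open>S\<close> generated by radial factors, coordinates and constants: it is closed under
  partial derivatives, reflections and divided differences, and an operator identity on it only has
  to be followed through the generators. The pivot is the commutator of \<open>T i\<close> with a
  coordinate, which is symmetric in its two indices. This symmetry yields both the commutativity of
  the Dunkl operators, hence that of \<open>D\<close> and \<open>\<Delta>\<close>, and the relation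
  for \<open>D'(x P)\<close>.

  The coefficients in the Laplacian step compare two numbers. One is the parameter of
  \<open>Q\<close> in Euler's formula, \<open>2 n + \<mu> = 2 N + 1\<close>, lowered by 2 with each
  x0 derivative. The other belongs to the radial factor: \<open>v / r\<close> is an axially
  symmetric harmonic function for a vector variable of dimension 3, and \<open>X\<close> and
  \<open>Y\<close> each raise that dimension by 2. The difference is
  \<open>(2 N + 1 - 2 a) - (3 + 2 a + 2 b)\<close>.\<close>

lemma dir_deriv_eq:
  assumes "(f has_derivative f') (at x)"
  shows "dir_deriv v f x = f' v"
proof -
  have "((\<lambda>t. f (x + t *\<^sub>R v)) has_derivative (\<lambda>t. f' (t *\<^sub>R v))) (at 0)"
  proof -
    have "((\<lambda>t. x + t *\<^sub>R v) has_derivative (\<lambda>t. t *\<^sub>R v)) (at 0)"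
      by (auto intro!: derivative_eq_intros)
    from has_derivative_compose[OF this, of f f'] assms show ?thesis by simp
  qed
  moreover have "(\<lambda>t. f' (t *\<^sub>R v)) = (\<lambda>t. t *\<^sub>R f' v)"
    using has_derivative_linear[OF assms] by (simp add: linear_cmul)
  ultimately have "((\<lambda>t. f (x + t *\<^sub>R v)) has_vector_derivative f' v) (at 0)"
    by (simp add: has_vector_derivative_def)
  then show ?thesis
    unfolding dir_deriv_def by (rule vector_derivative_at)
qed

section \<open>Reflections\<close>

lemma norm_reflection: "norm (reflection \<alpha> x) = norm x"
proof (cases "\<alpha> = 0")
  case False
  then have "(norm (reflection \<alpha> x))\<^sup>2 = (norm x)\<^sup>2"
    unfolding reflection_def power2_norm_eq_inner
    by (simp add: inner_diff_left inner_diff_right inner_commute[of x \<alpha>] field_simps)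
  then show ?thesis by simp
qed (simp add: reflection_def)

lemma inner_root_reflection: "\<alpha> \<noteq> 0 \<Longrightarrow> \<alpha> \<bullet> reflection \<alpha> x = - (\<alpha> \<bullet> x)"
  by (simp add: reflection_def inner_diff_right power2_norm_eq_inner)

lemma inner_reflection_left: "reflection \<alpha> x \<bullet> y = x \<bullet> reflection \<alpha> y"
  by (simp add: reflection_def inner_diff_right inner_diff_left inner_commute)

lemma reflection_involution [simp]: "reflection \<alpha> (reflection \<alpha> x) = x"
proof (cases "\<alpha> = 0")
  case False
  then show ?thesis
    by (simp add: reflection_def[of \<alpha> "reflection \<alpha> x"] inner_root_reflection)
       (simp add: reflection_def)
qed (simp add: reflection_def)

lemma inner_reflection_reflection: "reflection \<alpha> x \<bullet> reflection \<alpha> y = x \<bullet> y"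
  by (simp add: inner_reflection_left)

lemma linear_reflection: "linear (reflection \<alpha>)"
  by (rule linearI) (simp_all add: reflection_def inner_add_right algebra_simps add_divide_distrib)

text \<open>Only orthogonality enters: \<open>reflection \<alpha>\<close> preserves the norm and the
  inner product from which a reflection is built. This later moves a divided difference from one
  root to another.\<close>

lemma reflection_conjugate:
  "reflection \<alpha> (reflection \<beta> x) = reflection (reflection \<alpha> \<beta>) (reflection \<alpha> x)"
proof -
  have "reflection \<alpha> (reflection \<beta> x) = reflection \<alpha> x - (2 * (\<beta> \<bullet> x) / (norm \<beta>)\<^sup>2) *\<^sub>R reflection \<alpha> \<beta>"
    by (simp add: reflection_def[of \<beta>] linear_diff[OF linear_reflection] linear_cmul[OF linear_reflection])
  also have "\<dots> = reflection (reflection \<alpha> \<beta>) (reflection \<alpha> x)"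
    by (simp add: reflection_def[of "reflection \<alpha> \<beta>"] norm_reflection inner_reflection_reflection)
  finally show ?thesis .
qed

lemma reflection_uminus_root: "reflection (- \<alpha>) = reflection \<alpha>"
  by (rule ext) (simp add: reflection_def)

lemma reflection_root: "\<alpha> \<noteq> 0 \<Longrightarrow> reflection \<alpha> \<alpha> = - \<alpha>"
  by (simp add: reflection_def power2_norm_eq_inner scaleR_2)

definition para_refl :: "(real, 'n) vec \<Rightarrow> 'n::finite paravec \<Rightarrow> 'n paravec"
  where "para_refl \<alpha> x = (fst x, reflection \<alpha> (snd x))"

lemma fst_para_refl [simp]: "fst (para_refl \<alpha> x) = fst x"
  and snd_para_refl [simp]: "snd (para_refl \<alpha> x) = reflection \<alpha> (snd x)"
  by (simp_all add: para_refl_def)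

lemma para_refl_involution [simp]: "para_refl \<alpha> (para_refl \<alpha> x) = x"
  by (simp add: para_refl_def)

lemma bounded_linear_para_refl: "bounded_linear (para_refl \<alpha>)"
  unfolding linear_conv_bounded_linear[symmetric]
  by (rule linearI) (simp_all add: para_refl_def linear_add[OF linear_reflection] linear_cmul[OF linear_reflection])

lemma has_derivative_norm_snd:
  fixes x :: "'a::real_normed_vector \<times> 'b::real_inner"
  assumes "snd x \<noteq> 0"
  shows "((\<lambda>x. norm (snd x)) has_derivative (\<lambda>h. snd h \<bullet> sgn (snd x))) (at x)"
  using has_derivative_compose[OF has_derivative_snd[OF has_derivative_ident] has_derivative_norm[OF assms]]
  by (simp add: inner_commute)

lemma reflection_component:
  "reflection \<alpha> x $ k = x $ k - (2 * \<alpha> $ k / (norm \<alpha>)\<^sup>2) * (\<alpha> \<bullet> x)"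
  by (simp add: reflection_def field_simps)

lemma inner_scaleR_sum: "(a \<bullet> x) *\<^sub>R v = (\<Sum>j\<in>UNIV. (a $ j) *\<^sub>R x $ j *\<^sub>R v)"
  for a x :: "real ^ 'm::finite" and v :: "'b::real_vector"
  by (simp add: inner_vec_def scaleR_sum_left)

text \<open>Leibniz rule for divided differences in abstract form: \<open>a\<close> and
  \<open>b\<close> stand for the values of a function at a point and at its mirror image,
  \<open>r\<close> for their divided difference.\<close>

lemma reflection_coord_diff:
  "x $ k *\<^sub>R a - reflection \<alpha> x $ k *\<^sub>R b = (\<alpha> \<bullet> x) *\<^sub>R (x $ k *\<^sub>R r + (2 * \<alpha> $ k / (norm \<alpha>)\<^sup>2) *\<^sub>R b)"
  if "a - b = (\<alpha> \<bullet> x) *\<^sub>R r" for x :: "(real, 'n::finite) vec" and a b r :: "'b::real_vector"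
proof -
  have "a = b + (\<alpha> \<bullet> x) *\<^sub>R r" using that by (simp add: algebra_simps)
  then show ?thesis by (simp add: reflection_component algebra_simps)
qed

lemma paravec_linear_expansion:
  fixes x :: "'n::finite paravec"
  assumes "bounded_linear l"
  shows "l x = fst x *\<^sub>R l (1, 0) + (\<Sum>i\<in>UNIV. snd x $ i *\<^sub>R l (0, axis i 1))"
proof -
  interpret bounded_linear l by fact
  have "x = fst x *\<^sub>R (1, 0) + (\<Sum>i\<in>UNIV. snd x $ i *\<^sub>R (0, axis i 1))"
    by (auto simp: prod_eq_iff fst_sum snd_sum vec_eq_iff axis_def if_distrib[of "\<lambda>c. _ * c"] cong: if_cong)
  then have "l x = l (fst x *\<^sub>R (1, 0) + (\<Sum>i\<in>UNIV. snd x $ i *\<^sub>R (0, axis i 1)))" by simp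
  also have "\<dots> = fst x *\<^sub>R l (1, 0) + (\<Sum>i\<in>UNIV. snd x $ i *\<^sub>R l (0, axis i 1))"
    by (simp only: add sum scaleR)
  finally show ?thesis .
qed

section \<open>Radial functions\<close>

locale axial_dunkl =
  fixes R Rp :: "(real, 'n::{finite,linorder}) vec set"
    and \<kappa> :: "(real, 'n) vec \<Rightarrow> real"
    and \<Omega> :: "complex set"
  assumes root_system: "root_system R"
    and positive_subsystem: "positive_subsystem R Rp"
    and multiplicity: "multiplicity_function R \<kappa>"
    and open_\<Omega>: "open \<Omega>"
    and upper: "\<Omega> \<subseteq> {z. Im z > 0}"
begin

definition U :: "'n paravec set" where "U = axial_set \<Omega>"

definition zc :: "'n paravec \<Rightarrow> complex" where "zc x = Complex (fst x) (norm (snd x))"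

lemma U_iff: "x \<in> U \<longleftrightarrow> zc x \<in> \<Omega>"
  by (cases x) (simp add: U_def axial_set_def zc_def)

lemma zc_refl [simp]: "zc (para_refl \<alpha> x) = zc x"
  by (simp add: zc_def norm_reflection)

lemma refl_U [simp]: "para_refl \<alpha> x \<in> U \<longleftrightarrow> x \<in> U"
  by (simp add: U_iff)

lemma continuous_zc: "continuous_on UNIV zc"
  unfolding zc_def Complex_eq by (intro continuous_intros)

lemma open_U: "open U"
proof -
  have "U = zc -` \<Omega>" by (auto simp: U_iff)
  then show ?thesis using open_vimage[OF open_\<Omega> continuous_zc] by simp
qed

lemma U_snd_nonzero: "x \<in> U \<Longrightarrow> snd x \<noteq> 0"
  using upper by (auto simp: U_iff zc_def)

text \<open>
  All functions below are set to \<open>0\<close> outside \<open>U\<close>, which turns identities that hold on \<open>U\<close> into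
  equations between functions.
\<close>

definition restr :: "('n paravec \<Rightarrow> 'b::zero) \<Rightarrow> 'n paravec \<Rightarrow> 'b"
  where "restr f = (\<lambda>x. if x \<in> U then f x else 0)"

lemma restr_simps: "x \<in> U \<Longrightarrow> restr f x = f x" "x \<notin> U \<Longrightarrow> restr f x = 0"
  by (simp_all add: restr_def)

text \<open>Imaginary parts are covered, being real parts after multiplication by
  \<open>- \<i>\<close>. The generator 1 / r is there because \<open>X\<close> divides by r; with it
  the algebra is closed under \<open>T0\<close> and \<open>X\<close>.\<close>

inductive_set Rad :: "('n paravec \<Rightarrow> real) set" where
  Re: "\<phi> holomorphic_on \<Omega> \<Longrightarrow> restr (\<lambda>x. Re (\<phi> (zc x))) \<in> Rad"
| inv: "restr (\<lambda>x. inverse (norm (snd x))) \<in> Rad"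
| add: "g \<in> Rad \<Longrightarrow> h \<in> Rad \<Longrightarrow> (\<lambda>x. g x + h x) \<in> Rad"
| mult: "g \<in> Rad \<Longrightarrow> h \<in> Rad \<Longrightarrow> (\<lambda>x. g x * h x) \<in> Rad"

definition T0 :: "('n paravec \<Rightarrow> 'b::real_normed_vector) \<Rightarrow> 'n paravec \<Rightarrow> 'b"
  where "T0 f = restr (dunkl_T0 f)"

text \<open>
  \<open>X\<close> is \<open>(1 / r) \<partial>\<^sub>r\<close>, a derivation on functions of \<open>x\<^sub>0\<close> and \<open>r = norm (snd x)\<close>.
\<close>

definition X :: "('n paravec \<Rightarrow> real) \<Rightarrow> 'n paravec \<Rightarrow> real"
  where "X g = restr (\<lambda>x. dir_deriv (0, snd x) g x / (norm (snd x))\<^sup>2)"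

text \<open>The gradient of a radial function in the vector variable is a multiple of
  \<open>snd x\<close>, and the multiplier is \<open>X g\<close>. This is why \<open>X\<close>, and
  not the plain radial derivative, is the basic operator.\<close>

definition rad_deriv :: "('n paravec \<Rightarrow> real) \<Rightarrow> ('n paravec \<Rightarrow> real) \<Rightarrow> ('n paravec \<Rightarrow> real) \<Rightarrow> bool"
  where "rad_deriv g g0 gX \<longleftrightarrow> g0 \<in> Rad \<and> gX \<in> Rad \<and>
    (\<forall>x\<in>U. (g has_derivative (\<lambda>h. fst h * g0 x + (snd x \<bullet> snd h) * gX x)) (at x))"

lemma Rad_zero: "g \<in> Rad \<Longrightarrow> x \<notin> U \<Longrightarrow> g x = 0"
  by (induction rule: Rad.induct) (auto simp: restr_simps)

lemma Rad_refl: "g \<in> Rad \<Longrightarrow> g (para_refl \<alpha> x) = g x"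
  by (induction rule: Rad.induct) (auto simp: restr_def norm_reflection)

lemma rad_derivD:
  assumes "rad_deriv g g0 gX"
  shows "T0 g = g0" "X g = gX"
proof -
  have *: "dir_deriv v g x = fst v * g0 x + (snd x \<bullet> snd v) * gX x" if "x \<in> U" for x v
    using dir_deriv_eq[of g "\<lambda>h. fst h * g0 x + (snd x \<bullet> snd h) * gX x" x v] assms that
    unfolding rad_deriv_def by blast
  have z: "g0 x = 0" "gX x = 0" if "x \<notin> U" for x
    using assms Rad_zero that by (auto simp: rad_deriv_def)
  show "T0 g = g0" by (rule ext) (auto simp: T0_def restr_def dunkl_T0_def * z)
  show "X g = gX"
    using U_snd_nonzero
    by (intro ext) (auto simp: X_def restr_def * z power2_norm_eq_inner)
qed

lemma has_derivative_restr:
  assumes "x \<in> U" "(f has_derivative f') (at x)"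
  shows "(restr f has_derivative f') (at x)"
  using has_derivative_transform_within_open[OF assms(2) open_U assms(1)]
  by (simp add: restr_def)

text \<open>Chain rule through z = x0 + i r: differentiating in r multiplies the complex derivative
  by \<open>\<i>\<close>, and the gradient of r is \<open>snd x\<close> divided by r, which leaves
  one factor 1 / r.\<close>

lemma rad_deriv_Re:
  assumes "\<phi> holomorphic_on \<Omega>"
  shows "rad_deriv (restr (\<lambda>x. Re (\<phi> (zc x)))) (restr (\<lambda>x. Re (deriv \<phi> (zc x))))
    (\<lambda>x. restr (\<lambda>x. Re (\<i> * deriv \<phi> (zc x))) x * restr (\<lambda>x. inverse (norm (snd x))) x)"
proof -
  have h: "deriv \<phi> holomorphic_on \<Omega>"
    using assms open_\<Omega> by (rule holomorphic_deriv)
  have "(restr (\<lambda>x. Re (\<phi> (zc x))) has_derivative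
     (\<lambda>h. fst h * Re (deriv \<phi> (zc x)) + (snd x \<bullet> snd h) * (Re (\<i> * deriv \<phi> (zc x)) * inverse (norm (snd x))))) (at x)"
    if x: "x \<in> U" for x
  proof (rule has_derivative_restr[OF x])
    have nz: "snd x \<noteq> 0" using x U_snd_nonzero by auto
    have "(\<phi> has_field_derivative deriv \<phi> (zc x)) (at (zc x))"
      using assms open_\<Omega> x by (auto intro: holomorphic_derivI simp: U_iff)
    then have d\<phi>: "(\<phi> has_derivative (*) (deriv \<phi> (zc x))) (at (zc x))"
      by (simp add: has_field_derivative_def)
    note dn = has_derivative_norm_snd[OF nz]
    have dz: "(zc has_derivative (\<lambda>h. of_real (fst h) + \<i> * of_real (snd h \<bullet> sgn (snd x)))) (at x)"
      unfolding zc_def[abs_def] Complex_eq using dn by (auto intro!: derivative_eq_intros)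
    have "((\<lambda>x. Re (\<phi> (zc x))) has_derivative (\<lambda>h. Re (deriv \<phi> (zc x) * (of_real (fst h) + \<i> * of_real (snd h \<bullet> sgn (snd x)))))) (at x)"
      by (intro has_derivative_Re has_derivative_compose[OF dz d\<phi>])
    then show "((\<lambda>x. Re (\<phi> (zc x))) has_derivative (\<lambda>h. fst h * Re (deriv \<phi> (zc x)) +
        (snd x \<bullet> snd h) * (Re (\<i> * deriv \<phi> (zc x)) * inverse (norm (snd x))))) (at x)"
      by (rule has_derivative_eq_rhs) (auto simp: sgn_div_norm inner_commute field_simps)
  qed
  moreover have "restr (\<lambda>x. Re (\<i> * deriv \<phi> (zc x))) \<in> Rad"
    by (rule Rad.Re) (rule holomorphic_on_mult[OF holomorphic_on_const h])
  ultimately show ?thesis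
    unfolding rad_deriv_def by (auto simp only: restr_simps intro!: Rad.intros h)
qed

lemma Rad_neg: "g \<in> Rad \<Longrightarrow> (\<lambda>x. - g x) \<in> Rad"
proof -
  assume g: "g \<in> Rad"
  have "(\<lambda>x. restr (\<lambda>x. Re ((\<lambda>_. -1) (zc x))) x * g x) \<in> Rad"
    by (rule Rad.mult[OF Rad.Re g]) auto
  also have "(\<lambda>x. restr (\<lambda>x. Re ((\<lambda>_. -1) (zc x))) x * g x) = (\<lambda>x. - g x)"
    by (auto simp: restr_def Rad_zero[OF g])
  finally show ?thesis .
qed

lemma rad_deriv_inv:
  "rad_deriv (restr (\<lambda>x. inverse (norm (snd x)))) (restr (\<lambda>x. Re ((\<lambda>_. 0) (zc x))))
    (\<lambda>x. - (restr (\<lambda>x. inverse (norm (snd x))) x * (restr (\<lambda>x. inverse (norm (snd x))) x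
      * restr (\<lambda>x. inverse (norm (snd x))) x)))"
proof -
  have "(restr (\<lambda>x. inverse (norm (snd x))) has_derivative
     (\<lambda>h. - ((snd x \<bullet> snd h) * (inverse (norm (snd x)) * (inverse (norm (snd x)) * inverse (norm (snd x))))))) (at x)"
    if x: "x \<in> U" for x
  proof (rule has_derivative_restr[OF x])
    have nz: "snd x \<noteq> 0" using x U_snd_nonzero by auto
    note dn = has_derivative_norm_snd[OF nz]
    from Deriv.has_derivative_inverse[OF _ dn] nz
    have "((\<lambda>x. inverse (norm (snd x))) has_derivative (\<lambda>h. - (inverse (norm (snd x)) * (snd h \<bullet> sgn (snd x)) * inverse (norm (snd x))))) (at x)"
      by simp
    then show "((\<lambda>x. inverse (norm (snd x))) has_derivative (\<lambda>h. - ((snd x \<bullet> snd h) * (inverse (norm (snd x)) * (inverse (norm (snd x)) * inverse (norm (snd x))))))) (at x)"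
      by (rule has_derivative_eq_rhs) (auto simp: sgn_div_norm inner_commute field_simps)
  qed
  moreover have "restr (\<lambda>x. Re ((\<lambda>_. 0) (zc x))) \<in> Rad" by (rule Rad.Re) auto
  ultimately show ?thesis unfolding rad_deriv_def
    by (auto simp: restr_simps intro!: Rad.inv Rad.mult Rad_neg)
qed

lemma rad_deriv_add:
  assumes "rad_deriv g g0 gX" "rad_deriv h h0 hX"
  shows "rad_deriv (\<lambda>x. g x + h x) (\<lambda>x. g0 x + h0 x) (\<lambda>x. gX x + hX x)"
  using assms unfolding rad_deriv_def
  by (auto intro!: Rad.add derivative_eq_intros simp: algebra_simps)

lemma rad_deriv_mult:
  assumes "g \<in> Rad" "h \<in> Rad" "rad_deriv g g0 gX" "rad_deriv h h0 hX"
  shows "rad_deriv (\<lambda>x. g x * h x) (\<lambda>x. g0 x * h x + g x * h0 x) (\<lambda>x. gX x * h x + g x * hX x)"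
  unfolding rad_deriv_def
proof (intro conjI ballI)
  show "(\<lambda>x. g0 x * h x + g x * h0 x) \<in> Rad" "(\<lambda>x. gX x * h x + g x * hX x) \<in> Rad"
    using assms by (auto simp: rad_deriv_def intro!: Rad.add Rad.mult)
  fix x assume x: "x \<in> U"
  have "(g has_derivative (\<lambda>h. fst h * g0 x + (snd x \<bullet> snd h) * gX x)) (at x)"
    "(h has_derivative (\<lambda>h. fst h * h0 x + (snd x \<bullet> snd h) * hX x)) (at x)"
    using assms x by (auto simp: rad_deriv_def)
  from has_derivative_mult[OF this]
  show "((\<lambda>x. g x * h x) has_derivative (\<lambda>ha. fst ha * (g0 x * h x + g x * h0 x)
      + (snd x \<bullet> snd ha) * (gX x * h x + g x * hX x))) (at x)"
    by (rule has_derivative_eq_rhs) (auto simp: algebra_simps)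
qed

lemma rad_deriv_ex: "g \<in> Rad \<Longrightarrow> \<exists>g0 gX. rad_deriv g g0 gX"
  by (induction rule: Rad.induct) (blast intro: rad_deriv_Re rad_deriv_inv rad_deriv_add rad_deriv_mult)+

lemma rad_deriv: "g \<in> Rad \<Longrightarrow> rad_deriv g (T0 g) (X g)"
  using rad_deriv_ex rad_derivD by metis

lemma Rad_T0: "g \<in> Rad \<Longrightarrow> T0 g \<in> Rad" and Rad_X: "g \<in> Rad \<Longrightarrow> X g \<in> Rad"
  and Rad_has_derivative: "g \<in> Rad \<Longrightarrow> x \<in> U \<Longrightarrow>
    (g has_derivative (\<lambda>h. fst h * T0 g x + (snd x \<bullet> snd h) * X g x)) (at x)"
  using rad_deriv by (auto simp: rad_deriv_def)

lemma rad_add: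
  assumes "g \<in> Rad" "h \<in> Rad"
  shows "T0 (\<lambda>x. g x + h x) = (\<lambda>x. T0 g x + T0 h x)" "X (\<lambda>x. g x + h x) = (\<lambda>x. X g x + X h x)"
  using rad_derivD[OF rad_deriv_add[OF rad_deriv rad_deriv]] assms by auto

lemma rad_mult:
  assumes "g \<in> Rad" "h \<in> Rad"
  shows "T0 (\<lambda>x. g x * h x) = (\<lambda>x. T0 g x * h x + g x * T0 h x)"
    "X (\<lambda>x. g x * h x) = (\<lambda>x. X g x * h x + g x * X h x)"
  using rad_derivD[OF rad_deriv_mult[OF assms rad_deriv rad_deriv]] assms by auto

text \<open>Both compositions expand a product in the same way, so the generators decide. For a real
  part both sides are the real part of \<open>\<i>\<close> times the second derivative, divided by
  r; and 1 / r does not depend on x0.\<close>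

lemma X_T0: "g \<in> Rad \<Longrightarrow> X (T0 g) = T0 (X g)"
proof (induction rule: Rad.induct)
  case (Re \<phi>)
  have h: "deriv \<phi> holomorphic_on \<Omega>"
    using Re.hyps open_\<Omega> by (rule holomorphic_deriv)
  have hi: "(\<lambda>z. \<i> * deriv \<phi> z) holomorphic_on \<Omega>"
    by (rule holomorphic_on_mult[OF holomorphic_on_const h])
  have d: "deriv (\<lambda>z. \<i> * deriv \<phi> z) z = \<i> * deriv (deriv \<phi>) z" if "z \<in> \<Omega>" for z
    using h open_\<Omega> that by (intro deriv_cmult) (auto simp: holomorphic_on_imp_differentiable_at)
  have "T0 (X (restr (\<lambda>x. Re (\<phi> (zc x))))) =
    (\<lambda>x. restr (\<lambda>x. Re (deriv (\<lambda>z. \<i> * deriv \<phi> z) (zc x))) x * restr (\<lambda>x. inverse (norm (snd x))) x)"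
    unfolding rad_derivD[OF rad_deriv_Re[OF Re]]
    by (subst rad_mult[OF Rad.Re[OF hi] Rad.inv], unfold rad_derivD[OF rad_deriv_Re[OF hi]] rad_derivD[OF rad_deriv_inv])
       (auto simp: restr_def)
  also have "\<dots> = X (T0 (restr (\<lambda>x. Re (\<phi> (zc x)))))"
    unfolding rad_derivD[OF rad_deriv_Re[OF Re]] rad_derivD[OF rad_deriv_Re[OF h]]
    by (auto simp: restr_def d U_iff fun_eq_iff)
  finally show ?case by simp
next
  case inv
  let ?w = "restr (\<lambda>x. inverse (norm (snd x)))"
  have z: "rad_deriv (restr (\<lambda>x. Re ((\<lambda>_. 0) (zc x)))) (restr (\<lambda>x. Re (deriv (\<lambda>_. 0) (zc x))))
    (\<lambda>x. restr (\<lambda>x. Re (\<i> * deriv (\<lambda>_. 0) (zc x))) x * ?w x)"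
    by (rule rad_deriv_Re) auto
  have "rad_deriv (\<lambda>x. - g x) (\<lambda>x. - g0 x) (\<lambda>x. - gX x)" if "rad_deriv g g0 gX" for g g0 gX
    using that by (auto simp: rad_deriv_def intro!: Rad_neg derivative_eq_intros)
  note neg = this
  have "T0 (X ?w) = (\<lambda>x. 0)"
    unfolding rad_derivD[OF rad_deriv_inv]
    by (subst rad_derivD(1)[OF neg[OF rad_deriv_mult[OF Rad.inv Rad.mult[OF Rad.inv Rad.inv] rad_deriv_inv
        rad_deriv_mult[OF Rad.inv Rad.inv rad_deriv_inv rad_deriv_inv]]]]) (auto simp: restr_def)
  then show ?case
    unfolding rad_derivD(1)[OF rad_deriv_inv] rad_derivD(2)[OF z] by (auto simp: restr_def fun_eq_iff)
next
  case (add g h)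
  then show ?case by (simp add: rad_add Rad_T0 Rad_X)
next
  case (mult g h)
  then show ?case by (auto simp: rad_mult rad_add Rad_T0 Rad_X Rad.mult algebra_simps fun_eq_iff)
qed

section \<open>Partial derivatives and divided differences\<close>

text \<open>
  The operators act on the span of products of radial functions, coordinates and constants. Each
  generator is multiplied from the left, so that commutators can be computed generator by generator.
\<close>

inductive_set S :: "('n paravec \<Rightarrow> 'b::real_normed_vector) set" where
  const: "restr (\<lambda>_. c) \<in> S"
| add: "f \<in> S \<Longrightarrow> h \<in> S \<Longrightarrow> (\<lambda>x. f x + h x) \<in> S"
| rad: "g \<in> Rad \<Longrightarrow> f \<in> S \<Longrightarrow> (\<lambda>x. g x *\<^sub>R f x) \<in> S"
| coord: "f \<in> S \<Longrightarrow> (\<lambda>x. snd x $ k *\<^sub>R f x) \<in> S"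

lemma S_off: "f \<in> S \<Longrightarrow> x \<notin> U \<Longrightarrow> f x = 0"
  by (induction rule: S.induct) (auto simp: restr_simps)

lemma S_zero: "(\<lambda>_. 0) \<in> S"
  using S.const[of 0] by (simp add: restr_def)

lemma Rad_const: "restr (\<lambda>_. c) \<in> Rad"
  using Rad.Re[of "\<lambda>_. of_real c"] by simp

lemma S_scale: "f \<in> S \<Longrightarrow> (\<lambda>x. c *\<^sub>R f x) \<in> S"
proof -
  assume f: "f \<in> S"
  have "(\<lambda>x. restr (\<lambda>_. c) x *\<^sub>R f x) \<in> S" by (rule S.rad[OF Rad_const f])
  also have "(\<lambda>x. restr (\<lambda>_. c) x *\<^sub>R f x) = (\<lambda>x. c *\<^sub>R f x)"
    by (auto simp: restr_def S_off[OF f] fun_eq_iff)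
  finally show ?thesis .
qed

lemma S_sum: "finite I \<Longrightarrow> (\<And>i. i \<in> I \<Longrightarrow> f i \<in> S) \<Longrightarrow> (\<lambda>x. \<Sum>i\<in>I. f i x) \<in> S"
  by (induction rule: finite_induct) (auto intro: S_zero S.add)

lemma S_linear:
  assumes "linear L" "f \<in> S"
  shows "(\<lambda>x. L (f x)) \<in> S"
  using assms(2)
proof (induction rule: S.induct)
  case (const c)
  have "(\<lambda>x. L (restr (\<lambda>_. c) x)) = restr (\<lambda>_. L c)"
    by (auto simp: restr_def linear_0[OF assms(1)])
  then show ?case by (simp add: S.const)
qed (auto simp: linear_add[OF assms(1)] linear_cmul[OF assms(1)] intro: S.intros)

lemma S_inner: "f \<in> S \<Longrightarrow> (\<lambda>x. (a \<bullet> snd x) *\<^sub>R f x) \<in> S"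
  unfolding inner_scaleR_sum by (intro S_sum S_scale S.coord) auto

lemma S_refl: "f \<in> S \<Longrightarrow> (\<lambda>x. f (para_refl \<alpha> x)) \<in> S"
proof (induction rule: S.induct)
  case (const c)
  have "(\<lambda>x. restr (\<lambda>_. c) (para_refl \<alpha> x)) = restr (\<lambda>_. c)" by (auto simp: restr_def)
  then show ?case by (simp add: S.const)
next
  case (coord f k)
  have "(\<lambda>x. snd (para_refl \<alpha> x) $ k *\<^sub>R f (para_refl \<alpha> x)) =
    (\<lambda>x. snd x $ k *\<^sub>R f (para_refl \<alpha> x) + (- (2 * \<alpha> $ k / (norm \<alpha>)\<^sup>2)) *\<^sub>R (\<alpha> \<bullet> snd x) *\<^sub>R f (para_refl \<alpha> x))"
    by (simp add: reflection_component scaleR_diff_left)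
  then show ?case by (simp only:) (intro S.add S_scale S.coord S_inner coord)
qed (auto simp: Rad_refl intro: S.intros)

definition pd :: "'n \<Rightarrow> ('n paravec \<Rightarrow> 'b::real_normed_vector) \<Rightarrow> 'n paravec \<Rightarrow> 'b"
  where "pd i f = restr (dir_deriv (0, axis i 1) f)"

definition rho :: "(real, 'n) vec \<Rightarrow> ('n paravec \<Rightarrow> 'b::real_normed_vector) \<Rightarrow> 'n paravec \<Rightarrow> 'b"
  where "rho \<alpha> f = restr (dunkl_quotient \<alpha> f)"

definition T :: "'n \<Rightarrow> ('n paravec \<Rightarrow> 'b::real_normed_vector) \<Rightarrow> 'n paravec \<Rightarrow> 'b"
  where "T i f = restr (dunkl_T Rp \<kappa> i f)"

text \<open>Membership of the derivatives in \<open>S\<close> is part of the predicate, so one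
  induction gives differentiability and closure together, and hence derivatives of every
  order.\<close>

definition has_S_deriv :: "('n paravec \<Rightarrow> 'b::real_normed_vector) \<Rightarrow> ('n paravec \<Rightarrow> 'b) \<Rightarrow> ('n \<Rightarrow> 'n paravec \<Rightarrow> 'b) \<Rightarrow> bool"
  where "has_S_deriv f f0 fi \<longleftrightarrow> f0 \<in> S \<and> (\<forall>i. fi i \<in> S) \<and>
    (\<forall>x\<in>U. (f has_derivative (\<lambda>h. fst h *\<^sub>R f0 x + (\<Sum>i\<in>UNIV. snd h $ i *\<^sub>R fi i x))) (at x))"

lemma has_S_derivD:
  assumes "has_S_deriv f f0 fi"
  shows "T0 f = f0" "pd i f = fi i"
proof -
  have *: "dir_deriv v f x = fst v *\<^sub>R f0 x + (\<Sum>i\<in>UNIV. snd v $ i *\<^sub>R fi i x)" if "x \<in> U" for x v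
    using dir_deriv_eq[of f "(\<lambda>h. fst h *\<^sub>R f0 x + (\<Sum>i\<in>UNIV. snd h $ i *\<^sub>R fi i x))" x v] assms that
    unfolding has_S_deriv_def by blast
  have z: "f0 x = 0" "fi i x = 0" if "x \<notin> U" for x i
    using assms S_off that unfolding has_S_deriv_def by blast+
  show "T0 f = f0" by (rule ext) (auto simp: T0_def restr_def dunkl_T0_def * z)
  show "pd i f = fi i"
    by (rule ext) (auto simp: pd_def restr_def * z axis_def if_distrib[of "\<lambda>c. c *\<^sub>R _"] cong: if_cong)
qed

lemma has_S_deriv_const: "has_S_deriv (restr (\<lambda>_. c)) (\<lambda>_. 0) (\<lambda>_ _. 0)"
  unfolding has_S_deriv_def
  by (auto intro!: S_zero has_derivative_restr)

lemma has_S_deriv_add: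
  assumes "has_S_deriv f f0 fi" "has_S_deriv h h0 hi"
  shows "has_S_deriv (\<lambda>x. f x + h x) (\<lambda>x. f0 x + h0 x) (\<lambda>i x. fi i x + hi i x)"
  unfolding has_S_deriv_def
proof (intro conjI allI ballI)
  fix x assume x: "x \<in> U"
  have "((\<lambda>x. f x + h x) has_derivative (\<lambda>k. (fst k *\<^sub>R f0 x + (\<Sum>i\<in>UNIV. snd k $ i *\<^sub>R fi i x)) +
      (fst k *\<^sub>R h0 x + (\<Sum>i\<in>UNIV. snd k $ i *\<^sub>R hi i x)))) (at x)"
    using assms x by (intro has_derivative_add) (auto simp: has_S_deriv_def)
  then show "((\<lambda>x. f x + h x) has_derivative (\<lambda>k. fst k *\<^sub>R (f0 x + h0 x) + (\<Sum>i\<in>UNIV. snd k $ i *\<^sub>R (fi i x + hi i x)))) (at x)"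
    by (rule has_derivative_eq_rhs) (auto simp: scaleR_add_right sum.distrib)
qed (use assms in \<open>auto simp: has_S_deriv_def intro: S.add\<close>)

lemma has_S_deriv_rad:
  assumes "has_S_deriv f f0 fi" "g \<in> Rad" "f \<in> S"
  shows "has_S_deriv (\<lambda>x. g x *\<^sub>R f x) (\<lambda>x. T0 g x *\<^sub>R f x + g x *\<^sub>R f0 x)
    (\<lambda>i x. snd x $ i *\<^sub>R X g x *\<^sub>R f x + g x *\<^sub>R fi i x)"
  unfolding has_S_deriv_def
proof (intro conjI allI ballI)
  fix x assume x: "x \<in> U"
  have d: "(f has_derivative (\<lambda>k. fst k *\<^sub>R f0 x + (\<Sum>i\<in>UNIV. snd k $ i *\<^sub>R fi i x))) (at x)"
    using assms x by (auto simp: has_S_deriv_def)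
  have "(\<Sum>i\<in>UNIV. snd k $ i *\<^sub>R (snd x $ i *\<^sub>R X g x *\<^sub>R f x + g x *\<^sub>R fi i x)) =
    (snd x \<bullet> snd k) *\<^sub>R X g x *\<^sub>R f x + g x *\<^sub>R (\<Sum>i\<in>UNIV. snd k $ i *\<^sub>R fi i x)" for k :: "'n paravec"
    by (simp add: scaleR_add_right sum.distrib inner_vec_def scaleR_sum_left scaleR_sum_right sum_distrib_left mult_ac)
  with has_derivative_scaleR[OF Rad_has_derivative[OF assms(2) x] d]
  show "((\<lambda>x. g x *\<^sub>R f x) has_derivative (\<lambda>k. fst k *\<^sub>R (T0 g x *\<^sub>R f x + g x *\<^sub>R f0 x) + (\<Sum>i\<in>UNIV. snd k $ i *\<^sub>R (snd x $ i *\<^sub>R X g x *\<^sub>R f x + g x *\<^sub>R fi i x)))) (at x)"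
    by - (erule has_derivative_eq_rhs, simp add: algebra_simps)
qed (use assms in \<open>auto simp: has_S_deriv_def simp del: scaleR_scaleR intro!: S.intros Rad_T0 Rad_X\<close>)

lemma has_S_deriv_coord:
  assumes "has_S_deriv f f0 fi" "f \<in> S"
  shows "has_S_deriv (\<lambda>x. snd x $ k *\<^sub>R f x) (\<lambda>x. snd x $ k *\<^sub>R f0 x)
    (\<lambda>i x. snd x $ k *\<^sub>R fi i x + (if i = k then f x else 0))"
  unfolding has_S_deriv_def
proof (intro conjI allI ballI)
  fix x assume x: "x \<in> U"
  have d: "(f has_derivative (\<lambda>k. fst k *\<^sub>R f0 x + (\<Sum>i\<in>UNIV. snd k $ i *\<^sub>R fi i x))) (at x)"
    using assms x by (auto simp: has_S_deriv_def)
  have "bounded_linear (\<lambda>x::'n paravec. snd x $ k)"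
    by (rule bounded_linear_compose[OF bounded_linear_vec_nth bounded_linear_snd])
  then have c: "((\<lambda>x::'n paravec. snd x $ k) has_derivative (\<lambda>x. snd x $ k)) (at x)"
    by (rule bounded_linear_imp_has_derivative)
  have "(\<Sum>i\<in>UNIV. snd h $ i *\<^sub>R (snd x $ k *\<^sub>R fi i x + (if i = k then f x else 0))) =
    snd x $ k *\<^sub>R (\<Sum>i\<in>UNIV. snd h $ i *\<^sub>R fi i x) + snd h $ k *\<^sub>R f x" for h :: "'n paravec"
    by (simp add: scaleR_add_right sum.distrib scaleR_sum_right mult_ac if_distrib[of "\<lambda>c. _ *\<^sub>R c"] cong: if_cong)
  with has_derivative_scaleR[OF c d]
  show "((\<lambda>x. snd x $ k *\<^sub>R f x) has_derivative (\<lambda>h. fst h *\<^sub>R (snd x $ k *\<^sub>R f0 x) + (\<Sum>i\<in>UNIV. snd h $ i *\<^sub>R (snd x $ k *\<^sub>R fi i x + (if i = k then f x else 0))))) (at x)"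
    by - (erule has_derivative_eq_rhs, simp add: algebra_simps)
next
  fix i
  show "(\<lambda>x. snd x $ k *\<^sub>R fi i x + (if i = k then f x else 0)) \<in> S"
    using assms by (cases "i = k") (auto simp: has_S_deriv_def intro!: S.intros)
qed (use assms in \<open>auto simp: has_S_deriv_def intro!: S.intros\<close>)

lemma has_S_deriv_ex: "f \<in> S \<Longrightarrow> \<exists>f0 fi. has_S_deriv f f0 fi"
  by (induction rule: S.induct)
    (blast intro: has_S_deriv_const has_S_deriv_add has_S_deriv_rad has_S_deriv_coord)+

lemma has_S_deriv:
  assumes "f \<in> S" shows "has_S_deriv f (T0 f) (\<lambda>i. pd i f)"
proof -
  obtain f0 fi where "has_S_deriv f f0 fi" using has_S_deriv_ex[OF assms] by blast
  with has_S_derivD[OF this] show ?thesis by simp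
qed

lemma S_T0: "f \<in> S \<Longrightarrow> T0 f \<in> S" and S_pd: "f \<in> S \<Longrightarrow> pd i f \<in> S"
  and S_has_derivative: "f \<in> S \<Longrightarrow> x \<in> U \<Longrightarrow>
    (f has_derivative (\<lambda>h. fst h *\<^sub>R T0 f x + (\<Sum>i\<in>UNIV. snd h $ i *\<^sub>R pd i f x))) (at x)"
  using has_S_deriv by (auto simp: has_S_deriv_def)

lemma S_continuous_at: "f \<in> S \<Longrightarrow> x \<in> U \<Longrightarrow> continuous (at x) f"
  using S_has_derivative has_derivative_continuous by blast

text \<open>The partial derivatives lie in \<open>S\<close> again and are therefore continuous on
  \<open>U\<close>.\<close>

lemma S_C1_on:
  fixes f :: "'n paravec \<Rightarrow> 'b::real_normed_vector"
  assumes f: "f \<in> S"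
  shows "C1_on U f"
proof -
  define f' :: "'n paravec \<Rightarrow> 'n paravec \<Rightarrow>\<^sub>L 'b" where
    "f' = (\<lambda>x. ((blinfun_scaleR_left (T0 f x)) o\<^sub>L fst_blinfun) + (\<Sum>i\<in>UNIV. (blinfun_scaleR_left (pd i f x)) o\<^sub>L (Blinfun (\<lambda>h. snd h $ i))))"
  have bl: "bounded_linear (\<lambda>x::'n paravec. snd x $ k)" for k
    by (rule bounded_linear_compose[OF bounded_linear_vec_nth bounded_linear_snd])
  have "blinfun_apply (f' x) = (\<lambda>h. fst h *\<^sub>R T0 f x + (\<Sum>i\<in>UNIV. snd h $ i *\<^sub>R pd i f x))" for x
    by (rule ext) (simp add: f'_def blinfun.add_left blinfun.sum_left bounded_linear_Blinfun_apply[OF bl])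
  moreover have "continuous_on U (\<lambda>x. T0 f x)" "\<And>i. continuous_on U (\<lambda>x. pd i f x)"
    by (auto intro!: continuous_at_imp_continuous_on S_continuous_at S_T0 S_pd f)
  then have "continuous_on U f'"
    unfolding f'_def by (auto intro!: continuous_intros bounded_linear.continuous_on[OF bounded_linear_blinfun_scaleR_left])
  ultimately show ?thesis
    unfolding C1_on_def using S_has_derivative[OF f] by (intro exI[of _ f']) auto
qed

lemma pd_rules:
  assumes "f \<in> S"
  shows "T0 (restr (\<lambda>_. c)) = (\<lambda>_. 0)" "pd i (restr (\<lambda>_. c)) = (\<lambda>_. 0)"
    "h \<in> S \<Longrightarrow> T0 (\<lambda>x. f x + h x) = (\<lambda>x. T0 f x + T0 h x)"
    "h \<in> S \<Longrightarrow> pd i (\<lambda>x. f x + h x) = (\<lambda>x. pd i f x + pd i h x)"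
    "g \<in> Rad \<Longrightarrow> T0 (\<lambda>x. g x *\<^sub>R f x) = (\<lambda>x. T0 g x *\<^sub>R f x + g x *\<^sub>R T0 f x)"
    "g \<in> Rad \<Longrightarrow> pd i (\<lambda>x. g x *\<^sub>R f x) = (\<lambda>x. snd x $ i *\<^sub>R X g x *\<^sub>R f x + g x *\<^sub>R pd i f x)"
    "T0 (\<lambda>x. snd x $ k *\<^sub>R f x) = (\<lambda>x. snd x $ k *\<^sub>R T0 f x)"
    "pd i (\<lambda>x. snd x $ k *\<^sub>R f x) = (\<lambda>x. snd x $ k *\<^sub>R pd i f x + (if i = k then f x else 0))"
  by (rule has_S_derivD[OF has_S_deriv_const] has_S_derivD[OF has_S_deriv_add[OF has_S_deriv has_S_deriv]]
    has_S_derivD[OF has_S_deriv_rad[OF has_S_deriv]] has_S_derivD[OF has_S_deriv_coord[OF has_S_deriv]] assms | assumption)+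

lemma pd_linear:
  assumes "bounded_linear L" and f: "f \<in> S"
  shows "T0 (\<lambda>x. L (f x)) = (\<lambda>x. L (T0 f x))" "pd i (\<lambda>x. L (f x)) = (\<lambda>x. L (pd i f x))"
proof -
  interpret L: bounded_linear L by fact
  have "has_S_deriv (\<lambda>x. L (f x)) (\<lambda>x. L (T0 f x)) (\<lambda>i x. L (pd i f x))"
    unfolding has_S_deriv_def
  proof (intro conjI allI ballI)
    fix x assume "x \<in> U"
    from L.has_derivative[OF S_has_derivative[OF f this]]
    show "((\<lambda>x. L (f x)) has_derivative (\<lambda>h. fst h *\<^sub>R L (T0 f x) + (\<Sum>i\<in>UNIV. snd h $ i *\<^sub>R L (pd i f x)))) (at x)"
      by (simp add: L.add L.sum L.scaleR)
  qed (rule S_linear[OF L.linear_axioms S_T0[OF f]] S_linear[OF L.linear_axioms S_pd[OF f]])+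
  from has_S_derivD[OF this] show "T0 (\<lambda>x. L (f x)) = (\<lambda>x. L (T0 f x))" "pd i (\<lambda>x. L (f x)) = (\<lambda>x. L (pd i f x))"
    by auto
qed

text \<open>Chain rule: the gradient at the mirror image is itself reflected, because a reflection
  is its own transpose.\<close>

lemma pd_refl:
  assumes f: "f \<in> S"
  shows "T0 (\<lambda>x. f (para_refl \<alpha> x)) = (\<lambda>x. T0 f (para_refl \<alpha> x))"
    "pd i (\<lambda>x. f (para_refl \<alpha> x)) = (\<lambda>x. pd i f (para_refl \<alpha> x) - (2 * \<alpha> $ i / (norm \<alpha>)\<^sup>2) *\<^sub>R (\<Sum>j\<in>UNIV. \<alpha> $ j *\<^sub>R pd j f (para_refl \<alpha> x)))"
proof -
  let ?fi = "\<lambda>i x. pd i f (para_refl \<alpha> x) - (2 * \<alpha> $ i / (norm \<alpha>)\<^sup>2) *\<^sub>R (\<Sum>j\<in>UNIV. \<alpha> $ j *\<^sub>R pd j f (para_refl \<alpha> x))"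
  have eq: "(\<Sum>i\<in>UNIV. snd (para_refl \<alpha> h) $ i *\<^sub>R pd i f y) =
     (\<Sum>i\<in>UNIV. snd h $ i *\<^sub>R (pd i f y - (2 * \<alpha> $ i / (norm \<alpha>)\<^sup>2) *\<^sub>R (\<Sum>j\<in>UNIV. \<alpha> $ j *\<^sub>R pd j f y)))" for h y
    by (simp add: reflection_component scaleR_diff_left scaleR_diff_right sum_subtractf scaleR_sum_right
      inner_vec_def sum_distrib_left sum_distrib_right scaleR_sum_left)
      (subst sum.swap, simp add: mult_ac)
  have "has_S_deriv (\<lambda>x. f (para_refl \<alpha> x)) (\<lambda>x. T0 f (para_refl \<alpha> x)) ?fi"
    unfolding has_S_deriv_def
  proof (intro conjI allI ballI)
    fix x assume x: "x \<in> U"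
    have "(para_refl \<alpha> has_derivative para_refl \<alpha>) (at x)"
      by (rule bounded_linear_imp_has_derivative[OF bounded_linear_para_refl])
    from has_derivative_compose[OF this S_has_derivative[OF f]] x
    show "((\<lambda>x. f (para_refl \<alpha> x)) has_derivative
       (\<lambda>h. fst h *\<^sub>R T0 f (para_refl \<alpha> x) + (\<Sum>i\<in>UNIV. snd h $ i *\<^sub>R ?fi i x))) (at x)"
      by (simp only: eq refl_U fst_para_refl)
  next
    fix i
    have "?fi i = (\<lambda>x. pd i f (para_refl \<alpha> x) + (- (2 * \<alpha> $ i / (norm \<alpha>)\<^sup>2)) *\<^sub>R (\<Sum>j\<in>UNIV. \<alpha> $ j *\<^sub>R pd j f (para_refl \<alpha> x)))"
      by auto
    moreover have "\<dots> \<in> S"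
      by (intro S.add S_scale S_sum S_refl S_pd f) auto
    ultimately show "?fi i \<in> S" by simp
  qed (intro S_refl S_T0 f)
  from has_S_derivD[OF this] show "T0 (\<lambda>x. f (para_refl \<alpha> x)) = (\<lambda>x. T0 f (para_refl \<alpha> x))" "pd i (\<lambda>x. f (para_refl \<alpha> x)) = ?fi i"
    by auto
qed

text \<open>Off the mirror the quotient is determined by division; on the mirror the continuity of
  \<open>h\<close> identifies the limit. A divided difference is thus computed by exhibiting a
  factorization.\<close>

lemma rho_eqI:
  assumes "h \<in> S" "\<alpha> \<noteq> 0" and eq: "\<And>x. x \<in> U \<Longrightarrow> f x - f (para_refl \<alpha> x) = (\<alpha> \<bullet> snd x) *\<^sub>R h x"
  shows "rho \<alpha> f = h"
proof (rule ext)
  fix x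
  show "rho \<alpha> f x = h x"
  proof (cases "x \<in> U")
    case False
    then show ?thesis using S_off[OF assms(1)] by (simp add: rho_def restr_simps)
  next
    case x: True
    let ?q = "\<lambda>y. (f y - f (fst y, reflection \<alpha> (snd y))) /\<^sub>R (\<alpha> \<bullet> snd y)"
    let ?A = "{y::'n paravec. \<alpha> \<bullet> snd y \<noteq> 0}"
    have q: "?q y = h y" if "y \<in> U" "y \<in> ?A" for y
      using eq[OF that(1)] that(2) by (simp add: para_refl_def)
    have "dunkl_quotient \<alpha> f x = h x"
    proof (cases "\<alpha> \<bullet> snd x = 0")
      case False
      then show ?thesis using q[of x] x by (simp add: dunkl_quotient_def)
    next
      case True
      \<comment> \<open>Moving from \<open>x\<close> along the root leaves the mirror, so the
        complement accumulates at \<open>x\<close> and the limit is unique.\<close>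
      have nt: "at x within ?A \<noteq> bot"
      proof -
        have "((\<lambda>t. x + (0, t *\<^sub>R \<alpha>)) \<longlongrightarrow> x) (at (0::real))"
          by (auto intro!: tendsto_eq_intros simp: prod_eq_iff)
        then have "filterlim (\<lambda>t. x + (0, t *\<^sub>R \<alpha>)) (at x within ?A) (at (0::real))"
          using True assms(2) by (auto simp: filterlim_at eventually_at_filter prod_eq_iff inner_add_right)
        then show ?thesis
          using filterlim_def trivial_limit_at by (metis filtermap_bot_iff le_bot)
      qed
      have "(h \<longlongrightarrow> h x) (at x within ?A)"
        using S_continuous_at[OF assms(1) x] by (simp add: continuous_at continuous_within tendsto_within_subset)
          (meson Lim_at_imp_Lim_at_within)
      then have "(?q \<longlongrightarrow> h x) (at x within ?A) \<longleftrightarrow> True" if "eventually (\<lambda>y. ?q y = h y) (at x within ?A)"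
        using tendsto_cong[OF that] by simp
      moreover have "eventually (\<lambda>y. ?q y = h y) (at x within ?A)"
        using eventually_at_topological[of "\<lambda>y. y \<in> U" x ?A] open_U x q
        unfolding eventually_at_filter by (smt (verit, best) eventually_nhds)
      ultimately have "(?q \<longlongrightarrow> h x) (at x within ?A)"
        by simp
      then have "Lim (at x within ?A) ?q = h x"
        using nt by (intro tendsto_Lim)
      then show ?thesis using True by (simp add: dunkl_quotient_def)
    qed
    then show ?thesis using x by (simp add: rho_def restr_simps)
  qed
qed

text \<open>A radial factor passes through the difference by invariance, and a coordinate factor
  contributes a reflected copy of the function. The factor \<open>\<alpha> \<bullet> snd x\<close>
  thus splits off generator by generator, without Taylor or integral formulas.\<close>

lemma rho_ex:
  assumes "\<alpha> \<noteq> 0"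
  shows "f \<in> S \<Longrightarrow> \<exists>h\<in>S. \<forall>x\<in>U. f x - f (para_refl \<alpha> x) = (\<alpha> \<bullet> snd x) *\<^sub>R h x"
proof (induction rule: S.induct)
  case (const c)
  show ?case by (rule bexI[OF _ S_zero]) (simp add: restr_def)
next
  case (add f h)
  then obtain f' h' where *: "f' \<in> S" "\<forall>x\<in>U. f x - f (para_refl \<alpha> x) = (\<alpha> \<bullet> snd x) *\<^sub>R f' x"
    "h' \<in> S" "\<forall>x\<in>U. h x - h (para_refl \<alpha> x) = (\<alpha> \<bullet> snd x) *\<^sub>R h' x" by blast
  show ?case by (rule bexI[OF _ S.add[OF *(1,3)]]) (use * in \<open>simp add: add_diff_add scaleR_add_right\<close>)
next
  case (rad g f)
  then obtain f' where *: "f' \<in> S" "\<forall>x\<in>U. f x - f (para_refl \<alpha> x) = (\<alpha> \<bullet> snd x) *\<^sub>R f' x" by blast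
  show ?case by (rule bexI[OF _ S.rad[OF rad(1) *(1)]])
    (use * in \<open>simp add: Rad_refl[OF rad(1)] scaleR_diff_right[symmetric]\<close>)
next
  case (coord f k)
  then obtain f' where *: "f' \<in> S" "\<forall>x\<in>U. f x - f (para_refl \<alpha> x) = (\<alpha> \<bullet> snd x) *\<^sub>R f' x" by blast
  have "(\<lambda>x. snd x $ k *\<^sub>R f' x + (2 * \<alpha> $ k / (norm \<alpha>)\<^sup>2) *\<^sub>R f (para_refl \<alpha> x)) \<in> S"
    by (intro S.add S.coord S_scale S_refl * coord)
  then show ?case
    by (rule bexI[rotated]) (use * reflection_coord_diff in \<open>simp only: snd_para_refl Ball_def, blast\<close>)
qed

lemma
  assumes "\<alpha> \<noteq> 0" "f \<in> S"
  shows S_rho: "rho \<alpha> f \<in> S"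
    and rho_eq: "f x - f (para_refl \<alpha> x) = (\<alpha> \<bullet> snd x) *\<^sub>R rho \<alpha> f x"
proof -
  obtain h where h: "h \<in> S" "\<And>x. x \<in> U \<Longrightarrow> f x - f (para_refl \<alpha> x) = (\<alpha> \<bullet> snd x) *\<^sub>R h x"
    using rho_ex assms by blast
  have eq: "rho \<alpha> f = h" using h by (intro rho_eqI assms)
  show "rho \<alpha> f \<in> S" using eq h by simp
  show "f x - f (para_refl \<alpha> x) = (\<alpha> \<bullet> snd x) *\<^sub>R rho \<alpha> f x"
  proof (cases "x \<in> U")
    case False
    then show ?thesis using S_off[OF assms(2)] S_off[OF h(1)] by (simp add: eq)
  qed (simp only: eq h)
qed

lemma rho_rules:
  assumes a: "\<alpha> \<noteq> 0" and f: "f \<in> S"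
  shows "rho \<alpha> (restr (\<lambda>_. c)) = (\<lambda>_. 0)"
    "h \<in> S \<Longrightarrow> rho \<alpha> (\<lambda>x. f x + h x) = (\<lambda>x. rho \<alpha> f x + rho \<alpha> h x)"
    "g \<in> Rad \<Longrightarrow> rho \<alpha> (\<lambda>x. g x *\<^sub>R f x) = (\<lambda>x. g x *\<^sub>R rho \<alpha> f x)"
    "rho \<alpha> (\<lambda>x. snd x $ k *\<^sub>R f x) = (\<lambda>x. snd x $ k *\<^sub>R rho \<alpha> f x + (2 * \<alpha> $ k / (norm \<alpha>)\<^sup>2) *\<^sub>R f (para_refl \<alpha> x))"
proof -
  show "rho \<alpha> (restr (\<lambda>_. c)) = (\<lambda>_. 0)" by (rule rho_eqI[OF S_zero a]) (simp add: restr_def)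
  show "rho \<alpha> (\<lambda>x. f x + h x) = (\<lambda>x. rho \<alpha> f x + rho \<alpha> h x)" if "h \<in> S"
    by (rule rho_eqI[OF S.add[OF S_rho S_rho] a])
      (use that a f rho_eq[OF a f] rho_eq[OF a that] in \<open>simp_all add: add_diff_add scaleR_add_right\<close>)
  show "rho \<alpha> (\<lambda>x. g x *\<^sub>R f x) = (\<lambda>x. g x *\<^sub>R rho \<alpha> f x)" if "g \<in> Rad"
    by (rule rho_eqI[OF S.rad[OF that S_rho] a])
      (use that a f rho_eq[OF a f] in \<open>simp_all add: Rad_refl scaleR_diff_right[symmetric]\<close>)
  show "rho \<alpha> (\<lambda>x. snd x $ k *\<^sub>R f x) = (\<lambda>x. snd x $ k *\<^sub>R rho \<alpha> f x + (2 * \<alpha> $ k / (norm \<alpha>)\<^sup>2) *\<^sub>R f (para_refl \<alpha> x))"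
  proof (rule rho_eqI[OF _ a])
    show "(\<lambda>x. snd x $ k *\<^sub>R rho \<alpha> f x + (2 * \<alpha> $ k / (norm \<alpha>)\<^sup>2) *\<^sub>R f (para_refl \<alpha> x)) \<in> S"
      by (intro S.add S.coord S_scale S_refl S_rho a f)
  qed (simp only: snd_para_refl reflection_coord_diff[OF rho_eq[OF a f]])
qed

lemma rho_linear:
  assumes a: "\<alpha> \<noteq> 0" and L: "linear L" and f: "f \<in> S"
  shows "rho \<alpha> (\<lambda>x. L (f x)) = (\<lambda>x. L (rho \<alpha> f x))"
  by (rule rho_eqI[OF S_linear[OF L S_rho] a])
    (use a f rho_eq[OF a f] in \<open>simp_all add: linear_diff[OF L, symmetric] linear_cmul[OF L]\<close>)

lemma rho_uminus_root:
  assumes a: "\<alpha> \<noteq> 0" and f: "f \<in> S"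
  shows "rho (- \<alpha>) f = (\<lambda>x. - rho \<alpha> f x)"
  by (rule rho_eqI)
    (use a f rho_eq[OF a f] S_scale[OF S_rho[OF a f], of "-1"] in \<open>auto simp: para_refl_def reflection_uminus_root\<close>)

text \<open>Conjugation turns the reflection in \<open>\<beta>\<close>, followed by that in
  \<open>\<alpha>\<close>, into one in the moved root acting on the mirror image; the denominator is
  unchanged by orthogonality.\<close>

lemma rho_refl:
  assumes a: "\<beta> \<noteq> 0" and f: "f \<in> S"
  shows "rho \<beta> (\<lambda>x. f (para_refl \<alpha> x)) = (\<lambda>x. rho (reflection \<alpha> \<beta>) f (para_refl \<alpha> x))"
proof (rule rho_eqI[OF _ a])
  have b: "reflection \<alpha> \<beta> \<noteq> 0" using a by (metis norm_reflection norm_eq_zero)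
  then show "(\<lambda>x. rho (reflection \<alpha> \<beta>) f (para_refl \<alpha> x)) \<in> S" by (intro S_refl S_rho f)
  show "f (para_refl \<alpha> x) - f (para_refl \<alpha> (para_refl \<beta> x)) = (\<beta> \<bullet> snd x) *\<^sub>R rho (reflection \<alpha> \<beta>) f (para_refl \<alpha> x)" for x
    using rho_eq[OF b f, of "para_refl \<alpha> x"]
    by (simp only: para_refl_def fst_conv snd_conv reflection_conjugate[symmetric] inner_reflection_reflection)
qed

section \<open>Dunkl operators\<close>

lemma Rp_subset: "Rp \<subseteq> R"
  using positive_subsystem by (auto simp: positive_subsystem_def)

lemma finite_Rp: "finite Rp"
  using Rp_subset root_system finite_subset by (auto simp: root_system_def)

lemma R_nonzero: "\<alpha> \<in> R \<Longrightarrow> \<alpha> \<noteq> 0"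
  using root_system by (auto simp: root_system_def)

lemma Rp_nonzero: "\<alpha> \<in> Rp \<Longrightarrow> \<alpha> \<noteq> 0"
  using R_nonzero Rp_subset by auto

lemma R_uminus: "\<alpha> \<in> R \<Longrightarrow> - \<alpha> \<in> R"
  using root_system by (auto simp: root_system_def)

lemma reflection_image_R: "\<beta> \<in> R \<Longrightarrow> reflection \<beta> ` R = R"
  using root_system by (auto simp: root_system_def)

lemma \<kappa>_reflection:
  assumes "\<alpha> \<in> R" "\<beta> \<in> R" shows "\<kappa> (reflection \<beta> \<alpha>) = \<kappa> \<alpha>"
proof -
  have "reflection \<beta> \<circ> id \<in> reflection_group R"
    by (rule reflection_group.intros)+ fact
  then show ?thesis using multiplicity assms unfolding multiplicity_function_def by auto
qed

lemma \<kappa>_uminus: "\<alpha> \<in> R \<Longrightarrow> \<kappa> (- \<alpha>) = \<kappa> \<alpha>"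
  using \<kappa>_reflection[of \<alpha> \<alpha>] by (simp add: reflection_root R_nonzero)

text \<open>The vector that separates the positive roots splits \<open>R\<close> into the disjoint
  sets \<open>Rp\<close> and its negative.\<close>

lemma sum_R_even:
  fixes \<phi> :: "(real, 'n) vec \<Rightarrow> 'b::real_vector"
  assumes "\<And>\<alpha>. \<alpha> \<in> R \<Longrightarrow> \<phi> (- \<alpha>) = \<phi> \<alpha>"
  shows "sum \<phi> R = 2 *\<^sub>R sum \<phi> Rp"
proof -
  obtain \<beta> where b: "\<forall>\<alpha>\<in>R. \<alpha> \<bullet> \<beta> \<noteq> 0" "Rp = {\<alpha>\<in>R. \<alpha> \<bullet> \<beta> > 0}"
    using positive_subsystem by (auto simp: positive_subsystem_def)
  have "R = Rp \<union> uminus ` Rp"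
  proof
    show "R \<subseteq> Rp \<union> uminus ` Rp"
    proof
      fix \<alpha> assume a: "\<alpha> \<in> R"
      show "\<alpha> \<in> Rp \<union> uminus ` Rp"
      proof (cases "\<alpha> \<bullet> \<beta> > 0")
        case False
        then have "- \<alpha> \<in> Rp" using a b R_uminus[OF a] by force
        then show ?thesis by (metis UnI2 image_eqI minus_minus)
      qed (use a b in auto)
    qed
  qed (use b R_uminus in auto)
  moreover have "Rp \<inter> uminus ` Rp = {}" using b by auto
  ultimately have "sum \<phi> R = sum \<phi> Rp + sum \<phi> (uminus ` Rp)"
    using sum.union_disjoint[of Rp "uminus ` Rp" \<phi>] finite_Rp by simp
  also have "sum \<phi> (uminus ` Rp) = sum (\<lambda>\<alpha>. \<phi> (- \<alpha>)) Rp"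
    by (subst sum.reindex) (auto simp: inj_on_def)
  also have "\<dots> = sum \<phi> Rp" using assms Rp_subset by (intro sum.cong) auto
  finally show ?thesis by (simp add: scaleR_2)
qed

text \<open>A reflection permutes \<open>R\<close> but not \<open>Rp\<close>. For even summands the
  sum over \<open>Rp\<close> is half of the sum over \<open>R\<close>, where re-indexing is
  allowed.\<close>

lemma sum_Rp_reflection:
  fixes \<phi> :: "(real, 'n) vec \<Rightarrow> 'b::real_vector"
  assumes "\<And>\<alpha>. \<alpha> \<in> R \<Longrightarrow> \<phi> (- \<alpha>) = \<phi> \<alpha>" "\<beta> \<in> R"
  shows "(\<Sum>\<alpha>\<in>Rp. \<phi> (reflection \<beta> \<alpha>)) = (\<Sum>\<alpha>\<in>Rp. \<phi> \<alpha>)"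
proof -
  have inj: "inj_on (reflection \<beta>) R" by (rule inj_on_inverseI[of _ "reflection \<beta>"]) simp
  have "2 *\<^sub>R (\<Sum>\<alpha>\<in>Rp. \<phi> (reflection \<beta> \<alpha>)) = (\<Sum>\<alpha>\<in>R. \<phi> (reflection \<beta> \<alpha>))"
    using reflection_image_R[OF assms(2)]
    by (intro sum_R_even[symmetric]) (auto simp: linear_neg[OF linear_reflection] intro!: assms(1))
  also have "\<dots> = sum \<phi> (reflection \<beta> ` R)"
    by (simp add: sum.reindex[OF inj])
  also have "\<dots> = 2 *\<^sub>R sum \<phi> Rp"
    unfolding reflection_image_R[OF assms(2)] by (rule sum_R_even) (rule assms(1))
  finally show ?thesis by simp
qed

lemma T_eq: "T i f = (\<lambda>x. pd i f x + (\<Sum>\<alpha>\<in>Rp. (\<kappa> \<alpha> * \<alpha> $ i) *\<^sub>R rho \<alpha> f x))"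
  by (rule ext) (simp add: T_def pd_def rho_def restr_def dunkl_T_def)

lemma S_T: "f \<in> S \<Longrightarrow> T i f \<in> S"
  unfolding T_eq by (intro S.add S_sum S_scale S_pd S_rho finite_Rp Rp_nonzero)

text \<open>
  The commutator of \<open>T i\<close> with multiplication by the \<open>k\<close>-th coordinate.
\<close>

definition Sop :: "'n \<Rightarrow> 'n \<Rightarrow> ('n paravec \<Rightarrow> 'b::real_normed_vector) \<Rightarrow> 'n paravec \<Rightarrow> 'b"
  where "Sop i k f x = (if i = k then 1 else 0) *\<^sub>R f x +
    (\<Sum>\<alpha>\<in>Rp. (2 * \<kappa> \<alpha> * \<alpha> $ i * \<alpha> $ k / (norm \<alpha>)\<^sup>2) *\<^sub>R f (para_refl \<alpha> x))"

lemma Sop_commute: "Sop i k f = Sop k i f"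
  by (auto simp: Sop_def fun_eq_iff mult_ac)

lemma S_Sop: "f \<in> S \<Longrightarrow> Sop i k f \<in> S"
  unfolding Sop_def[abs_def] by (intro S.add S_sum S_scale S_refl finite_Rp)

lemma T_const: "T i (restr (\<lambda>_. c)) = (\<lambda>_. 0)"
  by (simp add: T_eq pd_rules[OF S.const] rho_rules[OF Rp_nonzero S.const])

lemma T_add: "f \<in> S \<Longrightarrow> h \<in> S \<Longrightarrow> T i (\<lambda>x. f x + h x) = (\<lambda>x. T i f x + T i h x)"
  by (simp add: T_eq pd_rules rho_rules[OF Rp_nonzero] scaleR_add_right sum.distrib fun_eq_iff)

lemma T_linear:
  assumes L: "bounded_linear L" and f: "f \<in> S"
  shows "T i (\<lambda>x. L (f x)) = (\<lambda>x. L (T i f x))"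
proof -
  interpret L: bounded_linear L by fact
  show ?thesis
    by (simp add: T_eq pd_linear[OF L f] rho_linear[OF Rp_nonzero L.linear_axioms f] L.add L.sum L.scaleR)
qed

lemma T_scale: "f \<in> S \<Longrightarrow> T i (\<lambda>x. c *\<^sub>R f x) = (\<lambda>x. c *\<^sub>R T i f x)"
  by (rule T_linear[OF bounded_linear_scaleR_right])

lemma T0_scale: "f \<in> S \<Longrightarrow> T0 (\<lambda>x. c *\<^sub>R f x) = (\<lambda>x. c *\<^sub>R T0 f x)"
  by (rule pd_linear[OF bounded_linear_scaleR_right])

lemma T_zero: "T i (\<lambda>_. 0) = (\<lambda>_. 0)" and T0_zero: "T0 (\<lambda>_. 0) = (\<lambda>_. 0)"
  using T_scale[OF S_zero, of i 0] T0_scale[OF S_zero, of 0] by simp_all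

lemma T_sum:
  "finite I \<Longrightarrow> (\<And>j. j \<in> I \<Longrightarrow> f j \<in> S) \<Longrightarrow> T i (\<lambda>x. \<Sum>j\<in>I. f j x) = (\<lambda>x. \<Sum>j\<in>I. T i (f j) x)"
  by (induction rule: finite_induct) (simp_all add: T_zero T_add S_sum)

lemma T0_sum:
  "finite I \<Longrightarrow> (\<And>j. j \<in> I \<Longrightarrow> f j \<in> S) \<Longrightarrow> T0 (\<lambda>x. \<Sum>j\<in>I. f j x) = (\<lambda>x. \<Sum>j\<in>I. T0 (f j) x)"
  by (induction rule: finite_induct) (simp_all add: T0_zero pd_rules(3) S_sum)

text \<open>The divided differences do not see a reflection invariant factor; only the partial
  derivative does, through the gradient \<open>X g\<close> times \<open>snd x\<close>.\<close>

lemma T_rad: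
  assumes "g \<in> Rad" "f \<in> S"
  shows "T i (\<lambda>x. g x *\<^sub>R f x) = (\<lambda>x. snd x $ i *\<^sub>R X g x *\<^sub>R f x + g x *\<^sub>R T i f x)"
  by (simp add: T_eq pd_rules(6)[OF assms(2,1)] rho_rules(3)[OF Rp_nonzero assms(2,1)] scaleR_add_right
    scaleR_sum_right mult_ac add.assoc)

lemma T_coord:
  assumes "f \<in> S"
  shows "T i (\<lambda>x. snd x $ k *\<^sub>R f x) = (\<lambda>x. snd x $ k *\<^sub>R T i f x + Sop i k f x)"
  by (simp add: T_eq pd_rules(8)[OF assms] rho_rules(4)[OF Rp_nonzero assms] scaleR_add_right
    scaleR_sum_right sum.distrib Sop_def fun_eq_iff mult_ac)

text \<open>Equivariance of the Dunkl gradient: the vector of all \<open>T i f\<close> is reflected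
  along with the point. For the divided differences the sum over roots is re-indexed, using that
  \<open>\<kappa>\<close> is invariant and that a root and its divided difference change sign
  together.\<close>

lemma T_refl:
  assumes b: "\<beta> \<in> R" and f: "f \<in> S"
  shows "T i (\<lambda>x. f (para_refl \<beta> x)) = (\<lambda>x. T i f (para_refl \<beta> x)
    - (2 * \<beta> $ i / (norm \<beta>)\<^sup>2) *\<^sub>R (\<Sum>j\<in>UNIV. \<beta> $ j *\<^sub>R T j f (para_refl \<beta> x)))"
proof (rule ext)
  fix x
  define y where "y = para_refl \<beta> x"
  define \<phi> where "\<phi> = (\<lambda>\<gamma>. (\<kappa> \<gamma> * reflection \<beta> \<gamma> $ i) *\<^sub>R rho \<gamma> f y)"
  let ?c = "2 * \<beta> $ i / (norm \<beta>)\<^sup>2"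
  have even: "\<phi> (- \<gamma>) = \<phi> \<gamma>" if "\<gamma> \<in> R" for \<gamma>
    by (simp add: \<phi>_def \<kappa>_uminus[OF that] rho_uminus_root[OF R_nonzero[OF that] f] linear_neg[OF linear_reflection])
  have "(\<Sum>\<alpha>\<in>Rp. (\<kappa> \<alpha> * \<alpha> $ i) *\<^sub>R rho \<alpha> (\<lambda>x. f (para_refl \<beta> x)) x) = (\<Sum>\<alpha>\<in>Rp. \<phi> (reflection \<beta> \<alpha>))"
    using Rp_subset
    by (intro sum.cong refl) (auto simp: rho_refl[OF Rp_nonzero f] \<phi>_def y_def \<kappa>_reflection b)
  also have "\<dots> = (\<Sum>\<alpha>\<in>Rp. \<phi> \<alpha>)" by (rule sum_Rp_reflection[OF _ b]) (rule even)
  also have "\<dots> = (\<Sum>\<alpha>\<in>Rp. (\<kappa> \<alpha> * \<alpha> $ i) *\<^sub>R rho \<alpha> f y)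
      - ?c *\<^sub>R (\<Sum>\<alpha>\<in>Rp. (\<beta> \<bullet> \<alpha>) *\<^sub>R \<kappa> \<alpha> *\<^sub>R rho \<alpha> f y)"
    unfolding scaleR_sum_right sum_subtractf[symmetric]
    by (intro sum.cong refl) (simp add: \<phi>_def reflection_component algebra_simps)
  also have "(\<Sum>\<alpha>\<in>Rp. (\<beta> \<bullet> \<alpha>) *\<^sub>R \<kappa> \<alpha> *\<^sub>R rho \<alpha> f y) =
      (\<Sum>j\<in>UNIV. \<beta> $ j *\<^sub>R (\<Sum>\<alpha>\<in>Rp. (\<kappa> \<alpha> * \<alpha> $ j) *\<^sub>R rho \<alpha> f y))"
    by (simp only: inner_scaleR_sum scaleR_sum_right, subst sum.swap) (simp add: mult_ac)
  finally show "T i (\<lambda>x. f (para_refl \<beta> x)) x = T i f (para_refl \<beta> x) - ?c *\<^sub>R (\<Sum>j\<in>UNIV. \<beta> $ j *\<^sub>R T j f (para_refl \<beta> x))"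
    by (simp add: T_eq pd_refl[OF f] y_def scaleR_add_right sum.distrib algebra_simps)
qed

lemma T_Sop:
  assumes "f \<in> S"
  shows "T i (Sop j k f) x = (if j = k then 1 else 0) *\<^sub>R T i f x +
    (\<Sum>\<alpha>\<in>Rp. (2 * \<kappa> \<alpha> * \<alpha> $ j * \<alpha> $ k / (norm \<alpha>)\<^sup>2) *\<^sub>R (T i f (para_refl \<alpha> x)
    - (2 * \<alpha> $ i / (norm \<alpha>)\<^sup>2) *\<^sub>R (\<Sum>l\<in>UNIV. \<alpha> $ l *\<^sub>R T l f (para_refl \<alpha> x))))"
proof -
  have "T i (Sop j k f) = (\<lambda>x. (if j = k then 1 else 0) *\<^sub>R T i f x +
    (\<Sum>\<alpha>\<in>Rp. (2 * \<kappa> \<alpha> * \<alpha> $ j * \<alpha> $ k / (norm \<alpha>)\<^sup>2) *\<^sub>R T i (\<lambda>x. f (para_refl \<alpha> x)) x))"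
    unfolding Sop_def[abs_def]
    by (subst T_add) (auto intro!: S_scale S_refl S_sum finite_Rp assms simp: T_scale T_sum assms finite_Rp S_scale S_refl)
  moreover have "\<alpha> \<in> R" if "\<alpha> \<in> Rp" for \<alpha> using that Rp_subset by auto
  ultimately show ?thesis by (simp add: T_refl assms)
qed

lemma T0_Sop: "f \<in> S \<Longrightarrow> T0 (Sop j k f) = Sop j k (T0 f)"
  unfolding Sop_def[abs_def]
  by (subst pd_rules(3)) (auto intro!: S_scale S_refl S_sum finite_Rp simp: T0_scale T0_sum finite_Rp S_scale S_refl pd_refl)

text \<open>
  The commutator of \<open>T i\<close> and \<open>T j\<close> commutes with multiplication by radial functions and coordinates
  and annihilates constants.
\<close>

lemma T_commute: "f \<in> S \<Longrightarrow> T i (T j f) = T j (T i f)"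
proof (induction rule: S.induct)
  case (const c)
  then show ?case by (simp add: T_const T_zero)
next
  case (add f h)
  then show ?case by (simp add: T_add S_T)
next
  case (rad g f)
  have "T i (T j (\<lambda>x. g x *\<^sub>R f x)) = (\<lambda>x. snd x $ j *\<^sub>R snd x $ i *\<^sub>R X (X g) x *\<^sub>R f x +
      (snd x $ j *\<^sub>R X g x *\<^sub>R T i f x + snd x $ i *\<^sub>R X g x *\<^sub>R T j f x)
      + Sop i j (\<lambda>x. X g x *\<^sub>R f x) x + g x *\<^sub>R T i (T j f) x)" for i j
    using rad(1,2)
    by (subst T_rad, simp, simp, subst T_add, intro S.intros Rad_X, simp, simp, intro S.intros S_T, simp, simp)
      (simp add: T_coord T_rad S.rad S_T Rad_X fun_eq_iff scaleR_add_right del: scaleR_scaleR)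
  from this[of i j] this[of j i] show ?case
    by (simp only: rad.IH Sop_commute[of j i]) (simp add: fun_eq_iff add_ac mult_ac)
next
  case (coord f k)
  have "T i (T j (\<lambda>x. snd x $ k *\<^sub>R f x)) x = snd x $ k *\<^sub>R T i (T j f) x + Sop i k (T j f) x + T i (Sop j k f) x" for i j x
    using coord(1)
    by (subst T_coord, simp, subst T_add, intro S.intros S_T, simp, simp add: S_Sop) (simp add: T_coord S_T)
  \<comment> \<open>Besides the induction hypothesis,
    \<open>Sop i k (T j f) + T i (Sop j k f)\<close> has to be symmetric in \<open>i\<close> and
    \<open>j\<close>. The reflected terms pair up, and the correction from equivariance carries the
    symmetric factor \<open>\<alpha> $ i * \<alpha> $ j * \<alpha> $ k\<close>.\<close>
  then show ?case
    by (intro ext) (simp add: coord T_Sop, simp add: Sop_def sum.distrib sum_subtractf algebra_simps)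
qed

text \<open>The radial case rests on \<open>X_T0\<close>, the coordinate case on the fact that the
  reflections fix x0.\<close>

lemma T0_T_commute: "f \<in> S \<Longrightarrow> T0 (T i f) = T i (T0 f)"
proof (induction rule: S.induct)
  case (const c)
  then show ?case by (simp add: T_const T_zero T0_zero pd_rules[OF S.const])
next
  case (add f h)
  then show ?case by (simp add: T_add S_T S_T0 pd_rules)
next
  case (rad g f)
  have "T0 (T i (\<lambda>x. g x *\<^sub>R f x)) = (\<lambda>x. snd x $ i *\<^sub>R (T0 (X g) x *\<^sub>R f x + X g x *\<^sub>R T0 f x)
      + (T0 g x *\<^sub>R T i f x + g x *\<^sub>R T0 (T i f) x))"
    using rad(1,2)
    by (subst T_rad, simp, simp, subst pd_rules(3), intro S.intros Rad_X, simp, simp, intro S.intros S_T, simp, simp)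
      (simp add: pd_rules S.rad S_T Rad_X del: scaleR_scaleR)
  moreover have "T i (T0 (\<lambda>x. g x *\<^sub>R f x)) = (\<lambda>x. (snd x $ i *\<^sub>R X (T0 g) x *\<^sub>R f x + T0 g x *\<^sub>R T i f x)
      + (snd x $ i *\<^sub>R X g x *\<^sub>R T0 f x + g x *\<^sub>R T i (T0 f) x))"
    using rad(1,2)
    by (subst pd_rules, simp, simp, subst T_add, intro S.intros Rad_T0, simp, simp, intro S.intros S_T0, simp, simp)
      (simp add: T_rad S.rad S_T0 Rad_T0 del: scaleR_scaleR)
  ultimately show ?case by (simp add: X_T0 rad fun_eq_iff scaleR_add_right)
next
  case (coord f k)
  then show ?case by (simp add: T_coord pd_rules S_T S_T0 S_Sop S.coord T0_Sop)
qed

end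

section \<open>Clifford relations inside double sums\<close>

lemma cl_gen_anticommute:
  "cl_gen i \<odot> (cl_gen j \<odot> a) + cl_gen j \<odot> (cl_gen i \<odot> a) = (if i = j then -2 *\<^sub>R a else 0)"
proof -
  have "cl_gen i \<odot> (cl_gen j \<odot> a) + cl_gen j \<odot> (cl_gen i \<odot> a) = (cl_gen i \<odot> cl_gen j + cl_gen j \<odot> cl_gen i) \<odot> a"
    by (simp add: cl_mult_assoc linear_add[OF linear_cl_mult(1)])
  also have "\<dots> = (if i = j then -2 *\<^sub>R a else 0)"
    by (simp only: cl_gen_relation linear_cmul[OF linear_cl_mult(1)] linear_0[OF linear_cl_mult(1)] cl_mult_one if_distrib[of "\<lambda>c. c \<odot> a"])
  finally show ?thesis .
qed

text \<open>Adding the sum to its transpose produces anticommutators, which vanish off the diagonal.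
  In this way the square of the vector variable, the square of \<open>Dir\<close> and the
  commutators \<open>Sop\<close> all collapse to traces.\<close>

lemma cl_gen_symmetric_sum:
  fixes a :: "'n::{finite,linorder} \<Rightarrow> 'n \<Rightarrow> 'n clifford"
  assumes "\<And>i j. a i j = a j i"
  shows "(\<Sum>i\<in>UNIV. \<Sum>j\<in>UNIV. cl_gen i \<odot> (cl_gen j \<odot> a i j)) = - (\<Sum>i\<in>UNIV. a i i)"
proof -
  let ?s = "\<Sum>i\<in>UNIV. \<Sum>j\<in>UNIV. cl_gen i \<odot> (cl_gen j \<odot> a i j)"
  have "?s = (\<Sum>i\<in>UNIV. \<Sum>j\<in>UNIV. cl_gen j \<odot> (cl_gen i \<odot> a i j))"
    by (subst sum.swap) (simp add: assms)
  then have "2 *\<^sub>R ?s = (\<Sum>i\<in>UNIV. \<Sum>j\<in>UNIV. cl_gen i \<odot> (cl_gen j \<odot> a i j) + cl_gen j \<odot> (cl_gen i \<odot> a i j))"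
    by (simp add: scaleR_2 sum.distrib)
  also have "\<dots> = 2 *\<^sub>R (- (\<Sum>i\<in>UNIV. a i i))"
    by (simp add: cl_gen_anticommute scaleR_sum_right sum_negf)
  finally show ?thesis by (simp only: scaleR_left_imp_eq scaleR_cancel_left) simp
qed

lemma bounded_linear_cl_mult: "bounded_linear (\<lambda>x. c \<odot> x)"
  using linear_cl_mult(2) linear_conv_bounded_linear by blast

lemma cl_mult_sum_right: "c \<odot> (\<Sum>i\<in>A. f i) = (\<Sum>i\<in>A. c \<odot> f i)"
  by (rule linear_sum[OF linear_cl_mult(2)])

lemma cl_mult_scaleR_right: "c \<odot> (r *\<^sub>R x) = r *\<^sub>R (c \<odot> x)"
  by (rule linear_cmul[OF linear_cl_mult(2)])

lemma cl_mult_add_right: "c \<odot> (x + y) = c \<odot> x + c \<odot> y"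
  by (rule linear_add[OF linear_cl_mult(2)])

section \<open>Multiplying radial functions by x0 and r squared, and the radial differential
  equation\<close>

context axial_dunkl begin

definition \<mu> :: real where "\<mu> = dunkl_dim Rp \<kappa>"

definition r2 :: "'n paravec \<Rightarrow> real" where "r2 x = snd x \<bullet> snd x"

text \<open>x0 itself does not vanish outside \<open>U\<close> and so is not in \<open>Rad\<close>.
  Its restriction, the real part of z, is, and multiplication by \<open>g\<close> hides the
  difference.\<close>

lemma Rad_fst: "g \<in> Rad \<Longrightarrow> (\<lambda>x. fst x * g x) \<in> Rad"
  and T0_Rad_fst: "g \<in> Rad \<Longrightarrow> T0 (\<lambda>x. fst x * g x) = (\<lambda>x. g x + fst x * T0 g x)"
  and X_Rad_fst: "g \<in> Rad \<Longrightarrow> X (\<lambda>x. fst x * g x) = (\<lambda>x. fst x * X g x)"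
proof -
  assume g: "g \<in> Rad"
  note id = rad_deriv_Re[OF holomorphic_on_ident]
  note p = Rad.Re[OF holomorphic_on_ident] g
  have eq: "(\<lambda>x. restr (\<lambda>x. Re (zc x)) x * g x) = (\<lambda>x. fst x * g x)" if "g \<in> Rad" for g
    by (rule ext) (simp add: restr_def Rad_zero[OF that] zc_def)
  show "(\<lambda>x. fst x * g x) \<in> Rad" using Rad.mult[OF p] by (simp add: eq[OF g])
  show "T0 (\<lambda>x. fst x * g x) = (\<lambda>x. g x + fst x * T0 g x)"
    using rad_mult(1)[OF p] unfolding rad_derivD(1)[OF id] eq[OF g]
    by (auto simp: fun_eq_iff restr_def Rad_zero[OF g] Rad_zero[OF Rad_T0[OF g]] zc_def)
  show "X (\<lambda>x. fst x * g x) = (\<lambda>x. fst x * X g x)"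
    using rad_mult(2)[OF p] unfolding rad_derivD(2)[OF id] eq[OF g]
    by (auto simp: fun_eq_iff restr_def Rad_zero[OF Rad_X[OF g]] zc_def)
qed

lemma Rad_r2: "g \<in> Rad \<Longrightarrow> (\<lambda>x. r2 x * g x) \<in> Rad"
  and T0_Rad_r2: "g \<in> Rad \<Longrightarrow> T0 (\<lambda>x. r2 x * g x) = (\<lambda>x. r2 x * T0 g x)"
  and X_Rad_r2: "g \<in> Rad \<Longrightarrow> X (\<lambda>x. r2 x * g x) = (\<lambda>x. 2 * g x + r2 x * X g x)"
proof -
  assume g: "g \<in> Rad"
  \<comment> \<open>The real part of \<open>- \<i> * z\<close> is r, so the square of
    \<open>?s\<close> agrees with \<open>r2\<close> on \<open>U\<close>.\<close>
  let ?s = "restr (\<lambda>x. Re (- \<i> * zc x))"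
  have h: "(\<lambda>z. - \<i> * z) holomorphic_on \<Omega>" by (intro holomorphic_intros)
  note s = rad_deriv_Re[OF h]
  note p = Rad.mult[OF Rad.Re[OF h] Rad.Re[OF h]] g
  note q = rad_deriv_mult[OF Rad.Re[OF h] Rad.Re[OF h] s s]
  have d: "deriv (\<lambda>z. - (\<i> * z)) = (\<lambda>z. - \<i>)"
    by (rule ext, rule DERIV_imp_deriv) (auto intro!: derivative_eq_intros)
  have eq: "(\<lambda>x. (?s x * ?s x) * g x) = (\<lambda>x. r2 x * g x)" if "g \<in> Rad" for g
    by (rule ext) (simp add: restr_def Rad_zero[OF that] zc_def r2_def power2_norm_eq_inner[symmetric] power2_eq_square)
  show "(\<lambda>x. r2 x * g x) \<in> Rad" using Rad.mult[OF p] by (simp only: eq[OF g])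
  show "T0 (\<lambda>x. r2 x * g x) = (\<lambda>x. r2 x * T0 g x)"
    using rad_mult(1)[OF p] unfolding rad_derivD(1)[OF q] eq[OF g]
    by (auto simp: fun_eq_iff restr_def Rad_zero[OF g] Rad_zero[OF Rad_T0[OF g]] zc_def d r2_def dot_square_norm power2_eq_square)
  show "X (\<lambda>x. r2 x * g x) = (\<lambda>x. 2 * g x + r2 x * X g x)"
    using rad_mult(2)[OF p] U_snd_nonzero unfolding rad_derivD(2)[OF q] eq[OF g]
    by (auto simp: fun_eq_iff restr_def Rad_zero[OF g] Rad_zero[OF Rad_X[OF g]] zc_def d r2_def dot_square_norm power2_eq_square)
qed

lemma Rad_cmult: "g \<in> Rad \<Longrightarrow> (\<lambda>x. c * g x) \<in> Rad"
  and T0_Rad_cmult: "g \<in> Rad \<Longrightarrow> T0 (\<lambda>x. c * g x) = (\<lambda>x. c * T0 g x)"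
  and X_Rad_cmult: "g \<in> Rad \<Longrightarrow> X (\<lambda>x. c * g x) = (\<lambda>x. c * X g x)"
proof -
  assume g: "g \<in> Rad"
  have h: "(\<lambda>z. of_real c) holomorphic_on \<Omega>" by (intro holomorphic_intros)
  note p = Rad.Re[OF h] g
  have eq: "(\<lambda>x. restr (\<lambda>x. Re (of_real c)) x * g x) = (\<lambda>x. c * g x)" if "g \<in> Rad" for g
    by (rule ext) (simp add: restr_def Rad_zero[OF that] zc_def)
  show "(\<lambda>x. c * g x) \<in> Rad" using Rad.mult[OF p] by (simp only: eq[OF g])
  show "T0 (\<lambda>x. c * g x) = (\<lambda>x. c * T0 g x)"
    using rad_mult(1)[OF p] unfolding rad_derivD(1)[OF rad_deriv_Re[OF h]] eq[OF g]
    by (auto simp: fun_eq_iff restr_def Rad_zero[OF Rad_T0[OF g]])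
  show "X (\<lambda>x. c * g x) = (\<lambda>x. c * X g x)"
    using rad_mult(2)[OF p] unfolding rad_derivD(2)[OF rad_deriv_Re[OF h]] eq[OF g]
    by (auto simp: fun_eq_iff restr_def Rad_zero[OF Rad_X[OF g]])
qed

lemma rad_diff:
  assumes "g \<in> Rad" "h \<in> Rad"
  shows "(\<lambda>x. g x - h x) \<in> Rad" "T0 (\<lambda>x. g x - h x) = (\<lambda>x. T0 g x - T0 h x)"
    "X (\<lambda>x. g x - h x) = (\<lambda>x. X g x - X h x)"
proof -
  have eq: "(\<lambda>x. g x - h x) = (\<lambda>x. g x + - 1 * h x)" by auto
  note m = assms(1) Rad_cmult[OF assms(2), of "- 1"]
  show "(\<lambda>x. g x - h x) \<in> Rad" unfolding eq by (rule Rad.add[OF m])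
  show "T0 (\<lambda>x. g x - h x) = (\<lambda>x. T0 g x - T0 h x)"
    unfolding eq rad_add(1)[OF m] T0_Rad_cmult[OF assms(2)] by simp
  show "X (\<lambda>x. g x - h x) = (\<lambda>x. X g x - X h x)"
    unfolding eq rad_add(2)[OF m] X_Rad_cmult[OF assms(2)] by simp
qed

text \<open>When Euler's formula trades the Euler operator of the vector variable for an x0
  derivative, \<open>- 2 * fst x * X g x\<close> appears next to \<open>2 * T0 g x\<close>;
  \<open>Y\<close> is half of their sum.\<close>

definition Y :: "('n paravec \<Rightarrow> real) \<Rightarrow> 'n paravec \<Rightarrow> real"
  where "Y g = (\<lambda>x. T0 g x - fst x * X g x)"

text \<open>
  On radial functions the Laplacian acts as \<open>L0 + \<mu> X\<close>, since \<open>r\<^sup>2 X\<^sup>2 = \<partial>\<^sub>r\<^sup>2 - X\<close>.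
\<close>

definition L0 :: "('n paravec \<Rightarrow> real) \<Rightarrow> 'n paravec \<Rightarrow> real"
  where "L0 g = (\<lambda>x. T0 (T0 g) x + r2 x * X (X g) x)"

text \<open>In x0 and r the equation reads \<open>g_00 + g_rr + ((c - 1) / r) g_r = 0\<close>, the
  Laplace equation for axially symmetric functions of x0 and a vector variable of dimension
  \<open>c\<close>.\<close>

definition rad_eigen :: "real \<Rightarrow> ('n paravec \<Rightarrow> real) \<Rightarrow> bool"
  where "rad_eigen c g \<longleftrightarrow> g \<in> Rad \<and> L0 g = (\<lambda>x. - c * X g x)"

lemmas rad_simps = rad_diff rad_add Rad_T0 Rad_X Rad.add Rad_cmult Rad_r2 Rad_fst
  T0_Rad_cmult X_Rad_cmult T0_Rad_fst X_Rad_fst T0_Rad_r2 X_Rad_r2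

lemma Rad_Y: "g \<in> Rad \<Longrightarrow> Y g \<in> Rad"
  by (simp add: Y_def rad_simps)

lemma X_Y: "g \<in> Rad \<Longrightarrow> X (Y g) = Y (X g)"
  by (simp add: Y_def rad_simps X_T0)

lemma rad_eigen_X:
  assumes "rad_eigen c g" shows "rad_eigen (c + 2) (X g)"
proof -
  have g: "g \<in> Rad" and e: "L0 g = (\<lambda>x. - c * X g x)" using assms by (auto simp: rad_eigen_def)
  have "X (L0 g) = (\<lambda>x. - c * X (X g) x)" unfolding e by (rule X_Rad_cmult[OF Rad_X[OF g]])
  \<comment> \<open>The extra term comes from \<open>X\<close> differentiating the factor
    \<open>r2\<close>, with value 2.\<close>
  moreover have "L0 (X g) = (\<lambda>x. X (L0 g) x - 2 * X (X g) x)"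
    using g by (simp add: L0_def rad_simps X_T0[symmetric])
  ultimately show ?thesis using g by (simp add: rad_eigen_def Rad_X algebra_simps)
qed

lemma rad_eigen_Y:
  assumes "rad_eigen c g" shows "rad_eigen (c + 2) (Y g)"
proof -
  have g: "g \<in> Rad" and e: "L0 g = (\<lambda>x. - c * X g x)" using assms by (auto simp: rad_eigen_def)
  have "Y (L0 g) = (\<lambda>x. - c * Y (X g) x)"
    unfolding e Y_def T0_Rad_cmult[OF Rad_X[OF g]] X_Rad_cmult[OF Rad_X[OF g]] by (simp add: algebra_simps)
  \<comment> \<open>Differentiating x0 in the second \<open>T0\<close> of \<open>Y g\<close> gives
    \<open>- 2 * T0 (X g) x\<close>, and moving \<open>X\<close> past \<open>r2\<close> gives
    \<open>2 * fst x * X (X g) x\<close>; together they are \<open>- 2 * Y (X g) x\<close>.\<close>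
  moreover have "L0 (Y g) = (\<lambda>x. Y (L0 g) x - 2 * Y (X g) x)"
    using g by (simp add: Y_def L0_def rad_simps X_T0 fun_eq_iff algebra_simps)
  ultimately show ?thesis using g by (simp add: rad_eigen_def Rad_Y X_Y algebra_simps)
qed

section \<open>The Laplacian and the Dirac operator\<close>

definition Lap :: "('n paravec \<Rightarrow> 'b::real_normed_vector) \<Rightarrow> 'n paravec \<Rightarrow> 'b"
  where "Lap f = (\<lambda>x. T0 (T0 f) x + (\<Sum>i\<in>UNIV. T i (T i f) x))"

text \<open>
  \<open>H\<close> is \<open>2 E + \<mu>\<close> with \<open>E\<close> the Euler operator of the vector variable.
\<close>

definition H :: "('n paravec \<Rightarrow> 'b::real_normed_vector) \<Rightarrow> 'n paravec \<Rightarrow> 'b"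
  where "H f = (\<lambda>x. \<Sum>i\<in>UNIV. (snd x $ i *\<^sub>R T i f x + T i (\<lambda>x. snd x $ i *\<^sub>R f x) x))"

lemma H_eq: "f \<in> S \<Longrightarrow> H f x = (\<Sum>i\<in>UNIV. 2 *\<^sub>R snd x $ i *\<^sub>R T i f x + Sop i i f x)"
  by (simp add: H_def T_coord scaleR_2 add.assoc del: scaleR_scaleR)

text \<open>The divided differences contribute \<open>f\<close> minus its reflections, weighted by
  \<open>2 * \<kappa> \<alpha>\<close>, and the commutators give the same reflections back. They
  cancel and leave \<open>f\<close> with the factor \<open>2 * gamma_kappa Rp \<kappa>\<close> plus
  the dimension, which is \<open>\<mu>\<close>.\<close>

lemma H_euler:
  assumes f: "f \<in> S"
  shows "H f = (\<lambda>x. 2 *\<^sub>R (\<Sum>i\<in>UNIV. snd x $ i *\<^sub>R pd i f x) + \<mu> *\<^sub>R f x)"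
proof (rule ext)
  fix x
  have 1: "(\<Sum>i\<in>UNIV. snd x $ i *\<^sub>R T i f x) = (\<Sum>i\<in>UNIV. snd x $ i *\<^sub>R pd i f x)
    + (\<Sum>\<alpha>\<in>Rp. \<kappa> \<alpha> *\<^sub>R (\<alpha> \<bullet> snd x) *\<^sub>R rho \<alpha> f x)"
    unfolding inner_scaleR_sum scaleR_sum_right
    by (subst sum.swap) (simp add: T_eq scaleR_add_right sum.distrib scaleR_sum_right mult_ac)
  have 2: "(\<Sum>i\<in>UNIV. Sop i i f x) = real CARD('n) *\<^sub>R f x + (\<Sum>\<alpha>\<in>Rp. 2 *\<^sub>R \<kappa> \<alpha> *\<^sub>R f (para_refl \<alpha> x))"
  proof -
    have "(\<Sum>i\<in>UNIV. \<Sum>\<alpha>\<in>Rp. (2 * \<kappa> \<alpha> * \<alpha> $ i * \<alpha> $ i / (norm \<alpha>)\<^sup>2) *\<^sub>R f (para_refl \<alpha> x)) =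
      (\<Sum>\<alpha>\<in>Rp. ((2 * \<kappa> \<alpha> / (norm \<alpha>)\<^sup>2) * (\<alpha> \<bullet> \<alpha>)) *\<^sub>R f (para_refl \<alpha> x))"
      unfolding scaleR_scaleR[symmetric] inner_scaleR_sum scaleR_sum_right by (subst sum.swap) (simp add: mult_ac)
    also have "\<dots> = (\<Sum>\<alpha>\<in>Rp. 2 *\<^sub>R \<kappa> \<alpha> *\<^sub>R f (para_refl \<alpha> x))"
      by (intro sum.cong refl) (auto simp: power2_norm_eq_inner Rp_nonzero)
    finally show ?thesis by (simp add: Sop_def sum.distrib sum_constant_scaleR)
  qed
  have 3: "\<kappa> \<alpha> *\<^sub>R (\<alpha> \<bullet> snd x) *\<^sub>R rho \<alpha> f x = \<kappa> \<alpha> *\<^sub>R f x - \<kappa> \<alpha> *\<^sub>R f (para_refl \<alpha> x)" if "\<alpha> \<in> Rp" for \<alpha>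
    by (simp add: rho_eq[OF Rp_nonzero[OF that] f, symmetric] scaleR_diff_right del: scaleR_scaleR)
  have "H f x = 2 *\<^sub>R (\<Sum>i\<in>UNIV. snd x $ i *\<^sub>R T i f x) + (\<Sum>i\<in>UNIV. Sop i i f x)"
    by (simp add: H_eq[OF f] sum.distrib scaleR_sum_right)
  also have "\<dots> = 2 *\<^sub>R (\<Sum>i\<in>UNIV. snd x $ i *\<^sub>R pd i f x) + \<mu> *\<^sub>R f x"
    unfolding 1 2 by (simp add: 3 sum_subtractf scaleR_diff_right scaleR_add_right scaleR_sum_right[symmetric]
      scaleR_sum_left[symmetric] \<mu>_def dunkl_dim_def gamma_kappa_def scaleR_add_left del: scaleR_scaleR)
      (simp add: scaleR_scaleR)
  finally show "H f x = 2 *\<^sub>R (\<Sum>i\<in>UNIV. snd x $ i *\<^sub>R pd i f x) + \<mu> *\<^sub>R f x" .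
qed

lemma H_coord:
  assumes f: "f \<in> S"
  shows "H (\<lambda>x. snd x $ k *\<^sub>R f x) x = snd x $ k *\<^sub>R H f x + 2 *\<^sub>R snd x $ k *\<^sub>R f x"
proof -
  have "(\<Sum>i\<in>UNIV. snd x $ i *\<^sub>R (snd x $ k *\<^sub>R pd i f x + (if i = k then f x else 0))) =
    snd x $ k *\<^sub>R (\<Sum>i\<in>UNIV. snd x $ i *\<^sub>R pd i f x) + snd x $ k *\<^sub>R f x"
    by (simp add: scaleR_add_right sum.distrib scaleR_sum_right mult_ac if_distrib[of "\<lambda>c. _ *\<^sub>R c"] cong: if_cong)
  then show ?thesis
    unfolding H_euler[OF S.coord[OF f]] H_euler[OF f] pd_rules(8)[OF f] by (simp only:) (simp add: algebra_simps)
qed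

lemma S_H: "f \<in> S \<Longrightarrow> H f \<in> S"
  unfolding H_def by (intro S_sum S.add S.coord S_T) auto

lemma S_Lap: "f \<in> S \<Longrightarrow> Lap f \<in> S"
  unfolding Lap_def by (intro S_sum S.add S_T0 S_T) auto

lemma H_T0:
  assumes f: "f \<in> S" shows "H (T0 f) = T0 (H f)"
proof -
  have 1: "T0 (H f) = (\<lambda>x. \<Sum>i\<in>UNIV. T0 (\<lambda>x. snd x $ i *\<^sub>R T i f x + T i (\<lambda>x. snd x $ i *\<^sub>R f x) x) x)"
    unfolding H_def by (rule T0_sum) (simp_all add: S.add S.coord S_T f)
  have 2: "T0 (\<lambda>x. snd x $ i *\<^sub>R T i f x + T i (\<lambda>x. snd x $ i *\<^sub>R f x) x) =
    (\<lambda>x. snd x $ i *\<^sub>R T i (T0 f) x + T i (\<lambda>x. snd x $ i *\<^sub>R T0 f x) x)" for i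
    unfolding pd_rules(3)[OF S.coord[OF S_T[OF f]] S_T[OF S.coord[OF f]]] pd_rules(7)[OF S_T[OF f]]
      T0_T_commute[OF f] T0_T_commute[OF S.coord[OF f]] pd_rules(7)[OF f] ..
  show ?thesis unfolding 1 2 by (simp only: H_def)
qed

lemma H_add:
  assumes f: "f \<in> S" and h: "h \<in> S" shows "H (\<lambda>x. f x + h x) = (\<lambda>x. H f x + H h x)"
  unfolding H_euler[OF f] H_euler[OF h] H_euler[OF S.add[OF f h]] pd_rules(4)[OF f h]
  by (simp add: scaleR_add_right sum.distrib add_ac)

lemma H_linear:
  assumes L: "bounded_linear L" and f: "f \<in> S" shows "H (\<lambda>x. L (f x)) = (\<lambda>x. L (H f x))"
proof -
  interpret L: bounded_linear L by fact
  show ?thesis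
    unfolding H_euler[OF f] H_euler[OF S_linear[OF L.linear_axioms f]] pd_linear(2)[OF L f]
    by (simp add: L.add L.sum L.scaleR)
qed

lemma H_rad:
  assumes f: "f \<in> S" and g: "g \<in> Rad"
  shows "H (\<lambda>x. g x *\<^sub>R f x) x = (2 * r2 x * X g x) *\<^sub>R f x + g x *\<^sub>R H f x"
proof -
  have "(\<Sum>i\<in>UNIV. snd x $ i *\<^sub>R (snd x $ i *\<^sub>R X g x *\<^sub>R f x + g x *\<^sub>R pd i f x)) =
    (r2 x * X g x) *\<^sub>R f x + g x *\<^sub>R (\<Sum>i\<in>UNIV. snd x $ i *\<^sub>R pd i f x)"
    by (simp add: r2_def inner_vec_def scaleR_add_right sum.distrib
      scaleR_sum_right scaleR_sum_left sum_distrib_left sum_distrib_right mult_ac)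
  then show ?thesis
    unfolding H_euler[OF S.rad[OF g f]] H_euler[OF f] pd_rules(6)[OF f g] by (simp only:) (simp add: algebra_simps)
qed

lemma Lap_add:
  assumes f: "f \<in> S" and h: "h \<in> S" shows "Lap (\<lambda>x. f x + h x) = (\<lambda>x. Lap f x + Lap h x)"
  unfolding Lap_def pd_rules(3)[OF f h] pd_rules(3)[OF S_T0[OF f] S_T0[OF h]] T_add[OF f h] T_add[OF S_T[OF f] S_T[OF h]]
  by (simp add: sum.distrib add_ac)

lemma Lap_linear:
  assumes L: "bounded_linear L" and f: "f \<in> S" shows "Lap (\<lambda>x. L (f x)) = (\<lambda>x. L (Lap f x))"
proof -
  interpret L: bounded_linear L by fact
  show ?thesis
    unfolding Lap_def T_linear[OF L f] T_linear[OF L S_T[OF f]] pd_linear(1)[OF L f] pd_linear(1)[OF L S_T0[OF f]]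
    by (simp add: L.add L.sum)
qed

lemma Lap_scale: "f \<in> S \<Longrightarrow> Lap (\<lambda>x. c *\<^sub>R f x) = (\<lambda>x. c *\<^sub>R Lap f x)"
  by (rule Lap_linear[OF bounded_linear_scaleR_right])

lemma Lap_zero [simp]: "Lap (\<lambda>_. 0) = (\<lambda>_. 0)"
  by (simp add: Lap_def T0_zero T_zero)

lemma Lap_sum:
  "finite I \<Longrightarrow> (\<And>j. j \<in> I \<Longrightarrow> f j \<in> S) \<Longrightarrow> Lap (\<lambda>x. \<Sum>j\<in>I. f j x) = (\<lambda>x. \<Sum>j\<in>I. Lap (f j) x)"
  by (induction rule: finite_induct) (simp_all add: Lap_zero Lap_add S_sum)

lemma Lap_T0: "f \<in> S \<Longrightarrow> Lap (T0 f) = T0 (Lap f)"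
  by (simp add: Lap_def pd_rules(3) S_T0 S_T S_sum T0_sum T0_T_commute)

lemma Lap_T: "f \<in> S \<Longrightarrow> Lap (T i f) = T i (Lap f)"
proof -
  assume f: "f \<in> S"
  have "T j (T j (T i f)) = T i (T j (T j f))" for j
    by (simp only: T_commute[OF f, of j i] T_commute[OF S_T[OF f], of j i])
  then show ?thesis
    using f by (simp add: Lap_def T_add S_T0 S_T S_sum T_sum T0_T_commute)
qed

text \<open>The reflection terms of the two commutators cancel root by root; the Kronecker parts
  remain and give \<open>T k f\<close> twice.\<close>

lemma Lap_coord:
  assumes f: "f \<in> S"
  shows "Lap (\<lambda>x. snd x $ k *\<^sub>R f x) x = snd x $ k *\<^sub>R Lap f x + 2 *\<^sub>R T k f x"
proof -
  have TT: "T i (T i (\<lambda>x. snd x $ k *\<^sub>R f x)) x = snd x $ k *\<^sub>R T i (T i f) x + (Sop i k (T i f) x + T i (Sop i k f) x)" for i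
    using f by (subst T_coord, simp, subst T_add, intro S.intros S_T, simp, simp add: S_Sop) (simp add: T_coord S_T)
  \<comment> \<open>A vector plus its reflection is orthogonal to the root; here it is the vector of
    the values \<open>T i f y\<close>.\<close>
  have a: "(\<Sum>i\<in>UNIV. \<alpha> $ i *\<^sub>R (T i f y + (T i f y - (2 * \<alpha> $ i / (norm \<alpha>)\<^sup>2) *\<^sub>R (\<Sum>l\<in>UNIV. \<alpha> $ l *\<^sub>R T l f y)))) = 0"
    if "\<alpha> \<in> Rp" for \<alpha> y
  proof -
    let ?s = "\<Sum>l\<in>UNIV. \<alpha> $ l *\<^sub>R T l f y"
    have "(\<Sum>i\<in>UNIV. \<alpha> $ i *\<^sub>R (T i f y + (T i f y - (2 * \<alpha> $ i / (norm \<alpha>)\<^sup>2) *\<^sub>R ?s))) =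
      2 *\<^sub>R ?s - (\<Sum>i\<in>UNIV. (2 * \<alpha> $ i * \<alpha> $ i / (norm \<alpha>)\<^sup>2)) *\<^sub>R ?s"
      by (simp add: scaleR_add_right scaleR_diff_right sum.distrib sum_subtractf scaleR_2 scaleR_sum_left mult_ac)
    also have "(\<Sum>i\<in>UNIV. (2 * \<alpha> $ i * \<alpha> $ i / (norm \<alpha>)\<^sup>2)) = 2"
      using Rp_nonzero[OF that]
      by (simp add: sum_divide_distrib[symmetric] sum_distrib_left[symmetric] mult.assoc power2_norm_eq_inner inner_vec_def)
        (metis inner_eq_zero_iff inner_vec_def inner_real_def sum.cong)
    finally show ?thesis by simp
  qed
  have "(\<Sum>i\<in>UNIV. Sop i k (T i f) x + T i (Sop i k f) x) = 2 *\<^sub>R T k f x +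
    (\<Sum>i\<in>UNIV. \<Sum>\<alpha>\<in>Rp. (2 * \<kappa> \<alpha> * \<alpha> $ k / (norm \<alpha>)\<^sup>2) *\<^sub>R \<alpha> $ i *\<^sub>R (T i f (para_refl \<alpha> x) + (T i f (para_refl \<alpha> x) -
        (2 * \<alpha> $ i / (norm \<alpha>)\<^sup>2) *\<^sub>R (\<Sum>l\<in>UNIV. \<alpha> $ l *\<^sub>R T l f (para_refl \<alpha> x)))))"
    by (simp add: T_Sop[OF f] Sop_def[of _ _ "T _ f"] sum.distrib scaleR_2 scaleR_add_right mult_ac add_ac
      if_distrib[of "\<lambda>c. c *\<^sub>R _"] cong: if_cong)
  also have "(\<Sum>i\<in>UNIV. \<Sum>\<alpha>\<in>Rp. (2 * \<kappa> \<alpha> * \<alpha> $ k / (norm \<alpha>)\<^sup>2) *\<^sub>R \<alpha> $ i *\<^sub>R (T i f (para_refl \<alpha> x) + (T i f (para_refl \<alpha> x) -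
        (2 * \<alpha> $ i / (norm \<alpha>)\<^sup>2) *\<^sub>R (\<Sum>l\<in>UNIV. \<alpha> $ l *\<^sub>R T l f (para_refl \<alpha> x))))) = 0"
    by (subst sum.swap, rule sum.neutral, rule ballI) (simp only: scaleR_sum_right[symmetric] a scaleR_zero_right)
  finally show ?thesis
    by (simp add: Lap_def TT pd_rules(7) f S_T0 sum.distrib scaleR_add_right scaleR_sum_right add.assoc)
qed

text \<open>In the second application of \<open>T i\<close> the coordinate from the gradient of
  \<open>g\<close> meets \<open>T i\<close> in both orders, which is the sum that defines
  \<open>H\<close>.\<close>

lemma Lap_rad:
  assumes f: "f \<in> S" and g: "g \<in> Rad"
  shows "Lap (\<lambda>x. g x *\<^sub>R f x) x = L0 g x *\<^sub>R f x + 2 *\<^sub>R T0 g x *\<^sub>R T0 f x + X g x *\<^sub>R H f x + g x *\<^sub>R Lap f x"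
proof -
  have "T i (T i (\<lambda>x. g x *\<^sub>R f x)) x = (snd x $ i * snd x $ i * X (X g) x) *\<^sub>R f x +
      X g x *\<^sub>R (snd x $ i *\<^sub>R T i f x + T i (\<lambda>x. snd x $ i *\<^sub>R f x) x) + g x *\<^sub>R T i (T i f) x" for i
  proof -
    have "T i (\<lambda>x. g x *\<^sub>R f x) = (\<lambda>x. X g x *\<^sub>R snd x $ i *\<^sub>R f x + g x *\<^sub>R T i f x)"
      by (simp add: T_rad[OF g f] mult_ac)
    then show ?thesis
      by (simp add: T_add S.rad Rad_X g S.coord f S_T T_rad scaleR_add_right del: scaleR_scaleR)
        (simp add: scaleR_scaleR mult_ac)
  qed
  then show ?thesis
    by (simp add: Lap_def pd_rules f g S.rad S_T0 Rad_T0 L0_def H_def r2_def inner_vec_def sum.distrib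
      scaleR_sum_right scaleR_sum_left sum_distrib_right scaleR_add_left scaleR_add_right)
      (simp add: scaleR_left_distrib[symmetric])
qed

lemma
  assumes f: "f \<in> S"
  shows S_fst: "(\<lambda>x. fst x *\<^sub>R f x) \<in> S"
  and T0_fst: "T0 (\<lambda>x. fst x *\<^sub>R f x) = (\<lambda>x. f x + fst x *\<^sub>R T0 f x)"
  and T_fst: "T i (\<lambda>x. fst x *\<^sub>R f x) = (\<lambda>x. fst x *\<^sub>R T i f x)"
  and H_fst: "H (\<lambda>x. fst x *\<^sub>R f x) = (\<lambda>x. fst x *\<^sub>R H f x)"
proof -
  have eq: "(\<lambda>x. fst x *\<^sub>R f x) = (\<lambda>x. (fst x * restr (\<lambda>_. 1) x) *\<^sub>R f x)"
    by (auto simp: restr_def S_off[OF f] fun_eq_iff)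
  note r = Rad_fst[OF Rad_const[of 1]]
  have c: "T0 (restr (\<lambda>_. 1::real)) = (\<lambda>_. 0)" "X (restr (\<lambda>_. 1)) = (\<lambda>_. 0)"
    using rad_derivD[OF rad_deriv_Re[of "\<lambda>_. 1"]] by (auto simp: restr_def)
  have z: "T0 f x = 0" "T i f x = 0" "f x = 0" "H f x = 0" if "x \<notin> U" for x i
    by (rule S_off[OF _ that], intro S_T0 S_T S_H f)+
  show "(\<lambda>x. fst x *\<^sub>R f x) \<in> S" unfolding eq by (rule S.rad[OF r f])
  show "T0 (\<lambda>x. fst x *\<^sub>R f x) = (\<lambda>x. f x + fst x *\<^sub>R T0 f x)"
    unfolding eq pd_rules(5)[OF f r] T0_Rad_fst[OF Rad_const] c by (auto simp: restr_def z)
  show "T i (\<lambda>x. fst x *\<^sub>R f x) = (\<lambda>x. fst x *\<^sub>R T i f x)"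
    unfolding eq T_rad[OF r f] X_Rad_fst[OF Rad_const] c by (auto simp: restr_def z)
  show "H (\<lambda>x. fst x *\<^sub>R f x) = (\<lambda>x. fst x *\<^sub>R H f x)"
    unfolding eq H_rad[OF f r, THEN ext] X_Rad_fst[OF Rad_const] c by (auto simp: restr_def z)
qed

lemma Lap_fst:
  assumes f: "f \<in> S"
  shows "Lap (\<lambda>x. fst x *\<^sub>R f x) = (\<lambda>x. fst x *\<^sub>R Lap f x + 2 *\<^sub>R T0 f x)"
  by (simp add: Lap_def T0_fst T_fst f S_T S_T0 S_fst pd_rules(3) scaleR_add_right scaleR_sum_right scaleR_2 add_ac)

end

text \<open>Weight of the term with \<open>a\<close> factors \<open>Y\<close> and
  \<open>k - a\<close> factors \<open>X\<close> after \<open>k\<close> Laplacians. It solves the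
  recursion of the next two lemmas: a step multiplies term \<open>a\<close> by
  \<open>2 * (N - 1 - a - k)\<close> and passes twice its weight on to \<open>a + 1\<close>.\<close>

definition power_coeff :: "real \<Rightarrow> nat \<Rightarrow> nat \<Rightarrow> real"
  where "power_coeff N k a = 2 ^ k * real (k choose a) * (\<Prod>i=a..<k. N - 1 - real i)"

lemma power_coeff_Suc_0: "power_coeff N (Suc k) 0 = 2 * (N - 1 - real k) * power_coeff N k 0"
  by (simp add: power_coeff_def)

lemma power_coeff_Suc_Suc:
  assumes "a \<le> k"
  shows "power_coeff N (Suc k) (Suc a) =
    2 * (N - 1 - real (Suc a) - real k) * power_coeff N k (Suc a) + 2 * power_coeff N k a"
proof (cases "a = k")
  case False
  then have a: "a < k" using assms by simp
  let ?p = "\<Prod>i=Suc a..<k. N - 1 - real i"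
  have p1: "(\<Prod>i=a..<k. N - 1 - real i) = (N - 1 - real a) * ?p"
    using a by (simp add: prod.atLeast_Suc_lessThan)
  have p2: "(\<Prod>i=Suc a..<Suc k. N - 1 - real i) = ?p * (N - 1 - real k)"
    using a by simp
  \<comment> \<open>Absorption cancels what the two factors have beyond \<open>N - 1 - k\<close>;
    Pascal's rule combines the rest.\<close>
  have "Suc a * (k choose Suc a) = (k - a) * (k choose a)"
    by (metis binomial_absorb_comp binomial_absorption)
  then have "real (Suc a) * real (k choose Suc a) = (real k - real a) * real (k choose a)"
    using a by (metis of_nat_mult of_nat_diff less_imp_le)
  then have "(N - 1 - real (Suc a) - real k) * real (k choose Suc a) + (N - 1 - real a) * real (k choose a)
      = (N - 1 - real k) * real (Suc k choose Suc a)"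
    by (simp add: algebra_simps)
  then have "(2 * 2 ^ k * ?p) * ((N - 1 - real (Suc a) - real k) * real (k choose Suc a) + (N - 1 - real a) * real (k choose a))
      = (2 * 2 ^ k * ?p) * ((N - 1 - real k) * real (Suc k choose Suc a))"
    by simp
  then show ?thesis unfolding power_coeff_def p1 p2 by (simp only: power_Suc) (simp only: algebra_simps)
qed (simp add: power_coeff_def)

text \<open>The product contains the zero factor \<open>i = n - 1\<close>; for \<open>a = n\<close>
  it would be empty, hence the strict inequality.\<close>

lemma power_coeff_top:
  assumes "a < n"
  shows "power_coeff (real n) n a = 0"
proof -
  have "n - 1 \<in> {a..<n}" "real n - 1 - real (n - 1) = 0" using assms by auto
  then show ?thesis unfolding power_coeff_def by (metis (no_types, lifting) finite_atLeastLessThan mult_zero_right prod_zero)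
qed

section \<open>The vector variable, the Dirac operator and iterated Laplacians\<close>

context axial_dunkl begin

text \<open>
  Left multiplication by the vector variable.
\<close>

definition V :: "('n paravec \<Rightarrow> 'n clifford) \<Rightarrow> 'n paravec \<Rightarrow> 'n clifford"
  where "V f = (\<lambda>x. \<Sum>i\<in>UNIV. snd x $ i *\<^sub>R (cl_gen i \<odot> f x))"

definition Dir :: "('n paravec \<Rightarrow> 'n clifford) \<Rightarrow> 'n paravec \<Rightarrow> 'n clifford"
  where "Dir f = (\<lambda>x. \<Sum>i\<in>UNIV. cl_gen i \<odot> T i f x)"

definition CR :: "('n paravec \<Rightarrow> 'n clifford) \<Rightarrow> 'n paravec \<Rightarrow> 'n clifford"
  where "CR f = (\<lambda>x. T0 f x + Dir f x)"

lemma S_cl: "f \<in> S \<Longrightarrow> (\<lambda>x. c \<odot> f x) \<in> S"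
  by (rule S_linear[OF linear_cl_mult(2)])

lemmas T_cl = T_linear[OF bounded_linear_cl_mult]
  and T0_cl = pd_linear(1)[OF bounded_linear_cl_mult]
  and H_cl = H_linear[OF bounded_linear_cl_mult]
  and Lap_cl = Lap_linear[OF bounded_linear_cl_mult]

lemma S_V: "f \<in> S \<Longrightarrow> V f \<in> S"
  unfolding V_def by (intro S_sum S.coord S_cl) auto

lemma S_Dir: "f \<in> S \<Longrightarrow> Dir f \<in> S"
  unfolding Dir_def by (intro S_sum S_cl S_T) auto

lemma V_V: "V (V f) x = - (r2 x *\<^sub>R f x)"
proof -
  have "V (V f) x = (\<Sum>i\<in>UNIV. \<Sum>j\<in>UNIV. cl_gen i \<odot> (cl_gen j \<odot> ((snd x $ i * snd x $ j) *\<^sub>R f x)))"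
    by (simp add: V_def cl_mult_sum_right cl_mult_scaleR_right scaleR_sum_right)
  also have "\<dots> = - (\<Sum>i\<in>UNIV. (snd x $ i * snd x $ i) *\<^sub>R f x)"
    by (rule cl_gen_symmetric_sum) (simp add: mult.commute)
  finally show ?thesis by (simp add: r2_def inner_vec_def scaleR_sum_left)
qed

lemma T_V: "f \<in> S \<Longrightarrow> T i (V f) x = (\<Sum>j\<in>UNIV. cl_gen j \<odot> T i (\<lambda>x. snd x $ j *\<^sub>R f x) x)"
  by (simp add: V_def T_sum S.coord S_cl cl_mult_scaleR_right[symmetric] T_cl)

lemma T_Dir: "f \<in> S \<Longrightarrow> T i (Dir f) = (\<lambda>x. \<Sum>j\<in>UNIV. cl_gen j \<odot> T i (T j f) x)"
  by (simp add: Dir_def T_sum S_cl S_T T_cl)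

lemma T0_Dir: "f \<in> S \<Longrightarrow> T0 (Dir f) = Dir (T0 f)"
  by (simp add: Dir_def T0_sum S_cl S_T T0_cl T0_T_commute)

lemma T0_V: "f \<in> S \<Longrightarrow> T0 (V f) = V (T0 f)"
  by (simp add: V_def T0_sum S.coord S_cl pd_rules(7) T0_cl)

lemma T0_CR: "f \<in> S \<Longrightarrow> T0 (CR f) = CR (T0 f)"
  by (simp add: CR_def pd_rules(3) S_T0 S_Dir T0_Dir)

lemma Dir_Dir:
  assumes f: "f \<in> S" shows "Dir (Dir f) x = - (\<Sum>i\<in>UNIV. T i (T i f) x)"
proof -
  have "Dir (Dir f) x = (\<Sum>i\<in>UNIV. \<Sum>j\<in>UNIV. cl_gen i \<odot> (cl_gen j \<odot> T i (T j f) x))"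
    by (simp only: Dir_def[of "Dir f"] T_Dir[OF f] cl_mult_sum_right)
  also have "\<dots> = - (\<Sum>i\<in>UNIV. T i (T i f) x)"
    by (rule cl_gen_symmetric_sum) (simp only: T_commute[OF f])
  finally show ?thesis .
qed

text \<open>Moving \<open>T i\<close> past a coordinate leaves \<open>Sop i j\<close>, whose
  symmetry reduces its double sum to minus a trace. In the other double sum the generators are
  swapped at the price of the diagonal terms \<open>2 * snd x $ i\<close> times
  \<open>T i f\<close>. The two corrections add up to \<open>- H f x\<close>.\<close>

lemma Dir_V:
  assumes f: "f \<in> S" shows "Dir (V f) x = - V (Dir f) x - H f x"
proof -
  have "Dir (V f) x = (\<Sum>i\<in>UNIV. \<Sum>j\<in>UNIV. cl_gen i \<odot> (cl_gen j \<odot> (snd x $ j *\<^sub>R T i f x + Sop i j f x)))"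
    by (simp only: Dir_def T_V[OF f] cl_mult_sum_right T_coord[OF f])
  also have "\<dots> = (\<Sum>i\<in>UNIV. \<Sum>j\<in>UNIV. cl_gen i \<odot> (cl_gen j \<odot> (snd x $ j *\<^sub>R T i f x)))
      + (\<Sum>i\<in>UNIV. \<Sum>j\<in>UNIV. cl_gen i \<odot> (cl_gen j \<odot> Sop i j f x))"
    by (simp only: cl_mult_add_right sum.distrib)
  also have "(\<Sum>i\<in>UNIV. \<Sum>j\<in>UNIV. cl_gen i \<odot> (cl_gen j \<odot> Sop i j f x)) = - (\<Sum>i\<in>UNIV. Sop i i f x)"
    by (rule cl_gen_symmetric_sum) (simp only: Sop_commute)
  finally have 1: "Dir (V f) x = (\<Sum>i\<in>UNIV. \<Sum>j\<in>UNIV. cl_gen i \<odot> (cl_gen j \<odot> (snd x $ j *\<^sub>R T i f x))) - (\<Sum>i\<in>UNIV. Sop i i f x)"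
    by simp
  have 2: "V (Dir f) x = (\<Sum>i\<in>UNIV. \<Sum>j\<in>UNIV. cl_gen j \<odot> (cl_gen i \<odot> (snd x $ j *\<^sub>R T i f x)))"
    unfolding V_def Dir_def by (subst sum.swap) (simp add: cl_mult_sum_right scaleR_sum_right cl_mult_scaleR_right)
  have "(\<Sum>i\<in>UNIV. \<Sum>j\<in>UNIV. cl_gen i \<odot> (cl_gen j \<odot> (snd x $ j *\<^sub>R T i f x))) + V (Dir f) x =
      - (\<Sum>i\<in>UNIV. 2 *\<^sub>R snd x $ i *\<^sub>R T i f x)"
    unfolding 2 sum.distrib[symmetric] cl_gen_anticommute by (simp add: sum_negf)
  then have 3: "(\<Sum>i\<in>UNIV. \<Sum>j\<in>UNIV. cl_gen i \<odot> (cl_gen j \<odot> (snd x $ j *\<^sub>R T i f x))) =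
      - (\<Sum>i\<in>UNIV. 2 *\<^sub>R snd x $ i *\<^sub>R T i f x) - V (Dir f) x"
    by (simp add: eq_diff_eq)
  have "H f x = (\<Sum>i\<in>UNIV. 2 *\<^sub>R snd x $ i *\<^sub>R T i f x) + (\<Sum>i\<in>UNIV. Sop i i f x)"
    by (simp only: H_eq[OF f] sum.distrib)
  then show ?thesis unfolding 1 3 by simp
qed

lemma CR_add: "f \<in> S \<Longrightarrow> h \<in> S \<Longrightarrow> CR (\<lambda>x. f x + h x) = (\<lambda>x. CR f x + CR h x)"
  by (simp add: CR_def Dir_def pd_rules(3) T_add cl_mult_add_right sum.distrib add_ac)

lemma CR_rad:
  assumes f: "f \<in> S" and g: "g \<in> Rad"
  shows "CR (\<lambda>x. g x *\<^sub>R f x) x = T0 g x *\<^sub>R f x + X g x *\<^sub>R V f x + g x *\<^sub>R CR f x"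
  by (simp add: CR_def Dir_def V_def pd_rules(5)[OF f g] T_rad[OF g f] cl_mult_add_right cl_mult_scaleR_right
    sum.distrib scaleR_add_right scaleR_sum_right mult_ac add_ac)

lemma CR_Lap:
  assumes f: "f \<in> S" shows "CR (Lap f) = Lap (CR f)"
proof -
  have "Lap (Dir f) = Dir (Lap f)"
    unfolding Dir_def by (simp add: Lap_sum S_cl S_T f Lap_cl Lap_T)
  then show ?thesis unfolding CR_def by (simp add: Lap_add S_T0 S_Dir f Lap_T0)
qed

lemma CR_Lap_power: "f \<in> S \<Longrightarrow> (Lap ^^ k) f \<in> S \<and> CR ((Lap ^^ k) f) = (Lap ^^ k) (CR f)"
  by (induction k) (simp_all add: CR_Lap S_Lap)

lemma Lap_V:
  assumes f: "f \<in> S" shows "Lap (V f) = (\<lambda>x. V (Lap f) x + 2 *\<^sub>R Dir f x)"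
proof -
  have "Lap (V f) = (\<lambda>x. \<Sum>j\<in>UNIV. cl_gen j \<odot> Lap (\<lambda>x. snd x $ j *\<^sub>R f x) x)"
    by (simp add: V_def Lap_sum S.coord S_cl f cl_mult_scaleR_right[symmetric] Lap_cl)
  then show ?thesis
    by (simp add: Lap_coord[OF f] V_def Dir_def cl_mult_add_right cl_mult_scaleR_right sum.distrib scaleR_sum_right)
qed

lemma H_zero: "H (\<lambda>_. 0) = (\<lambda>_. 0)"
  by (simp add: H_def T_zero)

lemma H_sum:
  "finite I \<Longrightarrow> (\<And>j. j \<in> I \<Longrightarrow> f j \<in> S) \<Longrightarrow> H (\<lambda>x. \<Sum>j\<in>I. f j x) = (\<lambda>x. \<Sum>j\<in>I. H (f j) x)"
  by (induction rule: finite_induct) (simp_all add: H_zero H_add S_sum)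

lemma H_V:
  assumes f: "f \<in> S" shows "H (V f) = (\<lambda>x. V (H f) x + 2 *\<^sub>R V f x)"
proof -
  have "H (V f) = (\<lambda>x. \<Sum>j\<in>UNIV. cl_gen j \<odot> H (\<lambda>x. snd x $ j *\<^sub>R f x) x)"
    by (simp add: V_def H_sum S.coord S_cl f cl_mult_scaleR_right[symmetric] H_cl)
  then show ?thesis
    by (simp add: H_coord[OF f] V_def cl_mult_add_right cl_mult_scaleR_right sum.distrib scaleR_sum_right)
qed

lemma V_add: "V (\<lambda>x. f x + h x) x = V f x + V h x"
  and V_scale: "V (\<lambda>x. r x *\<^sub>R f x) x = r x *\<^sub>R V f x"
  and V_zero: "V (\<lambda>_. 0) x = 0"
  by (simp_all add: V_def cl_mult_add_right cl_mult_scaleR_right sum.distrib scaleR_add_right scaleR_sum_right mult_ac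
    linear_0[OF linear_cl_mult(2)])

text \<open>\<open>Dir\<close> squares to minus the vector part of the Laplacian, and on a monogenic
  function it acts as minus \<open>T0\<close>, with which it commutes.\<close>

lemma monogenic_harmonic:
  assumes f: "f \<in> S" and m: "CR f = (\<lambda>_. 0)"
  shows "Lap f = (\<lambda>_. 0)"
proof -
  have 1: "Dir f = (\<lambda>x. (-1) *\<^sub>R T0 f x)" using m by (auto simp: CR_def fun_eq_iff add_eq_0_iff)
  have "T0 (Dir f) = (\<lambda>x. (-1) *\<^sub>R T0 (T0 f) x)"
    unfolding 1 by (rule T0_scale[OF S_T0[OF f]])
  moreover have "Dir (Dir f) = (\<lambda>x. (-1) *\<^sub>R Dir (T0 f) x)"
    unfolding 1 by (simp add: Dir_def T_linear[OF bounded_linear_scaleR_right S_T0[OF f], of _ "-1", simplified]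
      linear_neg[OF linear_cl_mult(2)] sum_negf)
  ultimately show ?thesis using Dir_Dir[OF f] T0_Dir[OF f] by (simp add: Lap_def fun_eq_iff)
qed

text \<open>
  Expressed through \<open>H\<close>, the last condition is Euler's formula \<open>(E + x\<^sub>0 \<partial>\<^sub>0) f = ((\<nu> - \<mu>) / 2) f\<close>.
\<close>

definition harmonic :: "real \<Rightarrow> ('n paravec \<Rightarrow> 'b::real_normed_vector) \<Rightarrow> bool"
  where "harmonic \<nu> f \<longleftrightarrow> f \<in> S \<and> Lap f = (\<lambda>_. 0) \<and> H f = (\<lambda>x. \<nu> *\<^sub>R f x - 2 *\<^sub>R fst x *\<^sub>R T0 f x)"

text \<open>\<open>\<nu> - \<mu>\<close> is twice the degree, and an x0 derivative lowers the degree
  by one.\<close>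

lemma harmonic_T0:
  assumes "harmonic \<nu> f" shows "harmonic (\<nu> - 2) (T0 f)"
proof -
  have f: "f \<in> S" and l: "Lap f = (\<lambda>_. 0)" and h: "H f = (\<lambda>x. \<nu> *\<^sub>R f x - 2 *\<^sub>R fst x *\<^sub>R T0 f x)"
    using assms by (auto simp: harmonic_def)
  have h': "H f = (\<lambda>x. \<nu> *\<^sub>R f x + (-2) *\<^sub>R fst x *\<^sub>R T0 f x)" unfolding h by auto
  have "H (T0 f) = (\<lambda>x. \<nu> *\<^sub>R T0 f x + (-2) *\<^sub>R (T0 f x + fst x *\<^sub>R T0 (T0 f) x))"
    unfolding H_T0[OF f] h'
    unfolding pd_rules(3)[OF S_scale[OF f] S_scale[OF S_fst[OF S_T0[OF f]]]] T0_scale[OF f] T0_scale[OF S_fst[OF S_T0[OF f]]]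
      T0_fst[OF S_T0[OF f]] ..
  moreover have "Lap (T0 f) = (\<lambda>_. 0)" unfolding Lap_T0[OF f] l T0_zero ..
  ultimately show ?thesis using f
    by (simp add: harmonic_def S_T0 fun_eq_iff algebra_simps)
qed

lemma harmonic_T0_power: "harmonic \<nu> f \<Longrightarrow> harmonic (\<nu> - 2 * real a) ((T0 ^^ a) f)"
proof (induction a)
  case (Suc a)
  then show ?case using harmonic_T0[of "\<nu> - 2 * real a" "(T0 ^^ a) f"] by (simp add: algebra_simps)
qed simp

text \<open>Euler's formula eliminates \<open>H f\<close>: its \<open>\<nu>\<close> meets the
  \<open>- c\<close> of the radial equation, and its x0 term completes \<open>T0 g\<close> to
  \<open>Y g\<close>.\<close>

lemma Lap_rad_harmonic:
  assumes g: "rad_eigen c g" and f: "harmonic \<nu> f"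
  shows "Lap (\<lambda>x. g x *\<^sub>R f x) x = ((\<nu> - c) * X g x) *\<^sub>R f x + (2 * Y g x) *\<^sub>R T0 f x"
  using f g unfolding harmonic_def rad_eigen_def
  by (auto simp: Lap_rad Y_def algebra_simps)

lemma Rad_powers: "g \<in> Rad \<Longrightarrow> (X ^^ b) g \<in> Rad" "g \<in> Rad \<Longrightarrow> (Y ^^ a) g \<in> Rad"
  by (induction a, induction b) (auto simp: Rad_X Rad_Y)

lemma X_Y_power: "g \<in> Rad \<Longrightarrow> X ((Y ^^ a) g) = (Y ^^ a) (X g)"
  by (induction a) (simp_all add: X_Y Rad_powers)

lemma rad_eigen_powers:
  assumes "rad_eigen c g" shows "rad_eigen (c + 2 * real a + 2 * real b) ((Y ^^ a) ((X ^^ b) g))"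
proof (induction a)
  case 0
  show ?case
  proof (induction b)
    case (Suc b)
    then show ?case using rad_eigen_X[OF Suc] by (simp add: algebra_simps)
  qed (use assms in simp)
next
  case (Suc a)
  then show ?case using rad_eigen_Y[OF Suc] by (simp add: algebra_simps)
qed

lemma Lap_power_formula:
  assumes h: "rad_eigen 3 h" and q: "harmonic (2 * N + 1) q"
  shows "(Lap ^^ k) (\<lambda>x. h x *\<^sub>R q x) =
    (\<lambda>x. \<Sum>a\<le>k. power_coeff N k a *\<^sub>R (Y ^^ a) ((X ^^ (k - a)) h) x *\<^sub>R (T0 ^^ a) q x)"
proof (induction k)
  case 0
  show ?case by (simp add: power_coeff_def)
next
  case (Suc k)
  have hR: "h \<in> Rad" using h by (simp add: rad_eigen_def)
  have qS: "(T0 ^^ a) q \<in> S" for a using harmonic_T0_power[OF q] by (simp add: harmonic_def)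
  define t where "t a x = (Y ^^ a) ((X ^^ (Suc k - a)) h) x *\<^sub>R (T0 ^^ a) q x" for a x
  let ?d = "\<lambda>a. 2 * (N - 1 - real a - real k) * power_coeff N k a"
  let ?F = "\<lambda>a x. (Y ^^ a) ((X ^^ (k - a)) h) x *\<^sub>R (T0 ^^ a) q x"
  have FS: "?F a \<in> S" for a by (intro S.rad Rad_powers hR qS)
  \<comment> \<open>The parameters of the two factors are \<open>3 + 2 * a + 2 * (k - a)\<close> and
    \<open>2 * N + 1 - 2 * a\<close>; their difference is
    \<open>2 * (N - 1 - a - k)\<close>.\<close>
  have step: "Lap (?F a) x = (2 * (N - 1 - real a - real k)) *\<^sub>R t a x + 2 *\<^sub>R t (Suc a) x" if "a \<le> k" for a x
  proof -
    have "X ((Y ^^ a) ((X ^^ (k - a)) h)) = (Y ^^ a) ((X ^^ (Suc k - a)) h)"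
      using that by (simp add: X_Y_power Rad_powers hR Suc_diff_le)
    then show ?thesis
      using Lap_rad_harmonic[OF rad_eigen_powers[OF h, of a "k - a"] harmonic_T0_power[OF q, of a], of x] that
      by (simp add: t_def of_nat_diff algebra_simps)
  qed
  have "(Lap ^^ Suc k) (\<lambda>x. h x *\<^sub>R q x) x = (\<Sum>a\<le>Suc k. power_coeff N (Suc k) a *\<^sub>R t a x)" for x
  proof -
    have "(Lap ^^ Suc k) (\<lambda>x. h x *\<^sub>R q x) x = (\<Sum>a\<le>k. power_coeff N k a *\<^sub>R Lap (?F a) x)"
      unfolding funpow.simps o_apply Suc
      by (subst Lap_sum) (simp_all only: finite_atMost S_scale[OF FS] Lap_scale[OF FS])
    also have "\<dots> = (\<Sum>a\<le>k. ?d a *\<^sub>R t a x) + (\<Sum>a\<le>k. (2 * power_coeff N k a) *\<^sub>R t (Suc a) x)"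
      unfolding sum.distrib[symmetric] by (intro sum.cong refl) (simp add: step scaleR_add_right mult_ac)
    \<comment> \<open>The new summand contains \<open>k choose Suc k = 0\<close>; with it, shifting
      the index aligns this sum with the other one.\<close>
    also have "(\<Sum>a\<le>k. ?d a *\<^sub>R t a x) = (\<Sum>a\<le>Suc k. ?d a *\<^sub>R t a x)"
      by (simp add: power_coeff_def)
    also have "\<dots> = ?d 0 *\<^sub>R t 0 x + (\<Sum>a\<le>k. ?d (Suc a) *\<^sub>R t (Suc a) x)"
      by (rule sum.atMost_Suc_shift)
    also have "?d 0 *\<^sub>R t 0 x + (\<Sum>a\<le>k. ?d (Suc a) *\<^sub>R t (Suc a) x) + (\<Sum>a\<le>k. (2 * power_coeff N k a) *\<^sub>R t (Suc a) x)
        = power_coeff N (Suc k) 0 *\<^sub>R t 0 x + (\<Sum>a\<le>k. power_coeff N (Suc k) (Suc a) *\<^sub>R t (Suc a) x)"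
      unfolding add.assoc sum.distrib[symmetric] scaleR_add_left[symmetric]
      by (simp only: power_coeff_Suc_0 of_nat_0 diff_0_right)
        (intro arg_cong2[of _ _ _ _ "(+)"] refl sum.cong, simp only: power_coeff_Suc_Suc atMost_iff)
    also have "\<dots> = (\<Sum>a\<le>Suc k. power_coeff N (Suc k) a *\<^sub>R t a x)"
      by (rule sum.atMost_Suc_shift[symmetric])
    finally show ?thesis .
  qed
  then show ?case unfolding t_def by (rule ext)
qed

lemma Lap_power_vanish:
  assumes h: "rad_eigen 3 h" and q: "harmonic (2 * real k + 1) q" and z: "(T0 ^^ k) q = (\<lambda>_. 0)"
  shows "(Lap ^^ k) (\<lambda>x. h x *\<^sub>R q x) = (\<lambda>_. 0)"
  unfolding Lap_power_formula[OF h q]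
proof (rule ext, rule sum.neutral, rule ballI)
  fix x a assume "a \<in> {..k}"
  then consider "a < k" | "a = k" by fastforce
  then show "power_coeff (real k) k a *\<^sub>R (Y ^^ a) ((X ^^ (k - a)) h) x *\<^sub>R (T0 ^^ a) q x = 0"
    by cases (simp_all add: power_coeff_top z)
qed

end

section \<open>Homogeneous polynomials\<close>

lemma polynomial_directional_derivative:
  fixes v :: "'a::real_normed_vector"
  assumes "real_polynomial_function p"
  shows "\<exists>q. real_polynomial_function q \<and> (\<forall>x. ((\<lambda>t. p (x + t *\<^sub>R v)) has_real_derivative q x) (at 0))"
  using assms
proof (induction rule: real_polynomial_function.induct)
  case (linear f)
  interpret bounded_linear f by fact
  show ?case
    by (intro exI[of _ "\<lambda>_. f v"] conjI allI) (auto simp: add scaleR intro!: derivative_eq_intros real_polynomial_function.intros(2))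
next
  case (const c)
  show ?case by (intro exI[of _ "\<lambda>_. 0"]) (auto intro: real_polynomial_function.intros(2))
next
  case (add f g)
  then obtain f' g' where "real_polynomial_function f'" "real_polynomial_function g'"
    "\<forall>x. ((\<lambda>t. f (x + t *\<^sub>R v)) has_real_derivative f' x) (at 0)"
    "\<forall>x. ((\<lambda>t. g (x + t *\<^sub>R v)) has_real_derivative g' x) (at 0)" by blast
  then show ?case
    by (intro exI[of _ "\<lambda>x. f' x + g' x"]) (auto intro: real_polynomial_function.intros(3) DERIV_add)
next
  case (mult f g)
  then obtain f' g' where *: "real_polynomial_function f'" "real_polynomial_function g'"
    "\<And>x. ((\<lambda>t. f (x + t *\<^sub>R v)) has_real_derivative f' x) (at 0)"
    "\<And>x. ((\<lambda>t. g (x + t *\<^sub>R v)) has_real_derivative g' x) (at 0)" by blast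
  have "((\<lambda>t. f (x + t *\<^sub>R v) * g (x + t *\<^sub>R v)) has_real_derivative f' x * g x + g' x * f x) (at 0)" for x
    using DERIV_mult[OF *(3,4), of x x] by simp
  moreover have "real_polynomial_function (\<lambda>x. f' x * g x + g' x * f x)"
    by (intro real_polynomial_function.intros(3) real_polynomial_function.intros(4) * mult)
  ultimately show ?case by (intro exI[of _ "\<lambda>x. f' x * g x + g' x * f x"]) simp
qed

definition hom_poly :: "nat \<Rightarrow> ('a::real_normed_vector \<Rightarrow> real) \<Rightarrow> bool"
  where "hom_poly n p \<longleftrightarrow> real_polynomial_function p \<and> (\<forall>c x. p (c *\<^sub>R x) = c ^ n * p x)"

text \<open>Differentiating the scaling law along \<open>v\<close> yields a factor \<open>c\<close>
  that can be cancelled for nonzero \<open>c\<close>. The case \<open>c = 0\<close> follows by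
  continuity; for \<open>n = 0\<close>, with \<open>0 ^ 0 = 1\<close>, it says that the derivative
  is constant.\<close>

lemma hom_poly_derivative:
  fixes p :: "'a::real_normed_vector \<Rightarrow> real"
  assumes "hom_poly (Suc n) p"
  shows "\<exists>q. hom_poly n q \<and> (\<forall>x. ((\<lambda>t. p (x + t *\<^sub>R v)) has_real_derivative q x) (at 0))"
proof -
  have p: "real_polynomial_function p" and hom: "\<And>c x. p (c *\<^sub>R x) = c ^ Suc n * p x"
    using assms by (auto simp: hom_poly_def)
  obtain q where q: "real_polynomial_function q" and
    d: "\<And>x. ((\<lambda>t. p (x + t *\<^sub>R v)) has_real_derivative q x) (at 0)"
    using polynomial_directional_derivative[OF p] by blast
  have ne: "q (c *\<^sub>R x) = c ^ n * q x" if "c \<noteq> 0" for c x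
  proof -
    have "((\<lambda>t. p (c *\<^sub>R x + (c * t) *\<^sub>R v)) has_real_derivative q (c *\<^sub>R x) * c) (at 0)"
      by (rule DERIV_chain2[where f = "\<lambda>t. p (c *\<^sub>R x + t *\<^sub>R v)" and g = "\<lambda>t. c * t"])
        (use d in \<open>auto intro!: derivative_eq_intros\<close>)
    moreover have "p (c *\<^sub>R x + (c * t) *\<^sub>R v) = c ^ Suc n * p (x + t *\<^sub>R v)" for t
      using hom[of c "x + t *\<^sub>R v"] by (simp add: scaleR_add_right)
    ultimately have "((\<lambda>t. c ^ Suc n * p (x + t *\<^sub>R v)) has_real_derivative q (c *\<^sub>R x) * c) (at 0)"
      by simp
    moreover have "((\<lambda>t. c ^ Suc n * p (x + t *\<^sub>R v)) has_real_derivative c ^ Suc n * q x) (at 0)"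
      by (rule DERIV_cmult[OF d])
    ultimately have "q (c *\<^sub>R x) * c = c ^ Suc n * q x" by (rule DERIV_unique)
    then show ?thesis using that by simp
  qed
  have "q (0 *\<^sub>R x) = 0 ^ n * q x" for x
  proof (rule LIM_unique)
    have "isCont q y" for y
      using continuous_real_polymonial_function[OF q] by simp
    then have "isCont (\<lambda>c. q (c *\<^sub>R x)) 0"
      using isCont_o2[of 0 "\<lambda>c. c *\<^sub>R x" q] by simp
    then show "(\<lambda>c. q (c *\<^sub>R x)) \<midarrow>0\<rightarrow> q (0 *\<^sub>R x)" by (simp add: isCont_def)
    have "(\<lambda>c. c ^ n * q x) \<midarrow>0\<rightarrow> 0 ^ n * q x" by (intro tendsto_intros)
    then show "(\<lambda>c. q (c *\<^sub>R x)) \<midarrow>0\<rightarrow> 0 ^ n * q x"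
      by (rule Lim_transform_eventually) (auto simp: eventually_at_filter ne)
  qed
  then have "q (c *\<^sub>R x) = c ^ n * q x" for c x using ne by (cases "c = 0") auto
  then show ?thesis using q d by (auto simp: hom_poly_def)
qed

lemma C1_on_cong:
  assumes "C1_on A f" "open A" "\<And>x. x \<in> A \<Longrightarrow> f x = g x"
  shows "C1_on A g"
proof -
  obtain f' where f': "\<And>x. x \<in> A \<Longrightarrow> (f has_derivative blinfun_apply (f' x)) (at x)" "continuous_on A f'"
    using assms(1) unfolding C1_on_def by blast
  have "(g has_derivative blinfun_apply (f' x)) (at x)" if "x \<in> A" for x
    using has_derivative_transform_within_open[OF f'(1)[OF that] assms(2) that assms(3)] .
  then show ?thesis unfolding C1_on_def using f'(2) by blast
qed

section \<open>From the operators on total functions to their restrictions, and polynomials in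
  \<open>S\<close>\<close>

context axial_dunkl begin

lemma dir_deriv_local:
  assumes "x \<in> U" "\<And>y. y \<in> U \<Longrightarrow> f y = g y"
  shows "dir_deriv v f x = dir_deriv v g x"
  unfolding dir_deriv_def
proof (rule vector_derivative_cong_eq)
  have "((\<lambda>t. x + t *\<^sub>R v) \<longlongrightarrow> x + 0 *\<^sub>R v) (at 0)"
    by (intro tendsto_intros)
  then have "((\<lambda>t. x + t *\<^sub>R v) \<longlongrightarrow> x) (nhds 0)"
    using tendsto_at_iff_tendsto_nhds[of "\<lambda>t. x + t *\<^sub>R v" 0] by simp
  then have "eventually (\<lambda>t. x + t *\<^sub>R v \<in> U) (nhds 0)"
    using open_U assms(1) topological_tendstoD by blast
  then show "eventually (\<lambda>t. t \<in> UNIV \<longrightarrow> f (x + t *\<^sub>R v) = g (x + t *\<^sub>R v)) (nhds 0)"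
    by eventually_elim (simp add: assms(2))
qed auto

text \<open>\<open>U\<close> is open and invariant under reflections, so neither the quotient nor
  its limit at the mirror sees a value outside \<open>U\<close>.\<close>

lemma dunkl_quotient_local:
  assumes "x \<in> U" "\<And>y. y \<in> U \<Longrightarrow> f y = g y"
  shows "dunkl_quotient \<alpha> f x = dunkl_quotient \<alpha> g x"
proof -
  let ?q = "\<lambda>f y. (f y - f (fst y, reflection \<alpha> (snd y))) /\<^sub>R (\<alpha> \<bullet> snd y)"
  have q: "?q f y = ?q g y" if "y \<in> U" for y
    using assms(2)[OF that] assms(2)[of "para_refl \<alpha> y"] that refl_U[of \<alpha> y] by (simp add: para_refl_def)
  have "eventually (\<lambda>y. y \<in> U) (nhds x)" using open_U assms(1) eventually_nhds_in_open by blast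
  then have e: "eventually (\<lambda>y. ?q f y = ?q g y) (at x within A)" for A
    unfolding eventually_at_filter by eventually_elim (use q in auto)
  have "Lim (at x within A) (?q f) = Lim (at x within A) (?q g)" for A
    unfolding Topological_Spaces.Lim_def tendsto_cong[OF e] ..
  then show ?thesis using q[OF assms(1)]
    by (cases "\<alpha> \<bullet> snd x = 0") (simp_all add: dunkl_quotient_def Let_def)
qed

lemma T_restr: "T i (restr f) = T i f" and T0_restr: "T0 (restr f) = T0 f"
proof -
  have "dir_deriv v (restr f) x = dir_deriv v f x" "dunkl_quotient \<alpha> (restr f) x = dunkl_quotient \<alpha> f x" if "x \<in> U" for x v \<alpha>
    using that by (auto intro!: dir_deriv_local dunkl_quotient_local simp: restr_simps)
  then show "T i (restr f) = T i f" "T0 (restr f) = T0 f"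
    by (auto simp: T_def T0_def restr_def dunkl_T_def dunkl_T0_def fun_eq_iff intro!: sum.cong)
qed

text \<open>Outside \<open>U\<close> the iterates may take unspecified values, but by locality these
  never influence the values on \<open>U\<close>.\<close>

lemma restr_laplacian: "restr (dunkl_laplacian Rp \<kappa> f) = Lap (restr f)"
proof -
  have *: "T i (dunkl_T Rp \<kappa> i f) = T i (T i f)" "T0 (dunkl_T0 f) = T0 (T0 f)" for i
    using T_restr[of i "dunkl_T Rp \<kappa> i f"] T0_restr[of "dunkl_T0 f"] by (simp_all add: T_def[of i f] T0_def[of f])
  then show ?thesis
    unfolding Lap_def T_restr T0_restr *[symmetric]
    by (auto simp: fun_eq_iff restr_def dunkl_laplacian_def T_def T0_def)
qed

lemma restr_laplacian_power: "restr ((dunkl_laplacian Rp \<kappa> ^^ k) f) = (Lap ^^ k) (restr f)"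
  by (induction k) (simp_all add: restr_laplacian)

lemma restr_CR: "restr (dunkl_CR Rp \<kappa> f) = CR (restr f)"
  unfolding CR_def Dir_def T_restr T0_restr
  by (auto simp: fun_eq_iff restr_def dunkl_CR_def dunkl_dirac_def T_def T0_def linear_0[OF linear_cl_mult(2)])

lemma S_real_polynomial:
  fixes f :: "'n paravec \<Rightarrow> 'b::real_normed_vector"
  assumes "real_polynomial_function p" "f \<in> S"
  shows "(\<lambda>x. p x *\<^sub>R f x) \<in> S"
  using assms
proof (induction arbitrary: f rule: real_polynomial_function.induct)
  case (linear l)
  have "(\<lambda>x. l x *\<^sub>R f x) = (\<lambda>x. fst x *\<^sub>R l (1, 0) *\<^sub>R f x + (\<Sum>i\<in>UNIV. snd x $ i *\<^sub>R l (0, axis i 1) *\<^sub>R f x))"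
    by (subst paravec_linear_expansion[OF linear(1)]) (simp add: scaleR_add_left scaleR_sum_left)
  then show ?case by (simp only:) (intro S.add S_fst S_sum S.coord S_scale linear finite)
next
  case (const c)
  then show ?case by (rule S_scale)
next
  case (add p q)
  then show ?case by (simp add: scaleR_add_left S.add)
next
  case (mult p q)
  then show ?case using mult.IH(1)[OF mult.IH(2)[OF mult.prems]] by simp
qed

lemma S_polynomial:
  fixes P :: "'n paravec \<Rightarrow> 'b::euclidean_space"
  assumes "polynomial_function P"
  shows "restr P \<in> S"
proof -
  have "restr P = (\<lambda>x. \<Sum>b\<in>Basis. (P x \<bullet> b) *\<^sub>R restr (\<lambda>_. b) x)"
    by (auto simp: restr_def fun_eq_iff euclidean_representation)
  moreover have "real_polynomial_function (\<lambda>x. P x \<bullet> b)" for b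
    using assms bounded_linear_inner_left unfolding polynomial_function_def o_def by blast
  ultimately show ?thesis by (simp only:) (intro S_sum S_real_polynomial S.const finite_Basis)
qed

lemma T0_power_hom_poly: "hom_poly n p \<Longrightarrow> (T0 ^^ Suc n) (restr p) = (\<lambda>_. 0)"
proof (induction n arbitrary: p)
  case 0
  \<comment> \<open>Since \<open>0 ^ 0 = 1\<close>, scaling by zero shows that \<open>p\<close> is
    constant.\<close>
  then have "p (0 *\<^sub>R x) = 0 ^ 0 * p x" for x unfolding hom_poly_def by blast
  then have "p = (\<lambda>_. p 0)" by (auto simp: fun_eq_iff)
  then show ?case using pd_rules(1)[OF S_zero, of "p 0"] by simp
next
  case (Suc n)
  obtain q where q: "hom_poly n q" "\<And>x. ((\<lambda>t. p (x + t *\<^sub>R (1, 0))) has_real_derivative q x) (at 0)"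
    using hom_poly_derivative[OF Suc.prems] by blast
  have "dunkl_T0 p = q"
    using q(2) by (auto simp: fun_eq_iff dunkl_T0_def dir_deriv_def has_real_derivative_iff_has_vector_derivative intro!: vector_derivative_at)
  then have "T0 (restr p) = restr q" unfolding T0_restr by (simp add: T0_def)
  then show ?case using Suc.IH[OF q(1)] by (simp add: funpow_swap1)
qed

lemma T0_power_inner:
  "f \<in> S \<Longrightarrow> (T0 ^^ k) f \<in> S \<and> (T0 ^^ k) (\<lambda>x. f x \<bullet> b) = (\<lambda>x. (T0 ^^ k) f x \<bullet> b)"
  by (induction k) (simp_all add: S_T0 pd_linear(1)[OF bounded_linear_inner_left])

lemma T0_power_homogeneous:
  fixes P :: "'n paravec \<Rightarrow> 'b::euclidean_space"
  assumes P: "homogeneous_polynomial n P"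
  shows "(T0 ^^ Suc n) (restr P) = (\<lambda>_. 0)"
proof (rule ext, rule euclidean_eqI)
  fix x and b :: 'b
  have pS: "restr P \<in> S" using P by (intro S_polynomial) (simp add: homogeneous_polynomial_def)
  have "hom_poly n (\<lambda>x. P x \<bullet> b)"
    using P bounded_linear_inner_left unfolding homogeneous_polynomial_def polynomial_function_def hom_poly_def o_def by force
  from T0_power_hom_poly[OF this]
  have "(T0 ^^ Suc n) (restr (\<lambda>x. P x \<bullet> b)) x = 0" by (simp only:)
  also have "restr (\<lambda>x. P x \<bullet> b) = (\<lambda>x. restr P x \<bullet> b)" by (auto simp: restr_def)
  finally show "(T0 ^^ Suc n) (restr P) x \<bullet> b = 0 \<bullet> b"
    using T0_power_inner[OF pS, of "Suc n" b] by simp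
qed

text \<open>Euler's identity: \<open>P (c *\<^sub>R x)\<close> is differentiated at
  \<open>c = 1\<close>, by the chain rule and as a power of \<open>c\<close>. Solving for the vector
  part leaves the x0 term.\<close>

lemma H_homogeneous:
  fixes P :: "'n paravec \<Rightarrow> 'b::euclidean_space"
  assumes P: "homogeneous_polynomial n P"
  shows "H (restr P) = (\<lambda>x. (2 * real n + \<mu>) *\<^sub>R restr P x - 2 *\<^sub>R fst x *\<^sub>R T0 (restr P) x)"
proof (rule ext)
  fix x
  let ?f = "restr P"
  have f: "?f \<in> S" using P by (intro S_polynomial) (simp add: homogeneous_polynomial_def)
  show "H ?f x = (2 * real n + \<mu>) *\<^sub>R ?f x - 2 *\<^sub>R fst x *\<^sub>R T0 ?f x"
  proof (cases "x \<in> U")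
    case False
    then show ?thesis using S_off[OF S_H[OF f]] S_off[OF S_T0[OF f]] S_off[OF f] by simp
  next
    case x: True
    let ?D = "\<lambda>h. fst h *\<^sub>R T0 ?f x + (\<Sum>i\<in>UNIV. snd h $ i *\<^sub>R pd i ?f x)"
    have "(?f has_derivative ?D) (at x)" by (rule S_has_derivative[OF f x])
    then have "(P has_derivative ?D) (at x)"
      by (rule has_derivative_transform_within_open[OF _ open_U x]) (simp add: restr_simps)
    then have "(P has_derivative ?D) (at ((1::real) *\<^sub>R x))" by simp
    moreover have "((\<lambda>c. c *\<^sub>R x) has_derivative (\<lambda>c. c *\<^sub>R x)) (at (1::real))"
      by (auto intro!: derivative_eq_intros)
    ultimately have 1: "((\<lambda>c. P (c *\<^sub>R x)) has_derivative (\<lambda>c. ?D (c *\<^sub>R x))) (at 1)"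
      by - (rule has_derivative_compose[where g = P and f = "\<lambda>c. c *\<^sub>R x"])
    have "((\<lambda>c. c ^ n *\<^sub>R P x) has_derivative (\<lambda>c. (real n * c) *\<^sub>R P x)) (at 1)"
      by (auto intro!: derivative_eq_intros)
    moreover have "(\<lambda>c. P (c *\<^sub>R x)) = (\<lambda>c. c ^ n *\<^sub>R P x)"
      using P unfolding homogeneous_polynomial_def by (intro ext) blast
    ultimately have "(\<lambda>c. ?D (c *\<^sub>R x)) = (\<lambda>c. (real n * c) *\<^sub>R P x)"
      using has_derivative_unique[OF 1] by simp
    from fun_cong[OF this, of 1] have "?D x = real n *\<^sub>R ?f x" using x by (simp add: restr_simps)
    then have sum_eq: "(\<Sum>i\<in>UNIV. snd x $ i *\<^sub>R pd i ?f x) = real n *\<^sub>R ?f x - fst x *\<^sub>R T0 ?f x"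
      by (simp add: eq_diff_eq add.commute)
    show ?thesis unfolding H_euler[OF f] sum_eq by (simp add: algebra_simps)
  qed
qed

lemma harmonic_add:
  assumes "harmonic \<nu> f" "harmonic \<nu> h"
  shows "harmonic \<nu> (\<lambda>x. f x + h x)"
  using assms unfolding harmonic_def
  by (auto simp: S.add Lap_add H_add pd_rules(3) algebra_simps)

lemma harmonic_scale:
  assumes "harmonic \<nu> f"
  shows "harmonic \<nu> (\<lambda>x. c *\<^sub>R f x)"
  using assms unfolding harmonic_def
  by (auto simp: S_scale Lap_scale H_linear[OF bounded_linear_scaleR_right] T0_scale algebra_simps)

text \<open>Multiplying by x0 contributes \<open>2 *\<^sub>R T0 G x\<close> to the Laplacian,
  multiplying by the vector variable \<open>2 *\<^sub>R Dir G x\<close>; the sum is twice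
  \<open>CR G\<close>, which is why \<open>G\<close> must be monogenic. The degree rises by one, so
  the parameter by two.\<close>

lemma harmonic_shift:
  assumes G: "harmonic (\<nu> - 2) G" and m: "CR G = (\<lambda>_. 0)"
  shows "harmonic \<nu> (\<lambda>x. fst x *\<^sub>R G x + V G x)"
proof -
  have g: "G \<in> S" and l: "Lap G = (\<lambda>_. 0)" and h: "H G = (\<lambda>x. (\<nu> - 2) *\<^sub>R G x - 2 *\<^sub>R fst x *\<^sub>R T0 G x)"
    using G by (auto simp: harmonic_def)
  have "Lap (\<lambda>x. fst x *\<^sub>R G x + V G x) = (\<lambda>x. 2 *\<^sub>R CR G x)"
    unfolding Lap_add[OF S_fst[OF g] S_V[OF g]] Lap_fst[OF g] Lap_V[OF g] l
    by (simp add: V_zero CR_def scaleR_add_right)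
  moreover have "V (H G) x = (\<nu> - 2) *\<^sub>R V G x - 2 *\<^sub>R fst x *\<^sub>R V (T0 G) x" for x
  proof -
    have "H G = (\<lambda>x. (\<nu> - 2) *\<^sub>R G x + (- 2 * fst x) *\<^sub>R T0 G x)" unfolding h by auto
    then show ?thesis by (simp only: V_add V_scale) simp
  qed
  then have "H (\<lambda>x. fst x *\<^sub>R G x + V G x) = (\<lambda>x. \<nu> *\<^sub>R (fst x *\<^sub>R G x + V G x) - 2 *\<^sub>R fst x *\<^sub>R (G x + fst x *\<^sub>R T0 G x + V (T0 G) x))"
    unfolding H_add[OF S_fst[OF g] S_V[OF g]] H_fst[OF g] H_V[OF g]
    by (simp only:) (simp add: h algebra_simps)
  moreover have "T0 (\<lambda>x. fst x *\<^sub>R G x + V G x) = (\<lambda>x. G x + fst x *\<^sub>R T0 G x + V (T0 G) x)"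
    unfolding pd_rules(3)[OF S_fst[OF g] S_V[OF g]] T0_fst[OF g] T0_V[OF g] ..
  ultimately show ?thesis using g by (simp add: harmonic_def S.add S_fst S_V m)
qed

section \<open>Axial functions\<close>

definition re_part :: "(complex \<Rightarrow> complex) \<Rightarrow> 'n paravec \<Rightarrow> real"
  where "re_part \<phi> = restr (\<lambda>x. Re (\<phi> (zc x)))"

definition inv_r :: "'n paravec \<Rightarrow> real"
  where "inv_r = restr (\<lambda>x. inverse (norm (snd x)))"

lemma Rad_re_part: "\<phi> holomorphic_on \<Omega> \<Longrightarrow> re_part \<phi> \<in> Rad"
  and T0_re_part: "\<phi> holomorphic_on \<Omega> \<Longrightarrow> T0 (re_part \<phi>) = re_part (deriv \<phi>)"
  and X_re_part: "\<phi> holomorphic_on \<Omega> \<Longrightarrow> X (re_part \<phi>) = (\<lambda>x. re_part (\<lambda>z. \<i> * deriv \<phi> z) x * inv_r x)"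
  unfolding re_part_def inv_r_def by (rule Rad.Re, assumption, rule rad_derivD[OF rad_deriv_Re], assumption, rule rad_derivD[OF rad_deriv_Re], assumption)

lemma re_part_cong: "(\<And>z. z \<in> \<Omega> \<Longrightarrow> \<phi> z = \<psi> z) \<Longrightarrow> re_part \<phi> = re_part \<psi>"
  by (auto simp: re_part_def restr_def U_iff)

lemma re_part_cmult:
  assumes "\<phi> holomorphic_on \<Omega>"
  shows "T0 (re_part (\<lambda>z. c * \<phi> z)) = re_part (\<lambda>z. c * deriv \<phi> z)"
    "X (re_part (\<lambda>z. c * \<phi> z)) = (\<lambda>x. re_part (\<lambda>z. \<i> * c * deriv \<phi> z) x * inv_r x)"
    "re_part (\<lambda>z. c * \<phi> z) \<in> Rad"
proof -
  have d: "deriv (\<lambda>z. c * \<phi> z) z = c * deriv \<phi> z" if "z \<in> \<Omega>" for z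
    using assms open_\<Omega> that by (intro deriv_cmult) (auto simp: holomorphic_on_imp_differentiable_at)
  have h: "(\<lambda>z. c * \<phi> z) holomorphic_on \<Omega>" by (rule holomorphic_on_mult[OF holomorphic_on_const assms])
  show "T0 (re_part (\<lambda>z. c * \<phi> z)) = re_part (\<lambda>z. c * deriv \<phi> z)"
    unfolding T0_re_part[OF h] by (rule re_part_cong) (rule d)
  have "re_part (\<lambda>z. \<i> * deriv (\<lambda>z. c * \<phi> z) z) = re_part (\<lambda>z. \<i> * c * deriv \<phi> z)"
    by (rule re_part_cong) (simp add: d)
  then show "X (re_part (\<lambda>z. c * \<phi> z)) = (\<lambda>x. re_part (\<lambda>z. \<i> * c * deriv \<phi> z) x * inv_r x)"
    unfolding X_re_part[OF h] by (simp only:)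
  show "re_part (\<lambda>z. c * \<phi> z) \<in> Rad" by (rule Rad_re_part[OF h])
qed

lemma inv_r_rules: "inv_r \<in> Rad" "T0 inv_r = (\<lambda>_. 0)" "X inv_r = (\<lambda>x. - (inv_r x * (inv_r x * inv_r x)))"
  using Rad.inv rad_derivD[OF rad_deriv_inv] unfolding inv_r_def by (auto simp: restr_def)

lemma r2_inv_r: "g \<in> Rad \<Longrightarrow> r2 x * (inv_r x * (inv_r x * g x)) = g x"
  using U_snd_nonzero[of x] Rad_zero[of g x]
  by (cases "x \<in> U") (auto simp: inv_r_def restr_def r2_def dot_square_norm power2_eq_square field_simps)

text \<open>As \<open>X h\<close> is \<open>v_r / r\<^sup>2 - v / r\<^sup>3\<close>, the last two
  claims are the Cauchy-Riemann equations. The 3 arises because \<open>v\<close> is harmonic in the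
  half plane: the planar Laplacian of v / r is \<open>- 2 * X h x\<close>, and \<open>L0\<close> is
  the planar Laplacian minus \<open>X\<close>.\<close>

lemma axial_radial:
  fixes f
  defines "u \<equiv> re_part f" and "h \<equiv> (\<lambda>x. re_part (\<lambda>z. - \<i> * f z) x * inv_r x)"
  assumes f: "f holomorphic_on \<Omega>"
  shows "u \<in> Rad" "rad_eigen 3 h" "T0 u x - r2 x * X h x = h x" "X u x + T0 h x = 0"
proof -
  have f': "deriv f holomorphic_on \<Omega>" using f open_\<Omega> by (rule holomorphic_deriv)
  \<comment> \<open>\<open>a\<close> and \<open>b\<close> are the real and imaginary part of the
    derivative, so \<open>a = u_0 = v_r\<close> and \<open>b = v_0 = - u_r\<close>; the primed
    versions belong to the second derivative.\<close>
  define v a b a' b' where "v = re_part (\<lambda>z. - \<i> * f z)" and "a = re_part (deriv f)"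
    and "b = re_part (\<lambda>z. - \<i> * deriv f z)" and "a' = re_part (deriv (deriv f))"
    and "b' = re_part (\<lambda>z. - \<i> * deriv (deriv f) z)"
  have R: "v \<in> Rad" "a \<in> Rad" "b \<in> Rad" "a' \<in> Rad" "b' \<in> Rad" "inv_r \<in> Rad"
    unfolding v_def a_def b_def a'_def b'_def
    by (intro re_part_cmult Rad_re_part f f' inv_r_rules holomorphic_deriv open_\<Omega>)+
  have i: "re_part (\<lambda>z. \<i> * \<phi> z) = (\<lambda>x. - re_part (\<lambda>z. - \<i> * \<phi> z) x)" for \<phi>
    by (auto simp: re_part_def restr_def)
  have v: "T0 v = b" "X v = (\<lambda>x. a x * inv_r x)"
    unfolding v_def b_def a_def re_part_cmult[OF f] by simp_all
  have a: "T0 a = a'" "X a = (\<lambda>x. - b' x * inv_r x)"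
    unfolding a_def a'_def b'_def T0_re_part[OF f'] X_re_part[OF f'] i by simp_all
  have b: "T0 b = b'" "X b = (\<lambda>x. a' x * inv_r x)"
    unfolding b_def b'_def a'_def re_part_cmult[OF f'] by simp_all
  have u: "T0 u = a" "X u = (\<lambda>x. - b x * inv_r x)"
    unfolding u_def a_def b_def T0_re_part[OF f] X_re_part[OF f] i by simp_all
  have h: "h = (\<lambda>x. v x * inv_r x)" unfolding h_def v_def ..
  have hR: "h \<in> Rad" unfolding h by (intro Rad.mult R)
  note inv_r = inv_r_rules(2,3)
  have T0h: "T0 h = (\<lambda>x. b x * inv_r x)" unfolding h rad_mult(1)[OF R(1,6)] v inv_r by simp
  have Xh: "X h = (\<lambda>x. a x * (inv_r x * inv_r x) - v x * (inv_r x * (inv_r x * inv_r x)))"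
    unfolding h rad_mult(2)[OF R(1,6)] v inv_r by (simp add: algebra_simps)
  have ww: "(\<lambda>x. inv_r x * inv_r x) \<in> Rad" "(\<lambda>x. inv_r x * (inv_r x * inv_r x)) \<in> Rad" by (intro Rad.mult R)+
  have T0T0h: "T0 (T0 h) = (\<lambda>x. b' x * inv_r x)" unfolding T0h rad_mult(1)[OF R(3,6)] b inv_r by simp
  have XXh: "X (X h) x = inv_r x * (inv_r x * (- 3 * X h x - T0 (T0 h) x))" for x
    unfolding T0T0h unfolding Xh rad_diff(3)[OF Rad.mult[OF R(2) ww(1)] Rad.mult[OF R(1) ww(2)]]
      rad_mult(2)[OF R(2) ww(1)] rad_mult(2)[OF R(1) ww(2)] rad_mult(2)[OF R(6) ww(1)] rad_mult(2)[OF R(6,6)] v a inv_r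
    by (simp add: algebra_simps)
  show "u \<in> Rad" unfolding u_def by (rule Rad_re_part[OF f])
  show "X u x + T0 h x = 0" unfolding u T0h by simp
  have r: "r2 x * (a x * (inv_r x * inv_r x)) = a x" "r2 x * (v x * (inv_r x * (inv_r x * inv_r x))) = v x * inv_r x" for x
    using r2_inv_r[OF R(2), of x] r2_inv_r[OF Rad.mult[OF R(1,6)], of x] by (simp_all add: mult_ac)
  show "T0 u x - r2 x * X h x = h x" unfolding u Xh unfolding h right_diff_distrib r by simp
  have "(\<lambda>x. - 3 * X h x - T0 (T0 h) x) \<in> Rad"
    by (intro rad_diff Rad_cmult Rad_X Rad_T0 hR)
  note r = r2_inv_r[OF this]
  show "rad_eigen 3 h"
    unfolding rad_eigen_def L0_def XXh r using hR by simp
qed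

lemma harmonic_S: "harmonic \<nu> f \<Longrightarrow> f \<in> S"
  by (simp add: harmonic_def)

lemma Lap_power_scale: "f \<in> S \<Longrightarrow> (Lap ^^ k) f \<in> S \<and> (Lap ^^ k) (\<lambda>x. c *\<^sub>R f x) = (\<lambda>x. c *\<^sub>R (Lap ^^ k) f x)"
  by (induction k) (simp_all add: S_Lap Lap_scale)

lemma axial_fueter:
  assumes f: "f holomorphic_on \<Omega>" and P: "homogeneous_polynomial n P"
    and m: "dunkl_monogenic_on UNIV Rp \<kappa> P" and N: "2 * real N = 2 * real n + \<mu> - 1" "n < N"
  shows "dunkl_monogenic_on U Rp \<kappa> ((dunkl_laplacian Rp \<kappa> ^^ N) (\<lambda>x. axial_fun f x \<odot> P x))"
proof -
  define p where "p = restr P"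
  define u where "u = re_part f"
  define h where "h = (\<lambda>x. re_part (\<lambda>z. - \<i> * f z) x * inv_r x)"
  define F where "F = restr (\<lambda>x. axial_fun f x \<odot> P x)"
  note rad = axial_radial[OF f, folded u_def h_def]
  have hR: "h \<in> Rad" using rad(2) by (simp add: rad_eigen_def)
  have p: "p \<in> S" unfolding p_def using P by (intro S_polynomial) (simp add: homogeneous_polynomial_def)
  have CRp: "CR p = (\<lambda>_. 0)"
    using m unfolding p_def restr_CR[symmetric] dunkl_monogenic_on_def by (auto simp: restr_def)
  \<comment> \<open>Euler's formula has the parameter \<open>2 * n + \<mu>\<close>, which is
    \<open>2 * N + 1\<close> by the choice of \<open>N\<close>.\<close>
  have harm_p: "harmonic (2 * real N + 1) p"
    unfolding harmonic_def N using p monogenic_harmonic[OF p CRp] H_homogeneous[OF P] by (simp add: p_def)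
  define q0 where "q0 = T0 p"
  \<comment> \<open>The origin of \<open>q\<close> is
    \<open>CR (V p) x = 2 *\<^sub>R q x - p x\<close>, shown below: its last term is half of what
    remains of the Euler term \<open>- (2 * N + 1)\<close> once \<open>- p\<close> is set
    apart.\<close>
  define q where "q = (\<lambda>x. (fst x *\<^sub>R q0 x + V q0 x) + (- real N) *\<^sub>R p x)"
  have q0: "harmonic (2 * real N + 1 - 2) q0" unfolding q0_def by (rule harmonic_T0[OF harm_p])
  have CRq0: "CR q0 = (\<lambda>_. 0)" unfolding q0_def T0_CR[OF p, symmetric] CRp T0_zero ..
  have q: "harmonic (2 * real N + 1) q"
    unfolding q_def by (intro harmonic_add harmonic_shift harmonic_scale q0 CRq0 harm_p)
  have T0p: "(T0 ^^ k) p \<in> S" for k using harmonic_S[OF harmonic_T0_power[OF harm_p]] .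
  \<comment> \<open>Each further \<open>T0\<close> also hits the factor x0 once, which raises the
    coefficient \<open>- N\<close> of the last term by one.\<close>
  have "(T0 ^^ k) q = (\<lambda>x. (fst x *\<^sub>R (T0 ^^ Suc k) p x + V ((T0 ^^ Suc k) p) x) + (real k - real N) *\<^sub>R (T0 ^^ k) p x)" for k
  proof (induction k)
    case (Suc k)
    let ?p = "(T0 ^^ k) p"
    have "(T0 ^^ Suc k) q = T0 (\<lambda>x. (fst x *\<^sub>R (T0 ^^ Suc k) p x + V ((T0 ^^ Suc k) p) x) + (real k - real N) *\<^sub>R (T0 ^^ k) p x)"
      by (simp only: funpow.simps o_apply Suc)
    also have "\<dots> = (\<lambda>x. (((T0 ^^ Suc k) p x + fst x *\<^sub>R T0 ((T0 ^^ Suc k) p) x) + V (T0 ((T0 ^^ Suc k) p)) x) + (real k - real N) *\<^sub>R T0 ((T0 ^^ k) p) x)"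
      unfolding pd_rules(3)[OF S.add[OF S_fst[OF T0p] S_V[OF T0p]] S_scale[OF T0p]]
        pd_rules(3)[OF S_fst[OF T0p] S_V[OF T0p]] T0_fst[OF T0p] T0_V[OF T0p] T0_scale[OF T0p] ..
    finally show ?case by (simp add: algebra_simps)
  qed (simp add: q_def q0_def)
  moreover have zero: "(T0 ^^ k) (\<lambda>_. 0) = (\<lambda>_. 0)" for k
    by (induction k) (simp_all add: T0_zero)
  have "(T0 ^^ k) p = (\<lambda>_. 0)" if "k > n" for k
  proof -
    have "(T0 ^^ ((k - Suc n) + Suc n)) p = (\<lambda>_. 0)"
      unfolding funpow_add o_apply p_def T0_power_homogeneous[OF P] by (rule zero)
    then show ?thesis using that by simp
  qed
  ultimately have q_zero: "(T0 ^^ N) q = (\<lambda>_. 0)"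
    using N(2) by (simp add: V_zero del: funpow.simps)
  have F: "F = (\<lambda>x. u x *\<^sub>R p x + h x *\<^sub>R V p x)"
  proof (rule ext)
    fix x
    show "F x = u x *\<^sub>R p x + h x *\<^sub>R V p x"
    proof (cases "x \<in> U")
      case True
      have "cl_vec (snd x /\<^sub>R norm (snd x)) \<odot> P x = inverse (norm (snd x)) *\<^sub>R V p x"
        using True by (simp add: cl_vec_def V_def p_def restr_simps linear_sum[OF linear_cl_mult(1)] linear_cmul[OF linear_cl_mult(1)]
          scaleR_sum_right)
      then show ?thesis using True
        by (simp add: F_def restr_simps axial_fun_def case_prod_unfold linear_add[OF linear_cl_mult(1)] linear_cmul[OF linear_cl_mult(1)]
          cl_mult_one u_def h_def re_part_def inv_r_def p_def zc_def)
    qed (simp add: F_def restr_simps u_def h_def re_part_def inv_r_def)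
  qed
  have V: "V p \<in> S" by (rule S_V[OF p])
  have FS: "F \<in> S" unfolding F by (intro S.add S.rad rad(1) hR p V)
  have "CR F = (\<lambda>x. 2 *\<^sub>R h x *\<^sub>R q x)"
  proof (rule ext)
    fix x
    have dir: "Dir p = (\<lambda>x. (- 1) *\<^sub>R T0 p x)" using CRp by (auto simp: CR_def fun_eq_iff add_eq_0_iff)
    have "V (Dir p) x = - V (T0 p) x" unfolding dir V_scale by simp
    then have "CR (V p) x = 2 *\<^sub>R V q0 x - H p x"
      by (simp add: CR_def T0_V[OF p] Dir_V[OF p] q0_def scaleR_2)
    also have "H p x = (2 * real N + 1) *\<^sub>R p x - 2 *\<^sub>R fst x *\<^sub>R q0 x"
      using harm_p by (simp add: harmonic_def q0_def)
    also have "2 *\<^sub>R V q0 x - ((2 * real N + 1) *\<^sub>R p x - 2 *\<^sub>R fst x *\<^sub>R q0 x) = 2 *\<^sub>R q x - p x"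
      by (simp add: q_def algebra_simps)
    finally have CRV: "CR (V p) x = 2 *\<^sub>R q x - p x" .
    have "CR F x = (T0 u x *\<^sub>R p x + X u x *\<^sub>R V p x) + (T0 h x *\<^sub>R V p x - (X h x * r2 x) *\<^sub>R p x + h x *\<^sub>R (2 *\<^sub>R q x - p x))"
      unfolding F CR_add[OF S.rad[OF rad(1) p] S.rad[OF hR V]] CR_rad[OF p rad(1)] CR_rad[OF V hR] CRV V_V CRp
      by simp
    also have "\<dots> = (T0 u x - r2 x * X h x) *\<^sub>R p x + (X u x + T0 h x) *\<^sub>R V p x + h x *\<^sub>R (2 *\<^sub>R q x - p x)"
      by (simp add: algebra_simps)
    \<comment> \<open>By the Cauchy-Riemann identities the first bracket is \<open>h x\<close>,
      cancelling the \<open>- p x\<close>, and the second is 0.\<close>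
    also have "\<dots> = 2 *\<^sub>R h x *\<^sub>R q x"
      using rad(3,4)[of x] unfolding h_def by (simp add: algebra_simps)
    finally show "CR F x = 2 *\<^sub>R h x *\<^sub>R q x" .
  qed
  then have "CR ((Lap ^^ N) F) = (\<lambda>_. 0)"
    using CR_Lap_power[OF FS, of N] Lap_power_scale[OF S.rad[OF hR harmonic_S[OF q]], of N 2] Lap_power_vanish[OF rad(2) q q_zero]
    by simp
  then have "restr (dunkl_CR Rp \<kappa> ((dunkl_laplacian Rp \<kappa> ^^ N) (\<lambda>x. axial_fun f x \<odot> P x))) = (\<lambda>_. 0)"
    by (simp add: restr_CR restr_laplacian_power F_def)
  moreover have "C1_on U ((Lap ^^ N) F)"
    using S_C1_on CR_Lap_power[OF FS] by blast
  then have "C1_on U ((dunkl_laplacian Rp \<kappa> ^^ N) (\<lambda>x. axial_fun f x \<odot> P x))"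
    by (rule C1_on_cong[OF _ open_U]) (simp add: F_def restr_laplacian_power[symmetric] restr_simps)
  ultimately show ?thesis
    unfolding dunkl_monogenic_on_def by (auto simp: restr_def fun_eq_iff split: if_splits)
qed

end

theorem theorem4p3:
  fixes R Rp :: "(real, 'n::{finite,linorder}) vec set"
    and \<kappa> :: "(real, 'n) vec \<Rightarrow> real"
    and \<Omega> :: "complex set"
    and f :: "complex \<Rightarrow> complex"
    and P :: "'n paravec \<Rightarrow> 'n clifford"
    and n :: nat
    and m :: int
  assumes "root_system R"
    and "positive_subsystem R Rp"
    and "multiplicity_function R \<kappa>"
    and "gamma_kappa Rp \<kappa> > 0"
    and "open \<Omega>"
    and "\<Omega> \<subseteq> {z. Im z > 0}"
    and "f holomorphic_on \<Omega>"
    and "homogeneous_polynomial n P"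
    and "dunkl_monogenic_on UNIV Rp \<kappa> P"
    and "dunkl_dim Rp \<kappa> = real_of_int m"
    and "odd m"
  shows "dunkl_monogenic_on (axial_set \<Omega>) Rp \<kappa>
    ((dunkl_laplacian Rp \<kappa> ^^ (n + nat ((m - 1) div 2))) (\<lambda>x. axial_fun f x \<odot> P x))"
proof -
  interpret axial_dunkl R Rp \<kappa> \<Omega>
    by standard (fact assms)+
  \<comment> \<open>With \<open>gamma_kappa\<close> positive this makes the Dunkl dimension exceed
    1; being odd, it is at least 3, so \<open>k > 0\<close> and the number of Laplacians exceeds
    \<open>n\<close>.\<close>
  have "real CARD('n) \<ge> 1" by (simp add: Suc_leI)
  then have "real_of_int m > 1" using assms(4,10) unfolding dunkl_dim_def by linarith
  then have "m > 1" by linarith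
  then obtain k where k: "m = 2 * k + 1" "k > 0" using \<open>odd m\<close> by (auto elim!: oddE)
  have "dunkl_monogenic_on U Rp \<kappa> ((dunkl_laplacian Rp \<kappa> ^^ (n + nat k)) (\<lambda>x. axial_fun f x \<odot> P x))"
    by (rule axial_fueter[OF assms(7-9)]) (use k assms(10) in \<open>simp_all add: \<mu>_def\<close>)
  then show ?thesis using k by (simp add: U_def)
qed

end
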